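(* Let $\mathcal H,\mathcal K$ be separable complex Hilbert spaces. Assume that: (i) $H_0$ is a densely defined, closed linear operator in $\mathcal H$ with $\rho(H_0)\ne\emptyset$, and $V_1,V_2$ are densely defined, closed linear operators from $\mathcal H$ to $\mathcal K$ with $\operatorname{dom}(V_1)\supseteq\operatorname{dom}(H_0)$ and $\operatorname{dom}(V_2)\supseteq\operatorname{dom}(H_0^* )$; write $R_0(z)=(H_0-zI_{\mathcal H})^{-1}$, $z\in\rho(H_0)$; (ii) for some (and hence for all) $z\in\rho(H_0)$, the operator $-V_1R_0(z)V_2^*$, defined on $\operatorname{dom}(V_2^* )$, has a bounded extension to $\mathcal K$, denoted by $K(z)=-\overline{V_1R_0(z)V_2^*}\in\mathcal B(\mathcal K)$; (iii) $1\in\rho(K(z_1))$ for some $z_1\in\rho(H_0)$; (iv) $[I_{\mathcal K}-K(z)]\in\Phi(\mathcal K)$ for all $z\in\rho(H_0)$. Let $H$ be the densely defined, closed linear operator in $\mathcal H$ determined by $$(H-zI_{\mathcal H})^{-1}=R_0(z)-\overline{R_0(z)V_2^*}\,[I_{\mathcal K}-K(z)]^{-1}V_1R_0(z),\quad z\in\{\zeta\in\rho(H_0)\,|\,1\in\rho(K(\zeta))\}.$$ Suppose that $z_0\in\sigma_d(H_0)\cap\sigma(H)$ with $D(z_0;\varepsilon_0)\cap\sigma(H)=\{z_0\}$ for some sufficiently small $\varepsilon_0=\varepsilon_0(z_0)>0$ (in particular, $D(z_0;\varepsilon_0)\setminus\{z_0\}\subset\rho(H_0)$). Then $K(\cdot)$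 is analytic on $\rho(H_0)$ and finitely meromorphic on $D(z_0;\varepsilon_0)$; in particular, near $z_0$, $$K(z)=\sum_{k=-N_0}^\infty(z-z_0)^kK_k(z_0),\quad 0<|z-z_0|<\varepsilon_0,$$ for some $N_0=N_0(z_0)\in\mathbb N$, with $K_{-k}(z_0)\in\mathcal F(\mathcal K)$ for $1\le k\le N_0$ and $K_k(z_0)\in\mathcal B(\mathcal K)$ for $k\in\mathbb N\cup\{0\}$. Assume in addition that $[I_{\mathcal K}-K_0(z_0)]\in\Phi(\mathcal K)$. Then $z_0$ is a discrete eigenvalue of $H$, $z_0\in\sigma_d(H)$, and for $0<\varepsilon_1<\varepsilon_0$ the function $M(\cdot)=I_{\mathcal K}-K(\cdot)$ satisfies the following on $\Omega=D(z_0;\varepsilon_1)$: $M$ is analytic on $\Omega\setminus\{z_0\}$ and finitely meromorphic on $\Omega$; $M(z)\in\Phi(\mathcal K)$ for all $z\in\Omega\setminus\{z_0\}$; the zeroth-order Laurent coefficient of $M$ at $z_0$ belongs to $\Phi(\mathcal K)$; and $M(\cdot)$ is boundedly invertible on a sufficiently small punctured disk centered at $z_0$. In addition, $$m_a(z_0;H)=m_a(z_0;H_0)+\operatorname{ind}_{C(z_0;\varepsilon)}(I_{\mathcal K}-K(\cdot)),\quad 0<\varepsilon<\varepsilon_1.$$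
   Context: $D(z_0;r)$ is the open disk with center $z_0$ and radius $r$, and $C(z_0;r)=\partial D(z_0;r)$. $\overline S$ is the closure of a closable operator $S$. $\mathcal B(\mathcal K)$, $\mathcal F(\mathcal K)$, $\Phi(\mathcal K)$ denote the bounded, finite rank, and bounded Fredholm operators on $\mathcal K$ (Fredholm: $\dim\ker(T)<\infty$, $\operatorname{ran}(T)$ closed, $\dim\ker(T^* )<\infty$). Under (i)--(iii) one has $V_1R_0(z)\in\mathcal B(\mathcal H,\mathcal K)$ and $\overline{R_0(z)V_2^*}=[V_2(H_0^*-\overline zI_{\mathcal H})^{-1}]^*\in\mathcal B(\mathcal K,\mathcal H)$ for $z\in\rho(H_0)$, and it is known (Kato) that the displayed formula is the resolvent of a uniquely determined densely defined, closed operator $H$, independent of $z$ (formally $H=H_0+V_2^*V_1$). For a densely defined closed operator $T$ and an isolated point $z_0$ of $\sigma(T)$ that is an eigenvalue, $m_a(z_0;T)$ is the dimension of the range of the Riesz projection $\frac{-1}{2\pi i}\oint_{C(z_0;\varepsilon)}(T-\zeta)^{-1}d\zeta$ ($\varepsilon>0$ small, counterclockwise). The discrete spectrum $\sigma_d(T)$ is the set of eigenvalues $z$ of $T$ that are isolated points of $\sigma(T)$ with $m_a(z;T)<\infty$. A $\mathcal B(\mathcal K)$-valued function $M(\cdot)$, analytic on an open connected set except for isolated singularities, is finitely meromorphic at $z_0$ if it is analytic in a punctured disk about $z_0$ and has there a norm convergent Laurent expansion $\sum_{k\ge-N_0}(z-z_0)^kM_k(z_0)$ with finitely many negative powers, all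 of whose coefficients $M_{-k}(z_0)$, $1\le k\le N_0$, are of finite rank (possibly zero); it is finitely meromorphic on an open set if it is meromorphic there and finitely meromorphic at each of its poles. For $M(\cdot)$ finitely meromorphic at $z_0$, Fredholm-valued in a punctured disk about $z_0$, with zeroth Laurent coefficient $M_0(z_0)$ Fredholm, and boundedly invertible on a punctured disk about $z_0$, the index with respect to the counterclockwise oriented circle $C(z_0;\varepsilon)$ is $$\operatorname{ind}_{C(z_0;\varepsilon)}(M(\cdot))=\operatorname{tr}_{\mathcal K}\Big(\frac1{2\pi i}\oint_{C(z_0;\varepsilon)}M'(\zeta)M(\zeta)^{-1}\,d\zeta\Big)=\operatorname{tr}_{\mathcal K}\Big(\frac1{2\pi i}\oint_{C(z_0;\varepsilon)}M(\zeta)^{-1}M'(\zeta)\,d\zeta\Big),$$ the integrals being finite rank operators. *)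

theory Defs
  imports "HOL-Complex_Analysis.Complex_Analysis"
begin

section \<open>Complex normed spaces and complex Hilbert spaces\<close>

class complex_normed_vector = real_normed_vector +
  fixes scaleC :: "complex \<Rightarrow> 'a \<Rightarrow> 'a" (infixr "*\<^sub>C" 75)
  assumes scaleC_add_right: "a *\<^sub>C (x + y) = a *\<^sub>C x + a *\<^sub>C y"
    and scaleC_add_left: "(a + b) *\<^sub>C x = a *\<^sub>C x + b *\<^sub>C x"
    and scaleC_scaleC: "a *\<^sub>C b *\<^sub>C x = (a * b) *\<^sub>C x"
    and scaleC_of_real: "complex_of_real r *\<^sub>C x = r *\<^sub>R x"
    and norm_scaleC: "norm (a *\<^sub>C x) = cmod a * norm x"

global_interpretation complex_vector:
  vector_space "scaleC :: complex \<Rightarrow> 'a \<Rightarrow> 'a::complex_normed_vector"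
  defines cspan = complex_vector.span
    and csubspace = complex_vector.subspace
    and cdim = complex_vector.dim
proof unfold_locales
  show "1 *\<^sub>C x = x" for x :: 'a
    using scaleC_of_real[of 1 x] by simp
qed (simp_all add: scaleC_add_right scaleC_add_left scaleC_scaleC)

text \<open>The inner product is conjugate linear in the first argument.\<close>

class complex_inner = complex_normed_vector +
  fixes cinner :: "'a \<Rightarrow> 'a \<Rightarrow> complex"
  assumes cinner_commute: "cinner x y = cnj (cinner y x)"
    and cinner_add_right: "cinner x (y + z) = cinner x y + cinner x z"
    and cinner_scaleC_right: "cinner x (a *\<^sub>C y) = a * cinner x y"
    and cinner_self: "cinner x x = complex_of_real ((norm x)\<^sup>2)"

class complex_hilbert = complex_inner + complete_space
begin
subclass banach ..
end

instantiation complex :: complex_hilbert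
begin
definition "a *\<^sub>C x = a * x" for a x :: complex
definition "cinner x y = cnj x * y" for x y :: complex
instance
proof
  show "cinner x x = complex_of_real ((norm x)\<^sup>2)" for x :: complex
    unfolding cinner_complex_def by (metis complex_norm_square mult.commute of_real_power)
qed (simp_all add: scaleC_complex_def cinner_complex_def algebra_simps norm_mult scaleR_conv_of_real)
end

text \<open>
  The type \<open>'a \<Rightarrow>\<^sub>L 'b\<close> consists of the bounded real linear maps.  With scalars acting on the
  values it is a complex normed space (complete if \<open>'b\<close> is), in which the bounded complex linear
  operators form a closed complex subspace.
\<close>

instantiation blinfun :: (real_normed_vector, complex_normed_vector) complex_normed_vector
begin

lift_definition scaleC_blinfun :: "complex \<Rightarrow> ('a \<Rightarrow>\<^sub>L 'b) \<Rightarrow> ('a \<Rightarrow>\<^sub>L 'b)" is "\<lambda>c f x. c *\<^sub>C f x"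
proof -
  fix c and f :: "'a \<Rightarrow> 'b" assume "bounded_linear f"
  then interpret f: bounded_linear f .
  obtain B where B: "\<And>x. norm (f x) \<le> norm x * B" using f.bounded by blast
  have comm: "c *\<^sub>C r *\<^sub>R x = r *\<^sub>R c *\<^sub>C x" for r :: real and x :: 'b
    by (simp add: scaleC_scaleC mult.commute flip: scaleC_of_real)
  show "bounded_linear (\<lambda>x. c *\<^sub>C f x)"
  proof
    show "\<exists>K. \<forall>x. norm (c *\<^sub>C f x) \<le> norm x * K"
    proof (intro exI allI)
      fix x
      show "norm (c *\<^sub>C f x) \<le> norm x * (cmod c * B)"
        using mult_left_mono[OF B[of x] norm_ge_zero[of c]] by (simp add: norm_scaleC ac_simps)
    qed
  qed (simp_all add: f.add f.scaleR scaleC_add_right comm)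
qed

instance
proof
  fix a b :: complex and r :: real and x y :: "'a \<Rightarrow>\<^sub>L 'b"
  show "a *\<^sub>C (x + y) = a *\<^sub>C x + a *\<^sub>C y" by transfer (simp add: scaleC_add_right)
  show "(a + b) *\<^sub>C x = a *\<^sub>C x + b *\<^sub>C x" by transfer (simp add: scaleC_add_left)
  show "a *\<^sub>C b *\<^sub>C x = (a * b) *\<^sub>C x" by transfer (simp add: scaleC_scaleC)
  show "complex_of_real r *\<^sub>C x = r *\<^sub>R x" by transfer (simp add: scaleC_of_real)
  have le: "norm (c *\<^sub>C z) \<le> cmod c * norm z" for c and z :: "'a \<Rightarrow>\<^sub>L 'b"
  proof (rule norm_blinfun_bound)
    fix v
    have "norm (blinfun_apply (c *\<^sub>C z) v) = cmod c * norm (blinfun_apply z v)"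
      by transfer (simp add: norm_scaleC)
    also have "\<dots> \<le> cmod c * (norm z * norm v)"
      by (intro mult_left_mono norm_blinfun) simp
    finally show "norm (blinfun_apply (c *\<^sub>C z) v) \<le> cmod c * norm z * norm v"
      by (simp add: mult.assoc)
  qed simp
  show "norm (a *\<^sub>C x) = cmod a * norm x"
  proof (cases "a = 0")
    case True
    then have "a *\<^sub>C x = 0" by (simp add: True) (transfer, simp)
    then show ?thesis using True by simp
  next
    case False
    have "inverse a *\<^sub>C a *\<^sub>C x = x" using False by transfer (simp add: scaleC_scaleC)
    then have "norm x \<le> inverse (cmod a) * norm (a *\<^sub>C x)"
      using le[of "inverse a" "a *\<^sub>C x"] by (simp add: norm_inverse)
    then have "cmod a * norm x \<le> norm (a *\<^sub>C x)"
      using False by (simp add: field_simps)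
    with le[of a x] show ?thesis by simp
  qed
qed

end

definition cfinite_dim :: "'a::complex_normed_vector set \<Rightarrow> bool" where
  "cfinite_dim S \<longleftrightarrow> (\<exists>B. finite B \<and> S \<subseteq> cspan B)"


section \<open>Unbounded operators\<close>

text \<open>
  A (generally unbounded) operator from \<open>'a\<close> to \<open>'b\<close> is given by its graph, a set of pairs; its
  domain is \<open>Domain T\<close>, its closure is the topological closure \<open>closure T\<close> of the graph, its
  (possibly unbounded) inverse is \<open>T\<inverse>\<close>.
\<close>

type_synonym ('a, 'b) operator = "('a \<times> 'b) set"

definition linear_operator ::
  "('a::complex_normed_vector, 'b::complex_normed_vector) operator \<Rightarrow> bool" where
  "linear_operator T \<longleftrightarrow> single_valued T \<and> (0, 0) \<in> T \<and>
     (\<forall>x y x' y'. (x, y) \<in> T \<longrightarrow> (x', y') \<in> T \<longrightarrow> (x + x', y + y') \<in> T) \<and>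
     (\<forall>a x y. (x, y) \<in> T \<longrightarrow> (a *\<^sub>C x, a *\<^sub>C y) \<in> T)"

definition dd_closed_operator ::
  "('a::complex_normed_vector, 'b::complex_normed_vector) operator \<Rightarrow> bool" where
  "dd_closed_operator T \<longleftrightarrow> linear_operator T \<and> closure (Domain T) = UNIV \<and> closed T"

definition adjoint_op ::
  "('a::complex_inner, 'b::complex_inner) operator \<Rightarrow> ('b, 'a) operator" where
  "adjoint_op T = {(k, h). \<forall>(x, y) \<in> T. cinner k y = cinner h x}"

abbreviation op_comp ::
  "('b, 'c) operator \<Rightarrow> ('a, 'b) operator \<Rightarrow> ('a, 'c) operator" (infixl "\<odot>" 75) where
  "S \<odot> T \<equiv> T O S"

definition op_uminus :: "('a, 'b::complex_normed_vector) operator \<Rightarrow> ('a, 'b) operator" where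
  "op_uminus T = {(x, - y) | x y. (x, y) \<in> T}"

definition op_shift ::
  "('a::complex_normed_vector, 'a) operator \<Rightarrow> complex \<Rightarrow> ('a, 'a) operator" where
  "op_shift T z = {(x, y - z *\<^sub>C x) | x y. (x, y) \<in> T}"

definition op_ker :: "('a, 'b::zero) operator \<Rightarrow> 'a set" where
  "op_ker T = {x. (x, 0) \<in> T}"


section \<open>Bounded operators\<close>

definition bounded_ops ::
  "('a::complex_normed_vector \<Rightarrow>\<^sub>L 'b::complex_normed_vector) set" (\<open>\<B>\<close>) where
  "\<B> = {B. \<forall>a x. blinfun_apply B (a *\<^sub>C x) = a *\<^sub>C blinfun_apply B x}"

definition graph_of ::
  "('a::real_normed_vector \<Rightarrow>\<^sub>L 'b::real_normed_vector) \<Rightarrow> ('a, 'b) operator" where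
  "graph_of B = {(x, blinfun_apply B x) | x. True}"

definition everywhere_bounded ::
  "('a::complex_normed_vector, 'b::complex_normed_vector) operator \<Rightarrow> bool" where
  "everywhere_bounded T \<longleftrightarrow> (\<exists>B\<in>\<B>. graph_of B = T)"

text \<open>The element of \<open>\<B>\<close> with graph \<open>T\<close>; meaningful only if \<open>everywhere_bounded T\<close>.\<close>

definition as_bounded ::
  "('a::complex_normed_vector, 'b::complex_normed_vector) operator \<Rightarrow> ('a \<Rightarrow>\<^sub>L 'b)" where
  "as_bounded T = (THE B. B \<in> \<B> \<and> graph_of B = T)"

definition has_bounded_extension ::
  "('a::complex_normed_vector, 'b::complex_normed_vector) operator \<Rightarrow> bool" where
  "has_bounded_extension T \<longleftrightarrow> (\<exists>B\<in>\<B>. T \<subseteq> graph_of B)"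

definition boundedly_invertible ::
  "('a::complex_normed_vector \<Rightarrow>\<^sub>L 'b::complex_normed_vector) \<Rightarrow> bool" where
  "boundedly_invertible B \<longleftrightarrow> everywhere_bounded ((graph_of B)\<inverse>)"

definition bounded_inverse ::
  "('a::complex_normed_vector \<Rightarrow>\<^sub>L 'b::complex_normed_vector) \<Rightarrow> ('b \<Rightarrow>\<^sub>L 'a)" where
  "bounded_inverse B = as_bounded ((graph_of B)\<inverse>)"

definition finite_rank_ops ::
  "('a::complex_normed_vector \<Rightarrow>\<^sub>L 'b::complex_normed_vector) set" (\<open>\<F>\<close>) where
  "\<F> = {B \<in> \<B>. cfinite_dim (range (blinfun_apply B))}"

definition Fredholm_ops ::
  "('a::complex_hilbert \<Rightarrow>\<^sub>L 'b::complex_hilbert) set" (\<open>\<Phi>\<close>) where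
  "\<Phi> = {B \<in> \<B>. cfinite_dim (op_ker (graph_of B)) \<and> closed (range (blinfun_apply B)) \<and>
     cfinite_dim (op_ker (adjoint_op (graph_of B)))}"

definition orthonormal_basis :: "'a::complex_inner set \<Rightarrow> bool" where
  "orthonormal_basis E \<longleftrightarrow>
     (\<forall>e\<in>E. \<forall>f\<in>E. cinner e f = (if e = f then 1 else 0)) \<and> closure (cspan E) = UNIV"

text \<open>For trace class (in particular, finite rank) \<open>B\<close> the choice of the basis is irrelevant.\<close>

definition op_trace :: "('a::complex_hilbert \<Rightarrow>\<^sub>L 'a) \<Rightarrow> complex" where
  "op_trace B = (\<Sum>\<^sub>\<infinity>e\<in>(SOME E. orthonormal_basis E). cinner e (blinfun_apply B e))"


section \<open>Spectrum\<close>

definition resolvent_set :: "('a::complex_normed_vector, 'a) operator \<Rightarrow> complex set" (\<open>\<rho>\<close>) where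
  "\<rho> T = {z. everywhere_bounded ((op_shift T z)\<inverse>)}"

definition op_spectrum :: "('a::complex_normed_vector, 'a) operator \<Rightarrow> complex set" (\<open>\<sigma>\<close>) where
  "\<sigma> T = - \<rho> T"

definition resolvent ::
  "('a::complex_normed_vector, 'a) operator \<Rightarrow> complex \<Rightarrow> ('a \<Rightarrow>\<^sub>L 'a)" where
  "resolvent T z = as_bounded ((op_shift T z)\<inverse>)"

definition is_eigenvalue :: "('a::complex_normed_vector, 'a) operator \<Rightarrow> complex \<Rightarrow> bool" where
  "is_eigenvalue T z \<longleftrightarrow> (\<exists>x. x \<noteq> 0 \<and> (x, z *\<^sub>C x) \<in> T)"

text \<open>The vector-valued version of \<^const>\<open>contour_integral\<close>.\<close>

definition path_integral ::
  "(real \<Rightarrow> complex) \<Rightarrow> (complex \<Rightarrow> 'a::complex_normed_vector) \<Rightarrow> 'a" where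
  "path_integral \<gamma> F =
     integral {0..1} (\<lambda>t. vector_derivative \<gamma> (at t within {0..1}) *\<^sub>C F (\<gamma> t))"

text \<open>
  At an isolated point \<open>z\<^sub>0\<close> of the spectrum the integral does not depend on the radius once
  the latter is small enough; the Riesz projection is this common value.
\<close>

definition riesz_projection ::
  "('a::complex_normed_vector, 'a) operator \<Rightarrow> complex \<Rightarrow> ('a \<Rightarrow>\<^sub>L 'a)" where
  "riesz_projection T z\<^sub>0 = (THE P. \<forall>\<^sub>F \<epsilon> in at_right 0.
     (- 1 / (2 * of_real pi * \<i>)) *\<^sub>C path_integral (circlepath z\<^sub>0 \<epsilon>) (resolvent T) = P)"

text \<open>
  The value is the dimension only if the range is finite-dimensional
  (\<^const>\<open>cdim\<close> is \<open>0\<close> otherwise).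
\<close>

definition alg_mult :: "complex \<Rightarrow> ('a::complex_normed_vector, 'a) operator \<Rightarrow> nat" (\<open>m\<^sub>a\<close>) where
  "m\<^sub>a z\<^sub>0 T = cdim (range (blinfun_apply (riesz_projection T z\<^sub>0)))"

definition discrete_spectrum ::
  "('a::complex_normed_vector, 'a) operator \<Rightarrow> complex set" (\<open>\<sigma>\<^sub>d\<close>) where
  "\<sigma>\<^sub>d T = {z. is_eigenvalue T z \<and> z isolated_in \<sigma> T \<and>
     cfinite_dim (range (blinfun_apply (riesz_projection T z)))}"


section \<open>Finitely meromorphic operator-valued functions\<close>

text \<open>
  As for \<^const>\<open>meromorphic_on\<close>, the value of a function at an isolated singularity is irrelevant.
\<close>

definition op_analytic_on ::
  "(complex \<Rightarrow> ('a::complex_normed_vector \<Rightarrow>\<^sub>L 'b::complex_normed_vector)) \<Rightarrow> complex set \<Rightarrow> bool" where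
  "op_analytic_on M S \<longleftrightarrow> open S \<and>
     (\<forall>z\<in>S. M z \<in> \<B> \<and> (\<exists>D. (M has_derivative (\<lambda>h. h *\<^sub>C D)) (at z)))"

definition op_deriv ::
  "(complex \<Rightarrow> ('a::complex_normed_vector \<Rightarrow>\<^sub>L 'b::complex_normed_vector)) \<Rightarrow> complex \<Rightarrow> ('a \<Rightarrow>\<^sub>L 'b)" where
  "op_deriv M z = (THE D. (M has_derivative (\<lambda>h. h *\<^sub>C D)) (at z))"

text \<open>
  Norm convergence of \<open>\<Sum>k\<ge>-N. (z - z\<^sub>0)\<^sup>k c\<^sub>k\<close> to \<open>M z\<close> for \<open>0 < \<bar>z - z\<^sub>0\<bar> < r\<close>.  Requiring the unused
  coefficients to vanish makes the family \<open>c\<close> unique.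
\<close>

definition op_laurent_expansion ::
  "(complex \<Rightarrow> ('a::complex_normed_vector \<Rightarrow>\<^sub>L 'b::complex_normed_vector)) \<Rightarrow> complex \<Rightarrow> real \<Rightarrow> nat
     \<Rightarrow> (int \<Rightarrow> ('a \<Rightarrow>\<^sub>L 'b)) \<Rightarrow> bool" where
  "op_laurent_expansion M z\<^sub>0 r N c \<longleftrightarrow> (\<forall>k. k < - int N \<longrightarrow> c k = 0) \<and>
     (\<forall>z \<in> ball z\<^sub>0 r - {z\<^sub>0}.
        (\<lambda>n. (z - z\<^sub>0) powi (int n - int N) *\<^sub>C c (int n - int N)) sums M z)"

definition laurent_coeff ::
  "(complex \<Rightarrow> ('a::complex_normed_vector \<Rightarrow>\<^sub>L 'b::complex_normed_vector)) \<Rightarrow> complex \<Rightarrow> int \<Rightarrow> ('a \<Rightarrow>\<^sub>L 'b)" where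
  "laurent_coeff M z\<^sub>0 = (THE c. \<exists>r>0. \<exists>N. op_laurent_expansion M z\<^sub>0 r N c)"

definition finitely_meromorphic_at ::
  "(complex \<Rightarrow> ('a::complex_normed_vector \<Rightarrow>\<^sub>L 'b::complex_normed_vector)) \<Rightarrow> complex \<Rightarrow> bool" where
  "finitely_meromorphic_at M z\<^sub>0 \<longleftrightarrow> (\<exists>r>0. op_analytic_on M (ball z\<^sub>0 r - {z\<^sub>0}) \<and>
     (\<exists>N c. op_laurent_expansion M z\<^sub>0 r N c \<and> (\<forall>k. c k \<in> \<B>) \<and>
        (\<forall>k. 1 \<le> k \<and> k \<le> int N \<longrightarrow> c (- k) \<in> \<F>)))"

definition finitely_meromorphic_on ::
  "(complex \<Rightarrow> ('a::complex_normed_vector \<Rightarrow>\<^sub>L 'b::complex_normed_vector)) \<Rightarrow> complex set \<Rightarrow> bool" where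
  "finitely_meromorphic_on M \<Omega> \<longleftrightarrow> open \<Omega> \<and>
     (\<exists>P\<subseteq>\<Omega>. P sparse_in \<Omega> \<and> op_analytic_on M (\<Omega> - P) \<and> (\<forall>p\<in>P. finitely_meromorphic_at M p))"

definition op_index ::
  "(complex \<Rightarrow> ('a::complex_hilbert \<Rightarrow>\<^sub>L 'a)) \<Rightarrow> complex \<Rightarrow> real \<Rightarrow> complex" where
  "op_index M z\<^sub>0 \<epsilon> = op_trace ((1 / (2 * of_real pi * \<i>)) *\<^sub>C
     path_integral (circlepath z\<^sub>0 \<epsilon>) (\<lambda>\<zeta>. op_deriv M \<zeta> o\<^sub>L bounded_inverse (M \<zeta>)))"


section \<open>The perturbation setting\<close>

text \<open>
  \<open>V\<^sub>1 R\<^sub>0(z)\<close>, the closure of \<open>R\<^sub>0(z) V\<^sub>2\<^sup>*\<close>, and \<open>K(z)\<close>, the negative of the closure of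
  \<open>V\<^sub>1 R\<^sub>0(z) V\<^sub>2\<^sup>*\<close>, as bounded operators.
\<close>

abbreviation R0_graph ::
  "('h::complex_hilbert, 'h) operator \<Rightarrow> complex \<Rightarrow> ('h, 'h) operator" where
  "R0_graph H\<^sub>0 z \<equiv> (op_shift H\<^sub>0 z)\<inverse>"

definition V1R0 ::
  "('h::complex_hilbert, 'h) operator \<Rightarrow> ('h, 'k::complex_hilbert) operator \<Rightarrow> complex
     \<Rightarrow> ('h \<Rightarrow>\<^sub>L 'k)" where
  "V1R0 H\<^sub>0 V\<^sub>1 z = as_bounded (V\<^sub>1 \<odot> R0_graph H\<^sub>0 z)"

definition R0V2adj ::
  "('h::complex_hilbert, 'h) operator \<Rightarrow> ('h, 'k::complex_hilbert) operator \<Rightarrow> complex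
     \<Rightarrow> ('k \<Rightarrow>\<^sub>L 'h)" where
  "R0V2adj H\<^sub>0 V\<^sub>2 z = as_bounded (closure (R0_graph H\<^sub>0 z \<odot> adjoint_op V\<^sub>2))"

definition K_op ::
  "('h::complex_hilbert, 'h) operator \<Rightarrow> ('h, 'k::complex_hilbert) operator
     \<Rightarrow> ('h, 'k) operator \<Rightarrow> complex \<Rightarrow> ('k \<Rightarrow>\<^sub>L 'k)" where
  "K_op H\<^sub>0 V\<^sub>1 V\<^sub>2 z = - as_bounded (closure (V\<^sub>1 \<odot> R0_graph H\<^sub>0 z \<odot> adjoint_op V\<^sub>2))"

end

theory Submission
  imports Defs
begin

text \<open>
  Fix \<open>z\<^sub>1\<close> with \<open>M(z\<^sub>1) = I - K(z\<^sub>1)\<close> invertible, and put \<open>A(z) = V\<^sub>1 R\<^sub>0(z)\<close> and \<open>B(z) = cl (R\<^sub>0(z) V\<^sub>2\<^sup>*)\<close>.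
  The resolvent equation gives \<open>K(z) - K(w) = - (z - w) A(z) B(w)\<close>, hence \<open>M'(z) = A(z) B(z)\<close>.  On a
  punctured disk in the resolvent sets of both \<open>H\<^sub>0\<close> and \<open>H\<close>, the Woodbury identity shows that \<open>M(z)\<close> is
  invertible, so that \<open>R(z) = R\<^sub>0(z) - B(z) M(z)\<^sup>-\<^sup>1 A(z)\<close> there.  The resolvent \<open>R\<^sub>0\<close> is finitely
  meromorphic at \<open>z\<^sub>0\<close> because its Riesz projection has finite rank, and therefore so are \<open>A\<close>, \<open>B\<close>, \<open>K\<close>.
  If the zeroth coefficient of \<open>M\<close> is Fredholm, a Schur complement reduces \<open>M\<^sup>-\<^sup>1\<close> to the inverse of
  a meromorphic family of operators between finite-dimensional spaces, so \<open>M\<^sup>-\<^sup>1\<close> and with it \<open>R\<close> are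
  finitely meromorphic.  The algebraic multiplicity is minus the trace of the residue of the resolvent.
  Since the trace of the residue of a product of finitely meromorphic functions does not depend on the
  order of the factors, \<open>tr res (B M\<^sup>-\<^sup>1 A) = tr res (A B M\<^sup>-\<^sup>1) = tr res (M' M\<^sup>-\<^sup>1)\<close>, which is the index.
\<close>

section \<open>Hilbert space preliminaries\<close>

text \<open>On the punctured disk, invertibility of \<open>M\<close> is read off from the position
  of the spectrum of \<open>H\<close>: the formula for the resolvent of \<open>H\<close> is used at
  one base point only, and membership of \<open>z\<close> in \<open>\<rho> H\<close> transports the
  inverse from there to \<open>z\<close>. The obstacle is \<open>z\<^sub>0\<close> itself, where
  \<open>K\<close> may have a pole. Its polar coefficients have finite rank, so they all vanish on a
  subspace of finite codimension; there \<open>M\<close> coincides with its regular part, whose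
  value at \<open>z\<^sub>0\<close> is the Fredholm zeroth coefficient. This explains why a
  condition on that single coefficient controls the inverse. What is left over is a finite block,
  possibly rectangular in appearance; invertibility of \<open>M\<close> nearby forces it to be
  bijective. All functions are kept in one class, \<open>has_finite_residue\<close>: a principal
  part with finite rank coefficients plus an analytic function on the full disk. It is stable under
  sums and compositions, and its residues have a trace even if the functions themselves do not.
  Operator-valued residues are compared through matrix elements, where scalar residue calculus is
  available.\<close>

lemma scaleC_one [simp]: "1 *\<^sub>C x = x"
  by (fact complex_vector.scale_one)

declare scaleC_complex_def [simp]

lemma scaleR_scaleC: "r *\<^sub>R x = complex_of_real r *\<^sub>C x"
  by (simp add: scaleC_of_real)

section \<open>Complex scaling, inner product algebra and the Cauchy-Schwarz inequality\<close>

lemma bounded_bilinear_scaleC: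
  "bounded_bilinear (scaleC :: complex \<Rightarrow> 'a \<Rightarrow> 'a::complex_normed_vector)"
proof
  show "\<exists>K. \<forall>a b. norm (a *\<^sub>C b) \<le> norm a * norm (b::'a) * K" for a :: complex and b :: 'a
    by (intro exI[of _ 1]) (simp add: norm_scaleC)
qed (simp_all add: scaleC_add_right scaleC_add_left scaleR_scaleC scaleC_scaleC mult.commute
      scaleR_conv_of_real)

lemmas tendsto_scaleC [tendsto_intros] = bounded_bilinear.tendsto[OF bounded_bilinear_scaleC]
lemmas continuous_on_scaleC [continuous_intros] =
  bounded_bilinear.continuous_on[OF bounded_bilinear_scaleC]

lemma bounded_linear_scaleC_right: "bounded_linear (\<lambda>x::'a::complex_normed_vector. c *\<^sub>C x)"
  by (rule bounded_bilinear.bounded_linear_right[OF bounded_bilinear_scaleC])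

lemma cinner_add_left: "cinner (x + y) z = cinner x z + cinner (y::'a::complex_inner) z"
  by (metis cinner_commute cinner_add_right complex_cnj_add)

lemma cinner_scaleC_left: "cinner (a *\<^sub>C x) y = cnj a * cinner (x::'a::complex_inner) y"
  by (metis cinner_commute cinner_scaleC_right complex_cnj_mult)

lemma cinner_zero_right [simp]: "cinner x (0::'a::complex_inner) = 0"
  by (metis add_cancel_right_right cinner_add_right)

lemma cinner_zero_left [simp]: "cinner (0::'a::complex_inner) x = 0"
  by (metis add_cancel_right_right cinner_add_left)

lemma cinner_minus_right [simp]: "cinner x (- y) = - cinner x (y::'a::complex_inner)"
  by (metis add.right_inverse add_eq_0_iff cinner_add_right cinner_zero_right)

lemma cinner_minus_left [simp]: "cinner (- x) y = - cinner (x::'a::complex_inner) y"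
  by (metis add.right_inverse add_eq_0_iff cinner_add_left cinner_zero_left)

lemma cinner_diff_right: "cinner x (y - z) = cinner x y - cinner x (z::'a::complex_inner)"
  using cinner_add_right[of x y "- z"] by simp

lemma cinner_diff_left: "cinner (x - y) z = cinner x z - cinner (y::'a::complex_inner) z"
  using cinner_add_left[of x "- y" z] by simp

lemma cinner_sum_right: "cinner x (\<Sum>i\<in>I. f i) = (\<Sum>i\<in>I. cinner x (f i :: 'a::complex_inner))"
  by (induction I rule: infinite_finite_induct) (simp_all add: cinner_add_right)

lemmas cinner_simps = cinner_add_left cinner_add_right cinner_diff_left cinner_diff_right
  cinner_scaleC_left cinner_scaleC_right

lemma cinner_eq_zero_iff [simp]: "cinner x x = 0 \<longleftrightarrow> x = (0::'a::complex_inner)"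
  by (simp add: cinner_self)

lemma cinner_ext:
  assumes "\<And>x. cinner x u = cinner x (v::'a::complex_inner)"
  shows "u = v"
  using assms[of "u - v"] by (metis cinner_diff_right cinner_eq_zero_iff right_minus_eq)

lemma norm_add_sq:
  "(norm (x + y :: 'a::complex_inner))\<^sup>2 = (norm x)\<^sup>2 + 2 * Re (cinner x y) + (norm y)\<^sup>2"
proof -
  have "complex_of_real ((norm (x + y))\<^sup>2) = cinner (x + y) (x + y)"
    by (simp only: cinner_self)
  also have "\<dots> = cinner x x + (cinner x y + cinner y x) + cinner y y"
    by (simp add: cinner_add_left cinner_add_right)
  also have "\<dots> = (norm x)\<^sup>2 + (cinner x y + cnj (cinner x y)) + (norm y)\<^sup>2"
    by (simp add: cinner_self flip: cinner_commute)
  finally have "complex_of_real ((norm (x + y))\<^sup>2) =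
      complex_of_real ((norm x)\<^sup>2 + 2 * Re (cinner x y) + (norm y)\<^sup>2)"
    by (simp add: complex_add_cnj)
  then show ?thesis by (simp only: of_real_eq_iff)
qed

lemma norm_diff_sq:
  "(norm (x - y :: 'a::complex_inner))\<^sup>2 = (norm x)\<^sup>2 - 2 * Re (cinner x y) + (norm y)\<^sup>2"
  using norm_add_sq[of x "- y"] by simp

lemma norm_add_orthogonal:
  "cinner x y = 0 \<Longrightarrow> (norm (x + y :: 'a::complex_inner))\<^sup>2 = (norm x)\<^sup>2 + (norm y)\<^sup>2"
  by (simp add: norm_add_sq)

lemma Cauchy_Schwarz: "cmod (cinner x y) \<le> norm x * norm (y::'a::complex_inner)"
proof (cases "y = 0")
  case False
  \<comment> \<open>\<open>t *\<^sub>C y\<close> is the orthogonal projection of \<open>x\<close>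
    onto the line through \<open>y\<close>, so Pythagoras bounds its norm by that of
    \<open>x\<close>.\<close>
  define t where "t = cinner y x / (norm y)\<^sup>2"
  have ny: "norm y \<noteq> 0" using False by simp
  have "cinner (t *\<^sub>C y) (x - t *\<^sub>C y) = cnj t * (cinner y x - t * cinner y y)"
    by (simp add: cinner_diff_right cinner_scaleC_left cinner_scaleC_right algebra_simps)
  also have "\<dots> = 0"
    using ny by (simp add: cinner_self t_def)
  finally have "cinner (t *\<^sub>C y) (x - t *\<^sub>C y) = 0" .
  from norm_add_orthogonal[OF this] have "(norm (t *\<^sub>C y))\<^sup>2 \<le> (norm x)\<^sup>2"
    by simp
  then have "norm (t *\<^sub>C y) \<le> norm x"
    by (rule power2_le_imp_le) simp
  then have le: "cmod t * norm y \<le> norm x"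
    by (simp add: norm_scaleC)
  have "cinner x y = cnj t * complex_of_real ((norm y)\<^sup>2)"
    using ny by (simp add: t_def flip: cinner_commute)
  then have "cmod (cinner x y) = (cmod t * norm y) * norm y"
    by (simp add: norm_mult norm_power power2_eq_square)
  also have "\<dots> \<le> norm x * norm y"
    by (intro mult_right_mono le) simp
  finally show ?thesis .
qed simp

lemma bounded_linear_cinner_right: "bounded_linear (\<lambda>y::'a::complex_inner. cinner x y)"
proof
  show "\<exists>K. \<forall>y. norm (cinner x y) \<le> norm y * K"
    using Cauchy_Schwarz[of x] by (intro exI[of _ "norm x"]) (simp add: mult.commute)
qed (simp_all add: cinner_add_right scaleR_scaleC cinner_scaleC_right scaleR_conv_of_real)



section \<open>Closed subspaces and orthogonal projections\<close>

lemma csubspace_closure: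
  assumes "csubspace (S::'a::complex_normed_vector set)"
  shows "csubspace (closure S)"
proof (rule complex_vector.subspaceI)
  show "0 \<in> closure S"
    using assms complex_vector.subspace_0 closure_subset by blast
next
  fix x y assume "x \<in> closure S" "y \<in> closure S"
  then obtain f g where fg: "\<forall>n. f n \<in> S" "f \<longlonglongrightarrow> x" "\<forall>n. g n \<in> S" "g \<longlonglongrightarrow> y"
    unfolding closure_sequential by blast
  then have "(\<lambda>n. f n + g n) \<longlonglongrightarrow> x + y" by (intro tendsto_add)
  moreover have "\<forall>n. f n + g n \<in> S" using fg assms complex_vector.subspace_add by blast
  ultimately show "x + y \<in> closure S" unfolding closure_sequential by (intro exI[of _ "\<lambda>n. f n + g n"]) simp
next
  fix c x assume "x \<in> closure S"
  then obtain f where f: "\<forall>n. f n \<in> S" "f \<longlonglongrightarrow> x" unfolding closure_sequential by blast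
  then have "(\<lambda>n. c *\<^sub>C f n) \<longlonglongrightarrow> c *\<^sub>C x" by (intro tendsto_intros)
  moreover have "\<forall>n. c *\<^sub>C f n \<in> S" using f assms complex_vector.subspace_scale by blast
  ultimately show "c *\<^sub>C x \<in> closure S" unfolding closure_sequential by (intro exI[of _ "\<lambda>n. c *\<^sub>C f n"]) simp
qed

definition orthogonal_complement :: "'a::complex_inner set \<Rightarrow> 'a set" where
  "orthogonal_complement S = {x. \<forall>y\<in>S. cinner y x = 0}"

lemma csubspace_orthogonal_complement: "csubspace (orthogonal_complement S)"
  by (intro complex_vector.subspaceI) (auto simp: orthogonal_complement_def cinner_simps)

lemma closed_orthogonal_complement: "closed (orthogonal_complement S)"
proof -
  have "orthogonal_complement S = (\<Inter>y\<in>S. {x. cinner y x = 0})"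
    by (auto simp: orthogonal_complement_def)
  moreover have "closed {x. cinner y x = 0}" for y :: 'a
    by (intro closed_Collect_eq continuous_intros
        bounded_linear.continuous_on[OF bounded_linear_cinner_right])
  ultimately show ?thesis by auto
qed

text \<open>A minimizing sequence for the distance from \<open>x\<close> is Cauchy by the
  parallelogram law, because midpoints stay in \<open>S\<close>. If the residual at the minimizer
  were not orthogonal to some \<open>y\<close> in \<open>S\<close>, moving along \<open>y\<close>
  would decrease the distance.\<close>

lemma orthogonal_projection_exists:
  fixes S :: "'a::complex_hilbert set"
  assumes S: "csubspace S" "closed S"
  shows "\<exists>p\<in>S. x - p \<in> orthogonal_complement S"
proof -
  have "0 \<in> S" by (rule complex_vector.subspace_0[OF S(1)])
  define d where "d = infdist x S"
  have d0: "0 \<le> d" and d_le: "\<And>y. y \<in> S \<Longrightarrow> d \<le> norm (x - y)"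
    unfolding d_def by (auto simp: infdist_nonneg infdist_le simp flip: dist_norm)
  have "\<exists>y\<in>S. norm (x - y) < d + inverse (Suc n)" for n
  proof -
    have "(INF a\<in>S. dist x a) = d"
      using \<open>0 \<in> S\<close> by (auto simp: d_def infdist_def)
    then have "(INF a\<in>S. dist x a) < d + inverse (Suc n)" by simp
    then show ?thesis
      using \<open>0 \<in> S\<close> by (subst (asm) cINF_less_iff) (auto intro!: bdd_belowI[of _ 0] simp: dist_norm)
  qed
  then obtain f where fS: "\<And>n. f n \<in> S" and f: "\<And>n. norm (x - f n) < d + inverse (Suc n)"
    by metis
  have lim: "(\<lambda>n. norm (x - f n)) \<longlonglongrightarrow> d"
  proof (rule tendsto_sandwich[of "\<lambda>_. d"])
    show "(\<lambda>n. d + inverse (real (Suc n))) \<longlonglongrightarrow> d"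
      using tendsto_add[OF tendsto_const LIMSEQ_inverse_real_of_nat, of d] by simp
  qed (use f d_le fS in \<open>auto intro!: always_eventually simp: less_imp_le\<close>)
  have par: "(norm (f m - f n))\<^sup>2 \<le> 2 * (norm (x - f m))\<^sup>2 + 2 * (norm (x - f n))\<^sup>2 - 4 * d\<^sup>2" for m n
  proof -
    let ?u = "x - f m" and ?v = "x - f n"
    have mid: "(1/2) *\<^sub>C (f m + f n) \<in> S"
      using fS S(1) by (intro complex_vector.subspace_scale complex_vector.subspace_add)
    have "?u + ?v = 2 *\<^sub>C (x - (1/2) *\<^sub>C (f m + f n))"
      by (simp add: complex_vector.scale_right_diff_distrib scaleC_scaleC)
        (simp add: scaleC_add_left[of 1 1, simplified])
    then have "norm (?u + ?v) = 2 * norm (x - (1/2) *\<^sub>C (f m + f n))"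
      by (simp add: norm_scaleC)
    with d_le[OF mid] d0 have "4 * d\<^sup>2 \<le> (norm (?u + ?v))\<^sup>2"
      by (simp add: power_mult_distrib power_mono)
    moreover have "(norm (?u + ?v))\<^sup>2 + (norm (?u - ?v))\<^sup>2 = 2 * (norm ?u)\<^sup>2 + 2 * (norm ?v)\<^sup>2"
      using norm_add_sq[of ?u ?v] norm_diff_sq[of ?u ?v] by linarith
    moreover have "(norm (?u - ?v))\<^sup>2 = (norm (f m - f n))\<^sup>2"
      by (simp add: norm_minus_commute)
    ultimately show ?thesis by linarith
  qed
  have "Cauchy f"
  proof (rule metric_CauchyI)
    fix e :: real assume "0 < e"
    have "(\<lambda>n. (norm (x - f n))\<^sup>2) \<longlonglongrightarrow> d\<^sup>2" by (intro tendsto_intros lim)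
    then have "\<forall>\<^sub>F n in sequentially. (norm (x - f n))\<^sup>2 < d\<^sup>2 + e\<^sup>2/4"
      by (rule order_tendstoD) (use \<open>0 < e\<close> in simp)
    then obtain N where N: "\<And>n. n \<ge> N \<Longrightarrow> (norm (x - f n))\<^sup>2 < d\<^sup>2 + e\<^sup>2/4"
      by (auto simp: eventually_sequentially)
    show "\<exists>M. \<forall>m\<ge>M. \<forall>n\<ge>M. dist (f m) (f n) < e"
    proof (intro exI allI impI)
      fix m n assume "N \<le> m" "N \<le> n"
      then have "(norm (f m - f n))\<^sup>2 < e\<^sup>2"
        using par[of m n] N[of m] N[of n] by linarith
      then show "dist (f m) (f n) < e"
        using \<open>0 < e\<close> by (simp add: dist_norm power2_less_imp_less)
    qed
  qed
  then obtain p where p: "f \<longlonglongrightarrow> p" using Cauchy_convergent convergent_def by blast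
  have pS: "p \<in> S" using closed_sequentially[OF S(2)] fS p by blast
  have np: "norm (x - p) = d"
    using LIMSEQ_unique[OF tendsto_norm[OF tendsto_diff[OF tendsto_const p]] lim] .
  have "cinner y (x - p) = 0" if y: "y \<in> S" for y
  proof (cases "y = 0")
    case False
    \<comment> \<open>The best correction of \<open>p\<close> along \<open>y\<close>; minimality
      forces it to vanish.\<close>
    define t where "t = cinner y (x - p) / (norm y)\<^sup>2"
    have "cinner (t *\<^sub>C y) (x - p - t *\<^sub>C y) = cnj t * (cinner y (x - p) - t * cinner y y)"
      by (simp only: cinner_diff_right[of _ "x -
          p"] cinner_scaleC_left cinner_scaleC_right right_diff_distrib ac_simps)
    also have "\<dots> = 0"
      using False by (simp add: cinner_self t_def)
    finally have orth: "cinner (t *\<^sub>C y) (x - p - t *\<^sub>C y) = 0" .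
    have "p + t *\<^sub>C y \<in> S"
      using y pS S(1) by (intro complex_vector.subspace_scale complex_vector.subspace_add)
    from d_le[OF this] have "d\<^sup>2 \<le> (norm (x - p - t *\<^sub>C y))\<^sup>2"
      using d0 by (intro power_mono) (simp_all add: diff_diff_add)
    with norm_add_orthogonal[OF orth] np have "norm (t *\<^sub>C y) = 0"
      by (simp add: algebra_simps)
    then have "t = 0" using False by (simp add: norm_scaleC)
    then show ?thesis using False by (simp add: t_def)
  qed simp
  with pS show ?thesis unfolding orthogonal_complement_def by blast
qed

section \<open>The algebra of bounded complex linear operators\<close>

lemma bounded_opsI: "(\<And>a x. blinfun_apply B (a *\<^sub>C x) = a *\<^sub>C blinfun_apply B x) \<Longrightarrow> B \<in> \<B>"
  by (simp add: bounded_ops_def)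

lemma bounded_opsD: "B \<in> \<B> \<Longrightarrow> blinfun_apply B (a *\<^sub>C x) = a *\<^sub>C blinfun_apply B x"
  by (simp add: bounded_ops_def)

declare scaleC_blinfun.rep_eq [simp]

lemma bounded_ops_intros [simp, intro]:
  "0 \<in> \<B>" "id_blinfun \<in> \<B>"
  "A \<in> \<B> \<Longrightarrow> B \<in> \<B> \<Longrightarrow> A + B \<in> \<B>" "A \<in> \<B> \<Longrightarrow> B \<in> \<B> \<Longrightarrow> A - B \<in> \<B>"
  "A \<in> \<B> \<Longrightarrow> - A \<in> \<B>" "A \<in> \<B> \<Longrightarrow> c *\<^sub>C A \<in> \<B>"
  "C \<in> \<B> \<Longrightarrow> D \<in> \<B> \<Longrightarrow> C o\<^sub>L D \<in> \<B>"
  by (auto simp: bounded_ops_def blinfun.bilinear_simps complex_vector.scale_right_distrib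
      complex_vector.scale_right_diff_distrib scaleC_scaleC mult.commute)

lemma blinfun_compose_scaleC_left: "(c *\<^sub>C A) o\<^sub>L B = c *\<^sub>C (A o\<^sub>L B)"
  by (rule blinfun_eqI) simp

lemma blinfun_compose_scaleC_right: "A \<in> \<B> \<Longrightarrow> A o\<^sub>L (c *\<^sub>C B) = c *\<^sub>C (A o\<^sub>L B)"
  by (rule blinfun_eqI) (simp add: bounded_opsD)

lemma blinfun_compose_assoc: "(A o\<^sub>L B) o\<^sub>L C = A o\<^sub>L (B o\<^sub>L C)"
  by (rule blinfun_eqI) simp

lemma blinfun_compose_id [simp]: "A o\<^sub>L id_blinfun = A" "id_blinfun o\<^sub>L A = A"
  by (auto intro: blinfun_eqI)

lemmas blinfun_compose_distrib =
  bounded_bilinear.add_left[OF bounded_bilinear_blinfun_compose]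
  bounded_bilinear.add_right[OF bounded_bilinear_blinfun_compose]
  bounded_bilinear.diff_left[OF bounded_bilinear_blinfun_compose]
  bounded_bilinear.diff_right[OF bounded_bilinear_blinfun_compose]
  bounded_bilinear.minus_left[OF bounded_bilinear_blinfun_compose]
  bounded_bilinear.minus_right[OF bounded_bilinear_blinfun_compose]
  blinfun_compose_scaleC_left blinfun_compose_scaleC_right
  blinfun_compose_assoc

lemmas blinfun_compose_zero [simp] =
  bounded_bilinear.zero_left[OF bounded_bilinear_blinfun_compose]
  bounded_bilinear.zero_right[OF bounded_bilinear_blinfun_compose]

lemmas blinfun_compose_sum_left = bounded_bilinear.sum_left[OF bounded_bilinear_blinfun_compose]
lemmas blinfun_compose_sum_right = bounded_bilinear.sum_right[OF bounded_bilinear_blinfun_compose]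

lemma csubspace_range_bounded_op: "B \<in> \<B> \<Longrightarrow> csubspace (range (blinfun_apply B))"
  unfolding complex_vector.subspace_def
  by (auto simp: blinfun.bilinear_simps[symmetric] bounded_opsD[symmetric] image_iff)
    (metis blinfun.zero_right)

lemma bounded_op_in_cspan:
  assumes "B \<in> \<B>" "x \<in> cspan S"
  shows "blinfun_apply B x \<in> cspan (blinfun_apply B ` S)"
  using assms(2)
proof (induction rule: complex_vector.span_induct_alt)
  case base
  then show ?case by (simp add: complex_vector.span_zero)
next
  case (step c x y)
  then show ?case using assms(1)
    by (simp add: blinfun.add_right bounded_opsD complex_vector.span_add
        complex_vector.span_scale complex_vector.span_base)
qed

subsection \<open>Riesz representation and adjoints\<close>

text \<open>One vector \<open>v\<close> orthogonal to the kernel determines the functional, since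
  \<open>x - (\<phi> x / \<phi> v) *\<^sub>C v\<close> lies in the kernel. The conjugate in the
  representing vector reflects conjugate linearity in the first argument.\<close>

lemma riesz_representation:
  fixes \<phi> :: "'a::complex_hilbert \<Rightarrow> complex"
  assumes \<phi>: "bounded_linear \<phi>" "\<And>c x. \<phi> (c *\<^sub>C x) = c * \<phi> x"
  shows "\<exists>h. \<forall>x. \<phi> x = cinner h x"
proof (cases "\<forall>x. \<phi> x = 0")
  case True
  then show ?thesis by (intro exI[of _ 0]) simp
next
  case False
  interpret \<phi>: bounded_linear \<phi> by fact
  obtain u where u: "\<phi> u \<noteq> 0" using False by blast
  let ?S = "{x. \<phi> x = 0}"
  have "csubspace ?S" by (intro complex_vector.subspaceI) (auto simp: \<phi>.add \<phi>(2))
  moreover have "closed ?S"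
    by (intro closed_Collect_eq continuous_intros \<phi>.continuous_on)
  ultimately obtain p where p: "\<phi> p = 0" "u - p \<in> orthogonal_complement ?S"
    using orthogonal_projection_exists[of ?S u] by blast
  define v where "v = u - p"
  have v: "\<phi> v \<noteq> 0" "\<And>x. \<phi> x = 0 \<Longrightarrow> cinner x v = 0"
    using u p by (auto simp: v_def \<phi>.diff orthogonal_complement_def)
  then have "v \<noteq> 0" using \<phi>.zero by auto
  have "\<phi> x = cinner ((cnj (\<phi> v) / (norm v)\<^sup>2) *\<^sub>C v) x" for x
  proof -
    have "\<phi> (x - (\<phi> x / \<phi> v) *\<^sub>C v) = 0" using v by (simp add: \<phi>.diff \<phi>(2))
    from v(2)[OF this] have "cinner v (x - (\<phi> x / \<phi> v) *\<^sub>C v) = 0"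
      by (metis cinner_commute complex_cnj_zero)
    then have "cinner v x = \<phi> x / \<phi> v * (norm v)\<^sup>2"
      by (simp add: cinner_diff_right cinner_scaleC_right cinner_self)
    then show ?thesis using v \<open>v \<noteq> 0\<close> by (simp add: cinner_scaleC_left field_simps)
  qed
  then show ?thesis by blast
qed

text \<open>Riesz representation of \<open>x \<mapsto> cinner k (A x)\<close> for each
  \<open>k\<close>; the norm bound comes from pairing the representing vector with itself.\<close>

lemma adjoint_exists:
  assumes "A \<in> \<B>"
  shows "\<exists>B\<in>\<B>. \<forall>k x. cinner (blinfun_apply B k) x = cinner k (blinfun_apply A (x::'a::complex_hilbert))"
proof -
  have "\<exists>h. \<forall>x. cinner k (blinfun_apply A x) = cinner h x" for k
    using assms
    by (intro riesz_representation bounded_linear_compose[OF bounded_linear_cinner_right]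
        blinfun.bounded_linear_right) (simp add: bounded_opsD cinner_scaleC_right)
  then obtain g where g: "\<And>k x. cinner (g k) x = cinner k (blinfun_apply A x)" by metis
  have ext: "u = v" if "\<And>x. cinner u x = cinner v x" for u v :: 'a
    by (rule cinner_ext) (metis that cinner_commute)
  have lin: "g (x + y) = g x + g y" "g (c *\<^sub>C x) = c *\<^sub>C g x" for x y c
    by (rule ext; simp add: g cinner_add_left cinner_scaleC_left)+
  have bound: "norm (g k) \<le> norm k * norm A" for k
  proof (cases "g k = 0")
    case False
    have "(norm (g k))\<^sup>2 = cmod (cinner (g k) (g k))" by (simp add: cinner_self norm_power)
    also have "\<dots> \<le> norm k * norm (blinfun_apply A (g k))"
      unfolding g by (rule Cauchy_Schwarz)
    also have "\<dots> \<le> norm k * (norm A * norm (g k))"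
      by (intro mult_left_mono norm_blinfun) simp
    finally show ?thesis using False by (simp add: power2_eq_square)
  qed simp
  have "bounded_linear g"
    using bound by (intro bounded_linear_intro[of _ "norm A"]) (auto simp: lin scaleR_scaleC)
  then have "blinfun_apply (Blinfun g) = g" by (rule bounded_linear_Blinfun_apply)
  then show ?thesis using g lin by (intro bexI[of _ "Blinfun g"]) (simp_all add: bounded_ops_def)
qed

lemma orthogonal_complement_dense:
  fixes S :: "'a::complex_hilbert set"
  assumes "csubspace S" "orthogonal_complement S = {0}"
  shows "closure S = UNIV"
proof -
  have "x \<in> closure S" for x
  proof -
    obtain p where p: "p \<in> closure S" "x - p \<in> orthogonal_complement (closure S)"
      using orthogonal_projection_exists[of "closure S" x] csubspace_closure[OF assms(1)] by auto
    then have "x - p \<in> orthogonal_complement S"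
      using closure_subset unfolding orthogonal_complement_def by blast
    with assms p show ?thesis by simp
  qed
  then show ?thesis by blast
qed

text \<open>Graphs of unbounded operators are subspaces of a product; once the product is a Hilbert
  space, a closed graph admits orthogonal projections.\<close>

instantiation prod :: (complex_normed_vector, complex_normed_vector) complex_normed_vector
begin
definition "scaleC_prod c p = (c *\<^sub>C fst p, c *\<^sub>C snd p)"
instance
proof
  fix a b :: complex and r :: real and x y :: "'a \<times> 'b"
  show "norm (a *\<^sub>C x) = cmod a * norm x"
    by (simp add: scaleC_prod_def norm_prod_def norm_scaleC power_mult_distrib real_sqrt_mult
        flip: distrib_left)
qed (simp_all add: scaleC_prod_def prod_eq_iff scaleC_add_right scaleC_add_left scaleC_scaleC
    scaleC_of_real)
end

instantiation prod :: (complex_hilbert, complex_hilbert) complex_hilbert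
begin
definition "cinner_prod p q = cinner (fst p) (fst q) + cinner (snd p) (snd q)"
instance
proof
  fix a :: complex and x y z :: "'a \<times> 'b"
  show "cinner x y = cnj (cinner y x)"
    by (simp add: cinner_prod_def flip: cinner_commute)
  show "cinner x x = complex_of_real ((norm x)\<^sup>2)"
    by (simp add: cinner_prod_def cinner_self norm_prod_def)
qed (simp_all add: cinner_prod_def scaleC_prod_def cinner_add_right cinner_scaleC_right
    algebra_simps)
end

section \<open>Adjoints of unbounded operators\<close>

lemma linear_operatorD:
  assumes "linear_operator T"
  shows "single_valued T" "(0, 0) \<in> T"
    "(x, y) \<in> T \<Longrightarrow> (x', y') \<in> T \<Longrightarrow> (x + x', y + y') \<in> T"
    "(x, y) \<in> T \<Longrightarrow> (a *\<^sub>C x, a *\<^sub>C y) \<in> T"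
  using assms unfolding linear_operator_def by blast+

lemma csubspace_linear_operator: "linear_operator T \<Longrightarrow> csubspace T"
  unfolding linear_operator_def
  by (intro complex_vector.subspaceI) (auto simp: scaleC_prod_def zero_prod_def)

lemma adjoint_op_iff: "(k, h) \<in> adjoint_op T \<longleftrightarrow> (\<forall>x y. (x, y) \<in> T \<longrightarrow> cinner k y = cinner h x)"
  unfolding adjoint_op_def by blast

lemma csubspace_Domain_adjoint: "csubspace (Domain (adjoint_op T))"
proof (rule complex_vector.subspaceI)
  show "0 \<in> Domain (adjoint_op T)" by (auto simp: adjoint_op_iff Domain_iff intro!: exI[of _ 0])
next
  fix k k' assume "k \<in> Domain (adjoint_op T)" "k' \<in> Domain (adjoint_op T)"
  then obtain h h' where "(k, h) \<in> adjoint_op T" "(k', h') \<in> adjoint_op T" by blast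
  then have "(k + k', h + h') \<in> adjoint_op T" by (simp add: adjoint_op_iff cinner_add_left)
  then show "k + k' \<in> Domain (adjoint_op T)" by blast
next
  fix c k assume "k \<in> Domain (adjoint_op T)"
  then obtain h where "(k, h) \<in> adjoint_op T" by blast
  then have "(c *\<^sub>C k, c *\<^sub>C h) \<in> adjoint_op T" by (simp add: adjoint_op_iff cinner_scaleC_left)
  then show "c *\<^sub>C k \<in> Domain (adjoint_op T)" by blast
qed

text \<open>A vector orthogonal to the domain of the adjoint gives a point \<open>(0, k)\<close> of the double
  orthogonal complement of the graph, that is, of the closed graph itself.\<close>

lemma dense_Domain_adjoint:
  fixes T :: "('a::complex_hilbert, 'b::complex_hilbert) operator"
  assumes "dd_closed_operator T"
  shows "closure (Domain (adjoint_op T)) = UNIV"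
proof (rule orthogonal_complement_dense[OF csubspace_Domain_adjoint])
  have T: "linear_operator T" "closed T" using assms by (auto simp: dd_closed_operator_def)
  have "k = 0" if k: "k \<in> orthogonal_complement (Domain (adjoint_op T))" for k
  proof -
    \<comment> \<open>Project \<open>(0, k)\<close> onto the closed graph. Orthogonality of the
      residual \<open>(?h, ?l)\<close> to every \<open>(x, y)\<close> in \<open>T\<close> is exactly
      membership of \<open>(?l, - ?h)\<close> in the adjoint.\<close>
    obtain p where p: "p \<in> T" "(0, k) - p \<in> orthogonal_complement T"
      using orthogonal_projection_exists[OF csubspace_linear_operator[OF T(1)] T(2)] by blast
    let ?h = "- fst p" and ?l = "k - snd p"
    have orth: "cinner x ?h + cinner y ?l = 0" if "(x, y) \<in> T" for x y
      using p(2) that by (force simp: orthogonal_complement_def cinner_prod_def)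
    have "(?l, - ?h) \<in> adjoint_op T"
      unfolding adjoint_op_iff
    proof (intro allI impI)
      fix x y assume "(x, y) \<in> T"
      from orth[OF this] have "cinner y ?l = cinner x (- ?h)"
        by (simp add: eq_neg_iff_add_eq_0 add.commute)
      then show "cinner ?l y = cinner (- ?h) x" by (metis cinner_commute)
    qed
    then have "cinner ?l k = 0" using k unfolding orthogonal_complement_def by blast
    \<comment> \<open>The residual is also orthogonal to \<open>p\<close> itself. As
      \<open>?l\<close> is orthogonal to \<open>k\<close>, the squared norms of \<open>?l\<close>
      and \<open>fst p\<close> then add up to 0.\<close>
    moreover have "cinner (fst p) ?h + cinner (snd p) ?l = 0"
      by (rule orth) (use p in simp)
    moreover have "cinner k ?l = 0" using \<open>cinner ?l k = 0\<close> by (metis cinner_commute complex_cnj_zero)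
    ultimately have "cinner ?l ?l = cinner (fst p) ?h" by (simp add: cinner_diff_left add_eq_0_iff)
    then have "complex_of_real ((norm ?l)\<^sup>2 + (norm (fst p))\<^sup>2) = 0" by (simp add: cinner_self)
    then have "(norm ?l)\<^sup>2 + (norm (fst p))\<^sup>2 = 0" by (simp only: of_real_eq_0_iff)
    then have "?l = 0" "fst p = 0" by (auto simp: add_nonneg_eq_0_iff)
    then have "(0, k) \<in> T" using p(1) by (metis prod.collapse right_minus_eq)
    then show "k = 0" using linear_operatorD(1,2)[OF T(1)] by (auto dest: single_valuedD)
  qed
  then show "orthogonal_complement (Domain (adjoint_op T)) = {0}"
    by (auto simp: orthogonal_complement_def)
qed

subsection \<open>The closed graph theorem\<close>

lemma csubspace_Domain: "csubspace G \<Longrightarrow> csubspace (Domain G)"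
  unfolding complex_vector.subspace_def
  by (auto simp: Domain_iff zero_prod_def scaleC_prod_def) (fastforce, fastforce)

text \<open>Baire's theorem makes one of the sets \<open>A n\<close>, on which values are bounded by
  \<open>n\<close>, dense in some ball of the domain; successive approximation and closedness of the
  graph turn density into a bound. The domain is an arbitrary closed subspace, because the result is
  also applied to the inverse of a Fredholm operator, which lives on the range.\<close>

lemma closed_graph:
  fixes G :: "('a::{complex_normed_vector, banach} \<times> 'b::{complex_normed_vector, banach}) set"
  assumes G: "csubspace G" "closed G" "single_valued G" "closed (Domain G)"
  obtains C where "\<And>x y. (x, y) \<in> G \<Longrightarrow> norm y \<le> C * norm x"
proof -
  have G0: "(0, 0) \<in> G" using complex_vector.subspace_0[OF G(1)] by (simp add: zero_prod_def)
  have Gadd: "(x + x', y + y') \<in> G" if "(x, y) \<in> G" "(x', y') \<in> G" for x x' y y'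
    using complex_vector.subspace_add[OF G(1) that] by simp
  have Gdiff: "(x - x', y - y') \<in> G" if "(x, y) \<in> G" "(x', y') \<in> G" for x x' y y'
    using complex_vector.subspace_diff[OF G(1) that] by simp
  have Gscale: "(c *\<^sub>C x, c *\<^sub>C y) \<in> G" if "(x, y) \<in> G" for c x y
    using complex_vector.subspace_scale[OF G(1) that, of c] by (simp add: scaleC_prod_def)
  define D where "D = Domain G"
  define A where "A n = {x. \<exists>y. (x, y) \<in> G \<and> norm y \<le> real n}" for n
  have D: "closed D" "0 \<in> D" "csubspace D"
    using G G0 csubspace_Domain by (auto simp: D_def)
  have AD: "closure (A n) \<subseteq> D" for n
    using D(1) by (intro closure_minimal) (auto simp: A_def D_def)
  have UA: "(\<Union>n. closure (A n)) = D"
  proof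
    show "D \<subseteq> (\<Union>n. closure (A n))"
    proof
      fix x assume "x \<in> D"
      then obtain y where "(x, y) \<in> G" unfolding D_def by blast
      moreover obtain n where "norm y \<le> real n" using real_arch_simple by blast
      ultimately have "x \<in> A n" unfolding A_def by blast
      then show "x \<in> (\<Union>n. closure (A n))" using closure_subset by blast
    qed
  qed (use AD in blast)
  let ?X = "top_of_set D"
  have "\<exists>n. ?X interior_of (closure (A n)) \<noteq> {}"
  proof (rule ccontr)
    assume "\<not> ?thesis"
    then have empty: "?X interior_of (closure (A n)) = {}" for n by blast
    have cm: "completely_metrizable_space ?X"
      using D(1) completely_metrizable_space_euclidean
      by (intro completely_metrizable_space_closedin) (simp_all flip: closed_closedin)
    have "closedin ?X (closure (A n))" for n
      using AD D(1) by (intro closed_subset) auto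
    then have "?X interior_of (\<Union> (range (\<lambda>n. closure (A n)))) = {}"
      using empty cm by (intro Baire_category_alt) auto
    then have "?X interior_of D = {}" unfolding UA .
    moreover have "?X interior_of D = D" using interior_of_topspace[of ?X] by simp
    ultimately show False using D(2) by blast
  qed
  then obtain n x0 where "x0 \<in> ?X interior_of (closure (A n))" by blast
  then obtain V where V: "openin ?X V" "x0 \<in> V" "V \<subseteq> closure (A n)"
    unfolding interior_of_def by blast
  then obtain U where U: "open U" "V = D \<inter> U" unfolding openin_open by blast
  then obtain r where r: "0 < r" "ball x0 r \<subseteq> U" using V(2) openE by blast
  have x0: "x0 \<in> D" "x0 \<in> closure (A n)" using U V by auto
  \<comment> \<open>Differences of points of \<open>A n\<close> move the ball from \<open>x0\<close>
    to the origin, at the price of doubling the bound.\<close>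
  have ball: "u \<in> closure (A (2 * n))" if "u \<in> D" "norm u < r" for u
  proof -
    have "x0 + u \<in> D" using x0 that D(3) complex_vector.subspace_add by blast
    moreover have "x0 + u \<in> ball x0 r" using that by (simp add: dist_norm)
    ultimately have "x0 + u \<in> closure (A n)" using U V r by blast
    then obtain f g where fg: "\<forall>k. f k \<in> A n" "f \<longlonglongrightarrow> x0 + u" "\<forall>k. g k \<in> A n" "g \<longlonglongrightarrow> x0"
      using x0(2) unfolding closure_sequential by blast
    have "f k - g k \<in> A (2 * n)" for k
    proof -
      obtain y y' where "(f k, y) \<in> G" "norm y \<le> real n" "(g k, y') \<in> G" "norm y' \<le> real n"
        using fg unfolding A_def by blast
      then have "(f k - g k, y - y') \<in> G" "norm (y - y') \<le> real (2 * n)"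
        using Gdiff norm_triangle_ineq4[of y y'] by auto
      then show ?thesis unfolding A_def by blast
    qed
    moreover have "(\<lambda>k. f k - g k) \<longlonglongrightarrow> u" using tendsto_diff[OF fg(2,4)] by simp
    ultimately show ?thesis
      unfolding closure_sequential by (intro exI[of _ "\<lambda>k. f k - g k"]) simp
  qed
  \<comment> \<open>A vector of length \<open>r / 2\<close> is approximated within
    \<open>r / 4\<close> by an element of \<open>A (2 * n)\<close>. Rescaling from length
    \<open>r / 2\<close> to \<open>norm u\<close> turns the bound \<open>2 * n\<close> into
    \<open>4 * n / r * norm u\<close> and the error into \<open>norm u / 2\<close>.\<close>
  define C where "C = 4 * real n / r"
  have C0: "0 \<le> C" using r by (simp add: C_def)
  have "\<exists>p. p \<in> G \<and> norm (snd p) \<le> C * norm u \<and> norm (u - fst p) \<le> norm u / 2" if u: "u \<in> D" for u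
  proof (cases "u = 0")
    case True
    then show ?thesis using G0 by (intro exI[of _ "(0, 0)"]) simp
  next
    case False
    define t where "t = r / (2 * norm u)"
    have t: "0 < t" using r False by (simp add: t_def)
    have "complex_of_real t *\<^sub>C u \<in> D" using u D(3) complex_vector.subspace_scale by blast
    moreover have "norm (complex_of_real t *\<^sub>C u) = t * norm u"
      using t by (simp add: norm_scaleC)
    then have "norm (complex_of_real t *\<^sub>C u) < r" using False r by (simp add: t_def)
    ultimately have "complex_of_real t *\<^sub>C u \<in> closure (A (2 * n))" by (rule ball)
    then obtain a where a: "a \<in> A (2 * n)" "dist a (complex_of_real t *\<^sub>C u) < r / 4"
      using r(1) unfolding closure_approachable by (metis divide_pos_pos zero_less_numeral)
    then obtain y where y: "(a, y) \<in> G" "norm y \<le> real (2 * n)" unfolding A_def by blast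
    let ?c = "complex_of_real (inverse t)"
    have "u - ?c *\<^sub>C a = ?c *\<^sub>C (complex_of_real t *\<^sub>C u - a)"
      using t by (simp add: complex_vector.scale_right_diff_distrib scaleC_scaleC flip: of_real_mult)
    then have "norm (u - ?c *\<^sub>C a) = inverse t * norm (complex_of_real t *\<^sub>C u - a)"
      using t by (simp only: norm_scaleC norm_of_real) simp
    also have "\<dots> \<le> inverse t * (r / 4)"
      using a(2) t by (intro mult_left_mono) (simp_all add: dist_norm norm_minus_commute)
    also have "\<dots> = norm u / 2" using r False by (simp add: t_def)
    finally have 1: "norm (u - ?c *\<^sub>C a) \<le> norm u / 2" .
    have "norm (?c *\<^sub>C y) = inverse t * norm y"
      using t by (simp only: norm_scaleC norm_of_real) simp
    also have "\<dots> \<le> inverse t * real (2 * n)" using y t by (intro mult_left_mono) simp_all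
    also have "\<dots> = C * norm u" using r by (simp add: t_def C_def)
    finally have 2: "norm (?c *\<^sub>C y) \<le> C * norm u" .
    show ?thesis using 1 2 Gscale[OF y(1), of ?c] by (intro exI[of _ "(?c *\<^sub>C a, ?c *\<^sub>C y)"]) simp
  qed
  then obtain p where p: "\<And>u. u \<in> D \<Longrightarrow> p u \<in> G" "\<And>u. u \<in> D \<Longrightarrow> norm (snd (p u)) \<le> C * norm u"
    "\<And>u. u \<in> D \<Longrightarrow> norm (u - fst (p u)) \<le> norm u / 2" by metis
  have "norm y \<le> (C * 2) * norm x" if xy: "(x, y) \<in> G" for x y
  proof -
    \<comment> \<open>\<open>u k\<close> is what remains of \<open>x\<close> after \<open>k\<close>
      approximations. Its norm halves each time, so the approximating values have a sum
      \<open>Y\<close>, and closedness of the graph identifies \<open>Y\<close> with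
      \<open>y\<close>.\<close>
    define u where "u = rec_nat x (\<lambda>k w. w - fst (p w))"
    have u0: "u 0 = x" and uS: "\<And>k. u (Suc k) = u k - fst (p (u k))" by (simp_all add: u_def)
    have uD: "u k \<in> D" for k
    proof (induction k)
      case 0
      then show ?case using xy by (auto simp: u0 D_def)
    next
      case (Suc k)
      then have "fst (p (u k)) \<in> D" using p(1) by (metis D_def Domain.DomainI prod.collapse)
      then show ?case using Suc D(3) by (simp add: uS complex_vector.subspace_diff)
    qed
    have nu: "norm (u k) \<le> norm x * (1/2) ^ k" for k
    proof (induction k)
      case (Suc k)
      have "norm (u (Suc k)) \<le> norm (u k) / 2" using p(3)[OF uD] by (simp add: uS)
      with Suc show ?case by simp
    qed (simp add: u0)
    have ny: "norm (snd (p (u k))) \<le> (C * norm x) * (1/2) ^ k" for k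
    proof -
      have "norm (snd (p (u k))) \<le> C * norm (u k)" by (rule p(2)[OF uD])
      also have "\<dots> \<le> C * (norm x * (1/2) ^ k)" by (intro mult_left_mono nu C0)
      finally show ?thesis by (simp add: mult.assoc)
    qed
    have geo: "(\<lambda>k. (C * norm x) * (1/2) ^ k) sums ((C * norm x) * 2)"
      using sums_mult[OF geometric_sums[of "1/2::real"], of "C * norm x"] by simp
    have sumn: "summable (\<lambda>k. norm (snd (p (u k))))"
      using ny by (intro summable_comparison_test'[OF sums_summable[OF geo], of 0]) simp
    define Y where "Y = (\<Sum>k. snd (p (u k)))"
    have "norm Y \<le> (\<Sum>k. norm (snd (p (u k))))" unfolding Y_def by (rule summable_norm[OF sumn])
    also have "\<dots> \<le> (C * norm x) * 2"
      using suminf_le[OF ny sumn sums_summable[OF geo]] sums_unique[OF geo] by simp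
    finally have Y: "norm Y \<le> (C * norm x) * 2" .
    have psum: "(x - u m, \<Sum>k<m. snd (p (u k))) \<in> G" for m
    proof (induction m)
      case (Suc m)
      have "(x - u m + fst (p (u m)), (\<Sum>k<m. snd (p (u k))) + snd (p (u m))) \<in> G"
        using Gadd[OF Suc, of "fst (p (u m))" "snd (p (u m))"] p(1)[OF uD] by simp
      then show ?case by (simp add: uS algebra_simps)
    qed (simp add: u0 G0)
    have "u \<longlonglongrightarrow> 0"
    proof (rule Lim_null_comparison)
      show "(\<lambda>k. norm x * (1/2) ^ k) \<longlonglongrightarrow> 0"
        by (intro tendsto_mult_right_zero LIMSEQ_power_zero) simp
    qed (use nu in auto)
    then have "(\<lambda>m. x - u m) \<longlonglongrightarrow> x" using tendsto_diff[OF tendsto_const, of u 0 _ x] by simp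
    moreover have "(\<lambda>m. \<Sum>k<m. snd (p (u k))) \<longlonglongrightarrow> Y"
      using summable_LIMSEQ[OF summable_norm_cancel[OF sumn]] by (simp add: Y_def)
    ultimately have "(\<lambda>m. (x - u m, \<Sum>k<m. snd (p (u k)))) \<longlonglongrightarrow> (x, Y)" by (rule tendsto_Pair)
    then have "(x, Y) \<in> G" by (rule closed_sequentially[OF G(2) psum])
    then have "y = Y" using single_valuedD[OF G(3) xy] by simp
    with Y show ?thesis by (simp add: ac_simps)
  qed
  then show thesis by (rule that)
qed

lemma everywhere_boundedI:
  fixes T :: "('a::{complex_normed_vector, banach}, 'b::{complex_normed_vector, banach}) operator"
  assumes T: "csubspace T" "closed T" "single_valued T" "Domain T = UNIV"
  shows "everywhere_bounded T"
proof -
  obtain C where C: "\<And>x y. (x, y) \<in> T \<Longrightarrow> norm y \<le> C * norm x"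
    using closed_graph[of T] T by auto
  have "\<forall>x. \<exists>y. (x, y) \<in> T" using T(4) by blast
  then obtain f where f: "\<And>x. (x, f x) \<in> T" by metis
  have f_eq: "f x = y" if "(x, y) \<in> T" for x y using single_valuedD[OF T(3) f that] .
  have add: "f (x + y) = f x + f y" for x y
    using complex_vector.subspace_add[OF T(1) f f] by (intro f_eq) simp
  have scale: "f (c *\<^sub>C x) = c *\<^sub>C f x" for c x
    using complex_vector.subspace_scale[OF T(1) f] by (intro f_eq) (simp add: scaleC_prod_def)
  have "bounded_linear f"
    using C[OF f] by (intro bounded_linear_intro[of _ C]) (auto simp: add scale scaleR_scaleC mult.commute)
  then have app: "blinfun_apply (Blinfun f) = f" by (rule bounded_linear_Blinfun_apply)
  have "Blinfun f \<in> \<B>" by (rule bounded_opsI) (simp add: app scale)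
  moreover have "graph_of (Blinfun f) = T" using f f_eq by (auto simp: graph_of_def app)
  ultimately show ?thesis unfolding everywhere_bounded_def by blast
qed

subsection \<open>Orthonormal sets\<close>

definition orthonormal :: "'a::complex_inner set \<Rightarrow> bool" where
  "orthonormal E \<longleftrightarrow> (\<forall>e\<in>E. \<forall>f\<in>E. cinner e f = (if e = f then 1 else 0))"

lemma orthonormalD: "orthonormal E \<Longrightarrow> e \<in> E \<Longrightarrow> f \<in> E \<Longrightarrow> cinner e f = (if e = f then 1 else 0)"
  by (simp add: orthonormal_def)

lemma orthonormal_norm: "orthonormal E \<Longrightarrow> e \<in> E \<Longrightarrow> norm e = 1"
proof -
  assume "orthonormal E" "e \<in> E"
  then have "complex_of_real ((norm e)\<^sup>2) = complex_of_real 1"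
    by (simp only: cinner_self[symmetric] orthonormalD) simp
  then have "(norm e)\<^sup>2 = 1" by (simp only: of_real_eq_iff)
  then have "norm e = 1 \<or> norm e = - 1" by (simp add: power2_eq_1_iff)
  then show "norm e = 1" using norm_ge_zero[of e] by linarith
qed

text \<open>For finite orthonormal \<open>E\<close> this is the orthogonal projection onto
  \<open>cspan E\<close>.\<close>

definition orthogonal_sum :: "'a::complex_inner set \<Rightarrow> 'a \<Rightarrow> 'a" where
  "orthogonal_sum E x = (\<Sum>e\<in>E. cinner e x *\<^sub>C e)"

lemma orthogonal_sum_in_cspan: "orthogonal_sum E x \<in> cspan E"
  unfolding orthogonal_sum_def
  by (intro complex_vector.span_sum complex_vector.span_scale complex_vector.span_base)

lemma cinner_orthogonal_sum:
  assumes "finite E" "orthonormal E" "f \<in> E"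
  shows "cinner f (orthogonal_sum E x) = cinner f x"
proof -
  have "cinner f (orthogonal_sum E x) = (\<Sum>e\<in>E. if e = f then cinner f x else 0)"
    unfolding orthogonal_sum_def cinner_sum_right
    using assms by (intro sum.cong) (auto simp: cinner_scaleC_right orthonormalD)
  then show ?thesis using assms by simp
qed

lemma cinner_cspan_zero:
  assumes "x \<in> cspan E" "\<And>e. e \<in> E \<Longrightarrow> cinner e v = 0"
  shows "cinner x v = 0"
  using assms(1)
  by (induction rule: complex_vector.span_induct_alt) (simp_all add: cinner_simps assms(2))

lemma orthogonal_sum_orthogonal:
  assumes "finite E" "orthonormal E" "y \<in> cspan E"
  shows "cinner y (x - orthogonal_sum E x) = 0"
  using assms by (intro cinner_cspan_zero[of y E]) (simp_all add: cinner_diff_right cinner_orthogonal_sum)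

lemma orthogonal_sum_id:
  assumes "finite E" "orthonormal E" "x \<in> cspan E"
  shows "orthogonal_sum E x = x"
proof -
  have "x - orthogonal_sum E x \<in> cspan E"
    using assms orthogonal_sum_in_cspan by (intro complex_vector.span_diff)
  then have "cinner (x - orthogonal_sum E x) (x - orthogonal_sum E x) = 0"
    by (rule orthogonal_sum_orthogonal[OF assms(1,2)])
  then show ?thesis by simp
qed

lemma orthogonal_sum_best:
  assumes "finite E" "orthonormal E" "y \<in> cspan E"
  shows "norm (x - orthogonal_sum E x) \<le> norm (x - y)"
proof (rule power2_le_imp_le)
  let ?s = "orthogonal_sum E x"
  have "?s - y \<in> cspan E" using assms orthogonal_sum_in_cspan by (intro complex_vector.span_diff)
  then have "cinner (?s - y) (x - ?s) = 0" by (rule orthogonal_sum_orthogonal[OF assms(1,2)])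
  from norm_add_orthogonal[OF this] show "(norm (x - ?s))\<^sup>2 \<le> (norm (x - y))\<^sup>2" by simp
qed simp

lemma orthonormal_insert:
  assumes E: "orthonormal E" and v: "v \<noteq> 0" "\<And>e. e \<in> E \<Longrightarrow> cinner e v = 0"
  shows "orthonormal (insert (inverse (norm v) *\<^sub>C v) E)"
proof -
  let ?e = "complex_of_real (inverse (norm v)) *\<^sub>C v"
  have "cinner ?e ?e = cnj (inverse (norm v)) * (inverse (norm v) * cinner v v)"
    by (simp only: cinner_scaleC_left cinner_scaleC_right ac_simps)
  also have "\<dots> = 1"
    using v(1) by (simp add: cinner_self power2_eq_square field_simps)
  finally have "cinner ?e ?e = 1" .
  moreover have "cinner f ?e = 0" if "f \<in> E" for f using v(2)[OF that] by (simp add: cinner_scaleC_right)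
  moreover from this have "cinner ?e f = 0" if "f \<in> E" for f
    using that by (metis cinner_commute complex_cnj_zero)
  ultimately show ?thesis using E unfolding orthonormal_def by (auto simp: E orthonormalD)
qed

lemma finite_orthonormalization:
  assumes "finite B"
  shows "\<exists>E. finite E \<and> orthonormal E \<and> cspan E = cspan (B :: 'a::complex_inner set)"
  using assms
proof (induction B)
  case empty
  show ?case by (intro exI[of _ "{}"]) (simp add: orthonormal_def)
next
  case (insert b B)
  then obtain E where E: "finite E" "orthonormal E" "cspan E = cspan B" by blast
  have eq: "cspan (insert b E) = cspan (insert b B)"
    using E(3) complex_vector.span_insert by metis
  define v where "v = b - orthogonal_sum E b"
  show ?case
  proof (cases "v = 0")
    case True
    then have "b \<in> cspan E" using orthogonal_sum_in_cspan[of E b] by (simp add: v_def)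
    then have "cspan (insert b E) = cspan E" by (rule complex_vector.span_redundant)
    then show ?thesis using E eq by blast
  next
    case False
    let ?e = "complex_of_real (inverse (norm v)) *\<^sub>C v"
    have "orthonormal (insert ?e E)"
      using E False by (intro orthonormal_insert) (auto simp: v_def cinner_diff_right cinner_orthogonal_sum)
    moreover have "cspan (insert ?e E) = cspan (insert b E)"
    proof (subst complex_vector.span_eq, intro conjI insert_subsetI)
      have s: "orthogonal_sum E b \<in> cspan (insert x E)" for x
        using orthogonal_sum_in_cspan complex_vector.span_mono[of E "insert x E"] by blast
      have "b \<in> cspan (insert b E)" by (simp add: complex_vector.span_base)
      then show "?e \<in> cspan (insert b E)"
        unfolding v_def by (intro complex_vector.span_scale complex_vector.span_diff s)
      have "complex_of_real (norm v) *\<^sub>C ?e + orthogonal_sum E b \<in> cspan (insert ?e E)"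
        by (intro complex_vector.span_add complex_vector.span_scale s complex_vector.span_base) simp
      moreover have "complex_of_real (norm v) *\<^sub>C ?e = v"
        using False by (simp add: scaleC_scaleC flip: of_real_mult)
      ultimately show "b \<in> cspan (insert ?e E)" by (simp add: v_def)
      show "E \<subseteq> cspan (insert b E)" "E \<subseteq> cspan (insert ?e E)"
        by (auto intro: complex_vector.span_base)
    qed
    ultimately show ?thesis using E eq by (intro exI[of _ "insert ?e E"]) simp
  qed
qed

lemma cfinite_dim_subset: "cfinite_dim T \<Longrightarrow> S \<subseteq> T \<Longrightarrow> cfinite_dim S"
  unfolding cfinite_dim_def by blast

lemma finite_dim_orthonormal_basis:
  assumes "csubspace S" "cfinite_dim (S :: 'a::complex_inner set)"
  obtains E where "finite E" "orthonormal E" "cspan E = S"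
proof -
  obtain B0 where B0: "finite B0" "S \<subseteq> cspan B0" using assms unfolding cfinite_dim_def by blast
  obtain B where B: "B \<subseteq> S" "\<not> complex_vector.dependent B" "S \<subseteq> cspan B"
    by (metis complex_vector.basis_exists)
  have "finite B" 
    using complex_vector.independent_span_bound[OF B0(1) B(2) subset_trans[OF B(1) B0(2)]] by simp
  moreover have "cspan B = S"
    using B complex_vector.span_minimal[OF B(1) assms(1)] by blast
  ultimately show thesis using finite_orthonormalization[of B] that by metis
qed

lemma orthonormal_independent:
  assumes "finite E" "orthonormal E"
  shows "\<not> complex_vector.dependent E"
proof
  assume "complex_vector.dependent E"
  then obtain u v where u: "v \<in> E" "u v \<noteq> 0" "(\<Sum>e\<in>E. u e *\<^sub>C e) = 0"
    using complex_vector.dependent_finite[OF assms(1)] by blast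
  have "0 = cinner v (\<Sum>e\<in>E. u e *\<^sub>C e)" by (simp add: u(3))
  also have "\<dots> = (\<Sum>e\<in>E. if e = v then u e else 0)"
    unfolding cinner_sum_right
    using assms u(1) by (intro sum.cong) (auto simp: cinner_scaleC_right orthonormalD)
  also have "\<dots> = u v" using assms(1) u(1) by simp
  finally show False using u(2) by simp
qed

lemma cdim_cspan_orthonormal: "finite E \<Longrightarrow> orthonormal E \<Longrightarrow> cdim (cspan E) = card E"
  using complex_vector.dim_span_eq_card_independent[OF orthonormal_independent] by simp

text \<open>A maximal orthonormal set has dense span, since a nonzero vector orthogonal to it could
  be normalized and added. Existence is what turns the choice made in \<open>op_trace\<close> into
  an actual basis.\<close>

lemma orthonormal_basis_exists: "\<exists>E. orthonormal_basis (E :: 'a::complex_hilbert set)"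
proof -
  obtain M :: "'a set" where M: "orthonormal M" "\<And>X. orthonormal X \<Longrightarrow> M \<subseteq> X \<Longrightarrow> X = M"
  proof -
    have "\<exists>M\<in>{E :: 'a set. orthonormal E}. \<forall>X\<in>{E. orthonormal E}. M \<subseteq> X \<longrightarrow> X = M"
    proof (rule subset_Zorn')
      fix C assume C: "subset.chain {E :: 'a set. orthonormal E} C"
      have "cinner e f = (if e = f then 1 else 0)" if ef: "e \<in> \<Union>C" "f \<in> \<Union>C" for e f
      proof -
        obtain X Y where XY: "e \<in> X" "X \<in> C" "f \<in> Y" "Y \<in> C" using ef by blast
        then have "X \<subseteq> Y \<or> Y \<subseteq> X" using C unfolding subset.chain_def by blast
        then obtain Z where "e \<in> Z" "f \<in> Z" "Z \<in> C" using XY by blast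
        then show ?thesis using C unfolding subset.chain_def by (auto simp: orthonormalD)
      qed
      then show "\<Union>C \<in> {E. orthonormal E}" by (simp add: orthonormal_def)
    qed
    then show thesis using that by blast
  qed
  have "orthogonal_complement (cspan M) = {0}"
  proof (rule ccontr)
    assume "orthogonal_complement (cspan M) \<noteq> {0}"
    then obtain v where v: "v \<noteq> 0" "v \<in> orthogonal_complement (cspan M)"
      by (auto simp: orthogonal_complement_def)
    then have perp: "cinner e v = 0" if "e \<in> M" for e
      using that complex_vector.span_base unfolding orthogonal_complement_def by blast
    let ?e = "complex_of_real (inverse (norm v)) *\<^sub>C v"
    \<comment> \<open>By maximality the normalized \<open>v\<close> already belongs to
      \<open>M\<close>, although \<open>v\<close> is orthogonal to \<open>M\<close>.\<close>
    have "insert ?e M = M"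
      using M(2)[of "insert ?e M"] orthonormal_insert[OF M(1) v(1) perp] by blast
    then have "cinner ?e v = 0" using perp by blast
    then show False using v(1) by (simp add: cinner_scaleC_left)
  qed
  then have "closure (cspan M) = UNIV"
    by (intro orthogonal_complement_dense complex_vector.subspace_span)
  then show ?thesis using M(1) unfolding orthonormal_basis_def orthonormal_def by blast
qed

text \<open>The partial sum over a finite \<open>Y\<close> is the best approximation from
  \<open>cspan Y\<close>, hence at least as good as any approximation that uses only part of
  \<open>Y\<close>.\<close>

lemma has_sum_orthonormal_basis:
  assumes "orthonormal_basis E"
  shows "((\<lambda>e. cinner e a *\<^sub>C e) has_sum a) E"
  unfolding has_sum_def tendsto_iff eventually_finite_subsets_at_top
proof (intro allI impI)
  fix \<epsilon> :: real assume "0 < \<epsilon>"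
  have "a \<in> closure (cspan E)" using assms by (simp add: orthonormal_basis_def)
  then obtain y where y: "y \<in> cspan E" "dist y a < \<epsilon>"
    using \<open>0 < \<epsilon>\<close> unfolding closure_approachable by blast
  then obtain F c where F: "finite F" "F \<subseteq> E" and yF: "y = (\<Sum>e\<in>F. c e *\<^sub>C e)"
    unfolding complex_vector.span_explicit by blast
  have "y \<in> cspan F" unfolding yF
    by (intro complex_vector.span_sum complex_vector.span_scale complex_vector.span_base)
  show "\<exists>X. finite X \<and> X \<subseteq> E \<and>
      (\<forall>Y. finite Y \<and> X \<subseteq> Y \<and> Y \<subseteq> E \<longrightarrow> dist (\<Sum>e\<in>Y. cinner e a *\<^sub>C e) a < \<epsilon>)"
  proof (intro exI[of _ F] conjI allI impI)
    fix Y assume Y: "finite Y \<and> F \<subseteq> Y \<and> Y \<subseteq> E"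
    have "orthonormal Y" using Y assms unfolding orthonormal_basis_def orthonormal_def by blast
    moreover have "y \<in> cspan Y" using \<open>y \<in> cspan F\<close> Y complex_vector.span_mono by blast
    ultimately have "norm (a - orthogonal_sum Y a) \<le> norm (a - y)"
      using Y by (intro orthogonal_sum_best) auto
    then show "dist (\<Sum>e\<in>Y. cinner e a *\<^sub>C e) a < \<epsilon>"
      using y(2) by (simp add: dist_norm norm_minus_commute orthogonal_sum_def)
  qed (use F in auto)
qed

subsection \<open>Traces of finite rank operators\<close>

text \<open>Expanding each \<open>B e\<close> in the finite set \<open>E\<close> exchanges a finite
  sum with the sum over the arbitrarily chosen basis, so that the choice drops out.\<close>

lemma op_trace_eq:
  assumes B: "B \<in> \<B>" "range (blinfun_apply B) \<subseteq> cspan E" and E: "finite E" "orthonormal E"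
  shows "op_trace B = (\<Sum>a\<in>E. cinner a (blinfun_apply B a))"
proof -
  define F :: "'a set" where "F = (SOME E. orthonormal_basis E)"
  have F: "orthonormal_basis F" unfolding F_def by (rule someI_ex[OF orthonormal_basis_exists])
  \<comment> \<open>The bounded functional \<open>x \<mapsto> cinner a (B x)\<close> is applied to
    the expansion of \<open>a\<close> in the chosen basis.\<close>
  have one: "((\<lambda>e. cinner e a * cinner a (blinfun_apply B e)) has_sum cinner a (blinfun_apply B a)) F"
    for a
  proof -
    have "bounded_linear (\<lambda>x. cinner a (blinfun_apply B x))"
      by (intro bounded_linear_compose[OF bounded_linear_cinner_right] blinfun.bounded_linear_right)
    from has_sum_bounded_linear[OF this has_sum_orthonormal_basis[OF F, of a]]
    show ?thesis by (simp add: o_def bounded_opsD[OF B(1)] cinner_scaleC_right)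
  qed
  have "cinner e (blinfun_apply B e) = (\<Sum>a\<in>E. cinner e a * cinner a (blinfun_apply B e))" for e
  proof -
    have "blinfun_apply B e \<in> cspan E" using B(2) by blast
    then have "cinner e (blinfun_apply B e) = cinner e (orthogonal_sum E (blinfun_apply B e))"
      by (simp add: orthogonal_sum_id E)
    then show ?thesis
      by (simp add: orthogonal_sum_def cinner_sum_right cinner_scaleC_right mult.commute)
  qed
  moreover have "((\<lambda>e. \<Sum>a\<in>E. cinner e a * cinner a (blinfun_apply B e)) has_sum
      (\<Sum>a\<in>E. cinner a (blinfun_apply B a))) F"
    using E(1) by (induction E) (simp_all add: one has_sum_add)
  ultimately show ?thesis unfolding op_trace_def F_def[symmetric] by (simp add: infsumI)
qed

lemma finite_rank_opsD:
  assumes "B \<in> \<F>" shows "B \<in> \<B>" "cfinite_dim (range (blinfun_apply B))"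
  using assms by (simp_all add: finite_rank_ops_def)

lemma finite_rank_basis:
  assumes "(B :: 'a::complex_normed_vector \<Rightarrow>\<^sub>L 'b::complex_inner) \<in> \<F>"
  obtains E where "finite E" "orthonormal E" "cspan E = range (blinfun_apply B)"
  using assms finite_dim_orthonormal_basis csubspace_range_bounded_op
  unfolding finite_rank_ops_def by blast

lemma cfinite_dim_add:
  assumes "cfinite_dim S" "cfinite_dim T"
  obtains B where "finite B" "S \<subseteq> cspan B" "T \<subseteq> cspan B"
proof -
  obtain B C where "finite B" "S \<subseteq> cspan B" "finite C" "T \<subseteq> cspan C"
    using assms unfolding cfinite_dim_def by blast
  then show thesis
    using that[of "B \<union> C"] complex_vector.span_mono[of B "B \<union> C"] complex_vector.span_mono[of C "B \<union> C"]
    by blast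
qed

lemma finite_rank_add [simp, intro]:
  assumes "A \<in> \<F>" "B \<in> \<F>" shows "A + B \<in> \<F>"
proof -
  obtain E where E: "finite E" "range (blinfun_apply A) \<subseteq> cspan E" "range (blinfun_apply B) \<subseteq> cspan E"
    using cfinite_dim_add assms finite_rank_opsD by metis
  have "range (blinfun_apply (A + B)) \<subseteq> cspan E"
    using E by (auto simp: blinfun.add_left intro!: complex_vector.span_add)
  then show ?thesis using assms E unfolding finite_rank_ops_def cfinite_dim_def by auto
qed

lemma finite_rank_zero [simp, intro]: "0 \<in> \<F>"
  unfolding finite_rank_ops_def cfinite_dim_def
  by (auto intro!: exI[of _ "{}"])

lemma finite_rank_compose_left [simp, intro]:
  assumes "A \<in> \<B>" "B \<in> \<F>" shows "A o\<^sub>L B \<in> \<F>"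
proof -
  obtain S where S: "finite S" "range (blinfun_apply B) \<subseteq> cspan S"
    using assms unfolding finite_rank_ops_def cfinite_dim_def by blast
  then have "range (blinfun_apply (A o\<^sub>L B)) \<subseteq> cspan (blinfun_apply A ` S)"
    using bounded_op_in_cspan[OF assms(1)] by auto
  then show ?thesis using assms S unfolding finite_rank_ops_def cfinite_dim_def by blast
qed

lemma finite_rank_compose_right [simp, intro]:
  assumes "A \<in> \<F>" "B \<in> \<B>" shows "A o\<^sub>L B \<in> \<F>"
proof -
  have "range (blinfun_apply (A o\<^sub>L B)) \<subseteq> range (blinfun_apply A)" by auto
  then show ?thesis using assms cfinite_dim_subset unfolding finite_rank_ops_def by blast
qed

lemma finite_rank_scaleC [simp, intro]: "A \<in> \<F> \<Longrightarrow> c *\<^sub>C A \<in> \<F>"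
  using finite_rank_compose_left[of "c *\<^sub>C id_blinfun" A] finite_rank_opsD(1)[of A]
  by (simp add: blinfun_compose_scaleC_left)

lemma finite_rank_uminus [simp, intro]: "A \<in> \<F> \<Longrightarrow> - A \<in> \<F>"
  using finite_rank_scaleC[of A "-1"] by simp

lemma op_trace_add:
  assumes "A \<in> \<F>" "B \<in> \<F>" shows "op_trace (A + B) = op_trace A + op_trace B"
proof -
  obtain S where S: "finite S" "range (blinfun_apply A) \<subseteq> cspan S" "range (blinfun_apply B) \<subseteq> cspan S"
    using cfinite_dim_add assms finite_rank_opsD by metis
  obtain E where E: "finite E" "orthonormal E" "cspan E = cspan S"
    using finite_orthonormalization S(1) by blast
  have "range (blinfun_apply (A + B)) \<subseteq> cspan E"
    using S E by (auto simp: blinfun.add_left intro!: complex_vector.span_add)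
  then show ?thesis
    using assms S E by (simp add: op_trace_eq[where E=E] finite_rank_opsD blinfun.add_left
        cinner_add_right sum.distrib)
qed

lemma op_trace_scaleC: "A \<in> \<F> \<Longrightarrow> op_trace (c *\<^sub>C A) = c * op_trace A"
proof -
  assume A: "A \<in> \<F>"
  then obtain E where E: "finite E" "orthonormal E" "cspan E = range (blinfun_apply A)"
    using finite_rank_basis by blast
  have "range (blinfun_apply (c *\<^sub>C A)) \<subseteq> cspan E"
    using complex_vector.span_scale[of _ E c] by (auto simp: E)
  then show ?thesis
    using A E by (simp add: op_trace_eq[where E=E] finite_rank_opsD cinner_scaleC_right sum_distrib_left)
qed

lemma op_trace_uminus: "A \<in> \<F> \<Longrightarrow> op_trace (- A) = - op_trace A"
  using op_trace_scaleC[of A "-1"] by simp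

text \<open>Expanding once along the range of \<open>X\<close> and once along the range of
  \<open>Y o\<^sub>L X\<close> turns both traces into the same finite double sum.\<close>

lemma op_trace_cyclic:
  assumes X: "X \<in> \<F>" and Y: "Y \<in> \<B>"
  shows "op_trace (X o\<^sub>L Y) = op_trace (Y o\<^sub>L X)"
proof -
  have XB: "X \<in> \<B>" using X finite_rank_opsD by blast
  obtain E where E: "finite E" "orthonormal E" "cspan E = range (blinfun_apply X)"
    using finite_rank_basis[OF X] by blast
  obtain F where F: "finite F" "orthonormal F" "cspan F = range (blinfun_apply (Y o\<^sub>L X))"
    using finite_rank_basis[of "Y o\<^sub>L X"] X Y by blast
  let ?x = "blinfun_apply X" and ?y = "blinfun_apply Y"
  have "op_trace (Y o\<^sub>L X) = (\<Sum>b\<in>F. cinner b (?y (?x b)))"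
    using X Y F XB by (subst op_trace_eq[where E=F]) auto
  also have "\<dots> = (\<Sum>b\<in>F. \<Sum>a\<in>E. cinner a (?x b) * cinner b (?y a))"
  proof (intro sum.cong refl)
    fix b
    have "?x b \<in> cspan E" using E by blast
    then have "?y (?x b) = ?y (orthogonal_sum E (?x b))" by (simp add: orthogonal_sum_id E)
    also have "\<dots> = (\<Sum>a\<in>E. cinner a (?x b) *\<^sub>C ?y a)"
      by (simp add: orthogonal_sum_def blinfun.sum_right bounded_opsD[OF Y])
    finally show "cinner b (?y (?x b)) = (\<Sum>a\<in>E. cinner a (?x b) * cinner b (?y a))"
      by (simp add: cinner_sum_right cinner_scaleC_right)
  qed
  also have "\<dots> = (\<Sum>a\<in>E. \<Sum>b\<in>F. cinner a (?x b) * cinner b (?y a))" by (rule sum.swap)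
  also have "\<dots> = (\<Sum>a\<in>E. cinner a (?x (?y a)))"
  proof (intro sum.cong refl)
    fix a assume "a \<in> E"
    then have "a \<in> range ?x" using E(3) complex_vector.span_base by blast
    then have "?y a \<in> cspan F" unfolding F(3) by auto
    then have "?x (?y a) = ?x (orthogonal_sum F (?y a))" by (simp add: orthogonal_sum_id F)
    also have "\<dots> = (\<Sum>b\<in>F. cinner b (?y a) *\<^sub>C ?x b)"
      by (simp add: orthogonal_sum_def blinfun.sum_right bounded_opsD[OF XB])
    finally show "(\<Sum>b\<in>F. cinner a (?x b) * cinner b (?y a)) = cinner a (?x (?y a))"
      by (simp add: cinner_sum_right cinner_scaleC_right mult.commute)
  qed
  also have "\<dots> = op_trace (X o\<^sub>L Y)"
    using X Y E XB by (subst op_trace_eq[where E=E]) auto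
  finally show ?thesis ..
qed

text \<open>An idempotent fixes every vector of an orthonormal basis of its range, so the trace
  counts that basis.\<close>

lemma op_trace_projection:
  assumes P: "P \<in> \<F>" "P o\<^sub>L P = P"
  shows "op_trace P = of_nat (cdim (range (blinfun_apply P)))"
proof -
  obtain E where E: "finite E" "orthonormal E" "cspan E = range (blinfun_apply P)"
    using finite_rank_basis[OF P(1)] by blast
  have "blinfun_apply P a = a" if "a \<in> E" for a
  proof -
    have "a \<in> range (blinfun_apply P)" using that E(3) complex_vector.span_base by blast
    then show ?thesis using P(2) by (metis blinfun_apply_blinfun_compose imageE)
  qed
  then have "op_trace P = (\<Sum>a\<in>E. 1)"
    using P E by (subst op_trace_eq[where E=E]) (auto simp: finite_rank_opsD orthonormalD)
  then show ?thesis using E cdim_cspan_orthonormal[OF E(1,2)] by simp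
qed

subsection \<open>Finite rank orthogonal projections\<close>

definition ortho_projection :: "'a::complex_hilbert set \<Rightarrow> ('a \<Rightarrow>\<^sub>L 'a)" where
  "ortho_projection E = Blinfun (orthogonal_sum E)"

lemma ortho_projection_apply [simp]: "blinfun_apply (ortho_projection E) x = orthogonal_sum E x"
proof -
  have "bounded_linear (orthogonal_sum E)"
    unfolding orthogonal_sum_def
    by (intro bounded_linear_sum bounded_linear_compose[OF
        bounded_bilinear.bounded_linear_left[OF bounded_bilinear_scaleC] bounded_linear_cinner_right])
  then show ?thesis unfolding ortho_projection_def by (simp add: bounded_linear_Blinfun_apply)
qed

lemma ortho_projection_finite_rank:
  assumes "finite E" shows "ortho_projection E \<in> \<F>"
proof -
  have "ortho_projection E \<in> \<B>"
    by (rule bounded_opsI) (simp add: orthogonal_sum_def cinner_scaleC_right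
        complex_vector.scale_sum_right scaleC_scaleC)
  moreover have "range (blinfun_apply (ortho_projection E)) \<subseteq> cspan E"
    using orthogonal_sum_in_cspan by auto
  ultimately show ?thesis using assms unfolding finite_rank_ops_def cfinite_dim_def by blast
qed

section \<open>Bounded inverses and resolvents\<close>

lemma in_graph_of [simp]: "(x, y) \<in> graph_of B \<longleftrightarrow> y = blinfun_apply B x"
  by (auto simp: graph_of_def)

lemma graph_of_inject: "graph_of A = graph_of B \<Longrightarrow> A = B"
  by (rule blinfun_eqI) (metis in_graph_of)

lemma as_bounded_graph_of: "B \<in> \<B> \<Longrightarrow> as_bounded (graph_of B) = B"
  unfolding as_bounded_def by (auto dest: graph_of_inject)

lemma everywhere_bounded_graph_of: "B \<in> \<B> \<Longrightarrow> everywhere_bounded (graph_of B)"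
  unfolding everywhere_bounded_def by blast

lemma as_boundedD:
  assumes "everywhere_bounded T"
  shows "as_bounded T \<in> \<B>" "graph_of (as_bounded T) = T"
  using assms as_bounded_graph_of unfolding everywhere_bounded_def by metis+

text \<open>Inverses as operator equations rather than converses of graphs, so that the algebra of
  composition applies to them.\<close>

definition is_inverse ::
  "('a::complex_normed_vector \<Rightarrow>\<^sub>L 'b::complex_normed_vector) \<Rightarrow> ('b \<Rightarrow>\<^sub>L 'a) \<Rightarrow> bool" where
  "is_inverse F G \<longleftrightarrow> F \<in> \<B> \<and> G \<in> \<B> \<and> F o\<^sub>L G = id_blinfun \<and> G o\<^sub>L F = id_blinfun"

lemma is_inverseD:
  assumes "is_inverse F G"
  shows "F \<in> \<B>" "G \<in> \<B>" "F o\<^sub>L G = id_blinfun" "G o\<^sub>L F = id_blinfun"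
    "blinfun_apply F (blinfun_apply G y) = y" "blinfun_apply G (blinfun_apply F x) = x"
    "F o\<^sub>L (G o\<^sub>L A) = A" "G o\<^sub>L (F o\<^sub>L B) = B"
  using assms unfolding is_inverse_def
  by (auto simp: blinfun_compose_assoc[symmetric])
    (metis blinfun_apply_blinfun_compose blinfun_apply_id_blinfun id_apply)+

lemma is_inverse_graph:
  assumes "F \<in> \<B>" "G \<in> \<B>"
  shows "(graph_of F)\<inverse> = graph_of G \<longleftrightarrow> is_inverse F G"
proof
  assume eq: "(graph_of F)\<inverse> = graph_of G"
  have iff: "y = blinfun_apply F x \<longleftrightarrow> x = blinfun_apply G y" for x y
  proof -
    have "(y, x) \<in> (graph_of F)\<inverse> \<longleftrightarrow> (y, x) \<in> graph_of G" using eq by simp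
    then show ?thesis by simp
  qed
  show "is_inverse F G"
    unfolding is_inverse_def
  proof (intro conjI blinfun_eqI assms)
    fix y show "blinfun_apply (F o\<^sub>L G) y = blinfun_apply id_blinfun y"
      using iff[of y "blinfun_apply G y"] by simp
  next
    fix x show "blinfun_apply (G o\<^sub>L F) x = blinfun_apply id_blinfun x"
      using iff[of "blinfun_apply F x" x] by simp
  qed
next
  assume "is_inverse F G"
  from is_inverseD(5,6)[OF this] show "(graph_of F)\<inverse> = graph_of G" by auto
qed

lemma boundedly_invertible_iff: "F \<in> \<B> \<Longrightarrow> boundedly_invertible F \<longleftrightarrow> (\<exists>G. is_inverse F G)"
  unfolding boundedly_invertible_def everywhere_bounded_def
  by (metis is_inverse_graph is_inverseD(2))

lemma bounded_inverse_eq: "is_inverse F G \<Longrightarrow> bounded_inverse F = G"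
  unfolding bounded_inverse_def using is_inverse_graph is_inverseD(1,2) as_bounded_graph_of by metis

text \<open>The equation \<open>x = y + T x\<close> is solved by the contraction principle.
  Uniqueness of the solution gives linearity in \<open>y\<close>, and the triangle inequality gives
  boundedness.\<close>

lemma Neumann_inverse:
  fixes T :: "'a::{complex_normed_vector, banach} \<Rightarrow>\<^sub>L 'a"
  assumes T: "T \<in> \<B>" "norm T < 1"
  shows "\<exists>G. is_inverse (id_blinfun - T) G"
proof -
  have "\<exists>!x. y + blinfun_apply T x = x" for y
  proof (rule banach_fix_type[of "norm T"])
    show "\<forall>u v. dist (y + blinfun_apply T u) (y + blinfun_apply T v) \<le> norm T * dist u v"
      by (simp add: dist_norm norm_blinfun flip: blinfun.diff_right)
  qed (use T in simp_all)
  then obtain g where g: "\<And>y. y + blinfun_apply T (g y) = g y"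
    and g_eq: "\<And>x y. y + blinfun_apply T x = x \<Longrightarrow> x = g y"
    by metis
  have add: "g (x + y) = g x + g y" for x y
    by (rule g_eq[symmetric]) (metis (no_types) add.assoc add.left_commute blinfun.add_right g)
  have scale: "g (c *\<^sub>C x) = c *\<^sub>C g x" for c x
    by (rule g_eq[symmetric]) (metis bounded_opsD[OF T(1)] g scaleC_add_right)
  have bound: "norm (g y) \<le> norm y * inverse (1 - norm T)" for y
  proof -
    have "norm (g y) \<le> norm y + norm (blinfun_apply T (g y))" by (metis g norm_triangle_ineq)
    also have "\<dots> \<le> norm y + norm T * norm (g y)" by (intro add_left_mono norm_blinfun)
    finally have "(1 - norm T) * norm (g y) \<le> norm y" by (simp add: algebra_simps)
    then show ?thesis using T(2) by (simp add: field_simps)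
  qed
  have "bounded_linear g"
    using bound by (intro bounded_linear_intro) (auto simp: add scale scaleR_scaleC)
  then have app: "blinfun_apply (Blinfun g) = g" by (rule bounded_linear_Blinfun_apply)
  have "is_inverse (id_blinfun - T) (Blinfun g)"
    unfolding is_inverse_def
  proof (intro conjI blinfun_eqI)
    show "Blinfun g \<in> \<B>" by (rule bounded_opsI) (simp add: app scale)
    fix x
    show "blinfun_apply ((id_blinfun - T) o\<^sub>L Blinfun g) x = blinfun_apply id_blinfun x"
      using g[of x] by (simp add: blinfun.diff_left app diff_eq_eq)
    show "blinfun_apply (Blinfun g o\<^sub>L (id_blinfun - T)) x = blinfun_apply id_blinfun x"
      by (simp add: blinfun.diff_left app g_eq[symmetric])
  qed (use T in auto)
  then show ?thesis ..
qed

section \<open>Resolvents and the resolvent equation\<close>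

lemma op_shift_iff: "(x, y) \<in> (op_shift T z)\<inverse> \<longleftrightarrow> (y, x + z *\<^sub>C y) \<in> T"
  unfolding op_shift_def by (auto simp: algebra_simps)

lemma resolventD:
  assumes "z \<in> \<rho> T"
  shows "resolvent T z \<in> \<B>" "graph_of (resolvent T z) = (op_shift T z)\<inverse>"
    "(y, x + z *\<^sub>C y) \<in> T \<longleftrightarrow> y = blinfun_apply (resolvent T z) x"
proof -
  have "everywhere_bounded ((op_shift T z)\<inverse>)" using assms by (simp add: resolvent_set_def)
  from as_boundedD[OF this] show *: "resolvent T z \<in> \<B>" "graph_of (resolvent T z) = (op_shift T z)\<inverse>"
    by (simp_all add: resolvent_def)
  show "(y, x + z *\<^sub>C y) \<in> T \<longleftrightarrow> y = blinfun_apply (resolvent T z) x"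
    unfolding op_shift_iff[symmetric] *(2)[symmetric] by simp
qed

lemma resolventI:
  assumes "B \<in> \<B>" "\<And>x y. (y, x + z *\<^sub>C y) \<in> T \<longleftrightarrow> y = blinfun_apply B x"
  shows "z \<in> \<rho> T" "resolvent T z = B"
proof -
  have "(op_shift T z)\<inverse> = graph_of B"
  proof (rule set_eqI)
    fix p
    show "p \<in> (op_shift T z)\<inverse> \<longleftrightarrow> p \<in> graph_of B"
      by (cases p) (simp only: op_shift_iff in_graph_of assms(2))
  qed
  then show "z \<in> \<rho> T" "resolvent T z = B"
    using assms(1) by (simp_all add: resolvent_set_def resolvent_def everywhere_bounded_graph_of
        as_bounded_graph_of)
qed

lemma resolvent_identity:
  assumes "z \<in> \<rho> T" "w \<in> \<rho> T"
  shows "resolvent T z - resolvent T w = (z - w) *\<^sub>C (resolvent T z o\<^sub>L resolvent T w)"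
proof (rule blinfun_eqI)
  fix x
  let ?Rz = "resolvent T z" and ?Rw = "resolvent T w"
  define y where "y = blinfun_apply ?Rw x"
  have "(y, x + w *\<^sub>C y) \<in> T" using resolventD(3)[OF assms(2)] y_def by blast
  then have "(y, (x + (w - z) *\<^sub>C y) + z *\<^sub>C y) \<in> T"
    by (simp add: complex_vector.scale_left_diff_distrib)
  then have "y = blinfun_apply ?Rz (x + (w - z) *\<^sub>C y)" using resolventD(3)[OF assms(1)] by blast
  then have "y = blinfun_apply ?Rz x + (w - z) *\<^sub>C blinfun_apply ?Rz y"
    by (metis blinfun.add_right bounded_opsD resolventD(1)[OF assms(1)])
  then have "blinfun_apply ?Rz x = y - (w - z) *\<^sub>C blinfun_apply ?Rz y"
    by (metis add_diff_cancel_right')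
  then have "blinfun_apply ?Rz x - y = (z - w) *\<^sub>C blinfun_apply ?Rz y"
    by (simp add: complex_vector.scale_left_diff_distrib)
  then show "blinfun_apply (?Rz - ?Rw) x = blinfun_apply ((z - w) *\<^sub>C (?Rz o\<^sub>L ?Rw)) x"
    by (simp add: blinfun.diff_left flip: y_def)
qed

lemma resolvent_commute:
  assumes "z \<in> \<rho> T" "w \<in> \<rho> T"
  shows "resolvent T z o\<^sub>L resolvent T w = resolvent T w o\<^sub>L resolvent T z"
proof (cases "z = w")
  case False
  have "(z - w) *\<^sub>C (resolvent T z o\<^sub>L resolvent T w) = (z - w) *\<^sub>C (resolvent T w o\<^sub>L resolvent T z)"
    using resolvent_identity[OF assms] resolvent_identity[OF assms(2,1)]
    by (metis (no_types) complex_vector.scale_minus_left minus_diff_eq)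
  then show ?thesis using False by simp
qed simp

text \<open>The resolvent equation in multiplicative form. It reduces questions about the resolvent
  at \<open>z\<close> to inverting an affine function of \<open>z\<close> built from one fixed
  resolvent.\<close>

lemma resolvent_is_inverse:
  assumes "z \<in> \<rho> T" "w \<in> \<rho> T"
  shows "is_inverse (id_blinfun - (z - w) *\<^sub>C resolvent T w) (id_blinfun + (z - w) *\<^sub>C resolvent T z)"
proof -
  note B = resolventD(1)[OF assms(1)] resolventD(1)[OF assms(2)]
  have 1: "(z - w) *\<^sub>C (resolvent T z o\<^sub>L resolvent T w) = resolvent T z - resolvent T w"
    using resolvent_identity[OF assms] by simp
  then have 2: "(z - w) *\<^sub>C (resolvent T w o\<^sub>L resolvent T z) = resolvent T z - resolvent T w"
    using resolvent_commute[OF assms] by simp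
  show ?thesis
    unfolding is_inverse_def using B
    by (auto simp: blinfun_compose_distrib 1 2 complex_vector.scale_right_diff_distrib)
qed

text \<open>Formally \<open>T - z = (1 - (z - w) R(w)) (T - w)\<close>, so that inverting the
  bounded factor inverts \<open>T - z\<close>.\<close>

lemma resolvent_setI:
  assumes w: "w \<in> \<rho> T" and G: "is_inverse (id_blinfun - (z - w) *\<^sub>C resolvent T w) G"
  shows "z \<in> \<rho> T"
proof (rule resolventI)
  let ?R = "resolvent T w"
  show "G o\<^sub>L ?R \<in> \<B>" using is_inverseD[OF G] resolventD(1)[OF w] by auto
  fix x y
  have "(y, x + z *\<^sub>C y) \<in> T \<longleftrightarrow> (y, (x + (z - w) *\<^sub>C y) + w *\<^sub>C y) \<in> T"
    by (simp add: complex_vector.scale_left_diff_distrib)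
  also have "\<dots> \<longleftrightarrow> y = blinfun_apply ?R (x + (z - w) *\<^sub>C y)" by (rule resolventD(3)[OF w])
  also have "\<dots> \<longleftrightarrow> blinfun_apply (id_blinfun - (z - w) *\<^sub>C ?R) y = blinfun_apply ?R x"
    by (simp add: blinfun.add_right blinfun.diff_left bounded_opsD[OF resolventD(1)[OF w]] diff_eq_eq)
  also have "\<dots> \<longleftrightarrow> y = blinfun_apply (G o\<^sub>L ?R) x"
    using is_inverseD(5,6)[OF G] by (metis blinfun_apply_blinfun_compose)
  finally show "(y, x + z *\<^sub>C y) \<in> T \<longleftrightarrow> y = blinfun_apply (G o\<^sub>L ?R) x" .
qed

lemma open_resolvent_set: "open (\<rho> (T :: ('a::{complex_normed_vector, banach}, 'a) operator))"
  unfolding open_dist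
proof
  fix w assume w: "w \<in> \<rho> T"
  define e where "e = inverse (norm (resolvent T w) + 1)"
  have "0 < norm (resolvent T w) + 1" by (simp add: add_nonneg_pos)
  then have e: "0 < e" by (simp add: e_def)
  show "\<exists>e>0. \<forall>z. dist z w < e \<longrightarrow> z \<in> \<rho> T"
  proof (intro exI[of _ e] conjI allI impI e)
    fix z assume "dist z w < e"
    then have "cmod (z - w) * (norm (resolvent T w) + 1) < 1"
      using \<open>0 < norm (resolvent T w) + 1\<close> by (simp add: e_def dist_norm field_simps)
    then have "norm ((z - w) *\<^sub>C resolvent T w) < 1"
      using norm_ge_zero[of "z - w"] by (simp only: norm_scaleC distrib_left mult_1_right)
    then show "z \<in> \<rho> T"
      using Neumann_inverse[of "(z - w) *\<^sub>C resolvent T w"] resolventD(1)[OF w] resolvent_setI[OF w]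
      by blast
  qed
qed

section \<open>Analytic operator-valued functions\<close>

text \<open>Difference quotients instead of the Frechet form, so that limit rules for products and
  inverses apply directly; \<open>op_has_deriv_iff\<close> links it to
  \<open>op_analytic_on\<close>.\<close>

definition op_has_deriv ::
  "(complex \<Rightarrow> ('a::complex_normed_vector \<Rightarrow>\<^sub>L 'b::complex_normed_vector)) \<Rightarrow> ('a \<Rightarrow>\<^sub>L 'b) \<Rightarrow> complex \<Rightarrow> bool" where
  "op_has_deriv f D z \<longleftrightarrow> ((\<lambda>w. inverse (w - z) *\<^sub>C (f w - f z)) \<longlongrightarrow> D) (at z)"

lemma op_has_deriv_iff: "(f has_derivative (\<lambda>h. h *\<^sub>C D)) (at z) \<longleftrightarrow> op_has_deriv f D z"
proof -
  have bl: "bounded_linear (\<lambda>h. h *\<^sub>C D)"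
    by (rule bounded_bilinear.bounded_linear_left[OF bounded_bilinear_scaleC])
  have eq: "norm (f w - f z - (w - z) *\<^sub>C D) / norm (w - z) = norm (inverse (w - z) *\<^sub>C (f w - f z) - D)"
    if "w \<noteq> z" for w
  proof -
    have "inverse (w - z) *\<^sub>C (f w - f z) - D = inverse (w - z) *\<^sub>C (f w - f z - (w - z) *\<^sub>C D)"
      using that by (simp add: complex_vector.scale_right_diff_distrib[of _ "f w - f z"] scaleC_scaleC)
    then show ?thesis by (simp add: norm_scaleC norm_inverse divide_inverse mult.commute)
  qed
  have "(f has_derivative (\<lambda>h. h *\<^sub>C D)) (at z) \<longleftrightarrow>
      ((\<lambda>w. norm (f w - f z - (w - z) *\<^sub>C D) / norm (w - z)) \<longlongrightarrow> 0) (at z)"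
    using bl by (simp add: has_derivative_iff_norm)
  also have "\<dots> \<longleftrightarrow> ((\<lambda>w. norm (inverse (w - z) *\<^sub>C (f w - f z) - D)) \<longlongrightarrow> 0) (at z)"
    by (intro tendsto_cong) (auto simp: eventually_at_filter eq)
  also have "\<dots> \<longleftrightarrow> op_has_deriv f D z"
    unfolding op_has_deriv_def tendsto_dist_iff[of _ D] dist_norm ..
  finally show ?thesis .
qed

lemma op_deriv_eq: "op_has_deriv f D z \<Longrightarrow> op_deriv f z = D"
  unfolding op_deriv_def op_has_deriv_iff op_has_deriv_def
  by (rule the_equality) (auto dest: tendsto_unique[rotated])

lemma op_analytic_on_iff:
  "op_analytic_on f S \<longleftrightarrow> open S \<and> (\<forall>z\<in>S. f z \<in> \<B> \<and> (\<exists>D. op_has_deriv f D z))"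
  by (simp add: op_analytic_on_def op_has_deriv_iff)

lemma op_analytic_onD:
  assumes "op_analytic_on f S"
  shows "open S" "z \<in> S \<Longrightarrow> f z \<in> \<B>" "z \<in> S \<Longrightarrow> \<exists>D. op_has_deriv f D z"
  using assms by (auto simp: op_analytic_on_iff)

lemma op_analytic_on_isCont: "op_analytic_on f S \<Longrightarrow> z \<in> S \<Longrightarrow> isCont f z"
  unfolding op_analytic_on_def using has_derivative_continuous by blast

lemma op_analytic_on_continuous_on: "op_analytic_on f S \<Longrightarrow> continuous_on S f"
  using op_analytic_on_isCont continuous_at_imp_continuous_on by blast

lemma op_analytic_on_subset: "op_analytic_on f S \<Longrightarrow> T \<subseteq> S \<Longrightarrow> open T \<Longrightarrow> op_analytic_on f T"
  by (auto simp: op_analytic_on_iff)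

lemma op_has_deriv_cong:
  assumes "op_has_deriv f D z" "open S" "z \<in> S" "\<And>w. w \<in> S \<Longrightarrow> f w = g w"
  shows "op_has_deriv g D z"
  unfolding op_has_deriv_def
proof (rule Lim_transform_eventually)
  show "((\<lambda>w. inverse (w - z) *\<^sub>C (f w - f z)) \<longlongrightarrow> D) (at z)" using assms(1) by (simp add: op_has_deriv_def)
  show "\<forall>\<^sub>F w in at z. inverse (w - z) *\<^sub>C (f w - f z) = inverse (w - z) *\<^sub>C (g w - g z)"
    using assms eventually_at_topological by (metis (mono_tags, lifting))
qed

lemma op_analytic_on_cong:
  assumes "op_analytic_on f S" "\<And>w. w \<in> S \<Longrightarrow> f w = g w"
  shows "op_analytic_on g S"
  using assms op_has_deriv_cong[of f _ _ S g] unfolding op_analytic_on_iff by metis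

lemma op_analytic_on_Un: "op_analytic_on f S \<Longrightarrow> op_analytic_on f T \<Longrightarrow> op_analytic_on f (S \<union> T)"
  by (auto simp: op_analytic_on_iff)

lemma op_analytic_on_const: "open S \<Longrightarrow> A \<in> \<B> \<Longrightarrow> op_analytic_on (\<lambda>_. A) S"
  by (auto simp: op_analytic_on_iff op_has_deriv_def intro!: exI[of _ 0])

lemma op_analytic_on_add:
  assumes "op_analytic_on f S" "op_analytic_on g S"
  shows "op_analytic_on (\<lambda>z. f z + g z) S"
proof -
  have "op_has_deriv (\<lambda>z. f z + g z) (D + E) z" if "op_has_deriv f D z" "op_has_deriv g E z" for z D E
    using tendsto_add[OF that[unfolded op_has_deriv_def]] unfolding op_has_deriv_def
    by (simp add: algebra_simps flip: scaleC_add_right)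
  then show ?thesis using assms unfolding op_analytic_on_iff by (metis bounded_ops_intros(3))
qed

lemma op_has_deriv_scaleC:
  assumes "(\<phi> has_field_derivative d) (at z)" "op_has_deriv f D z"
  shows "op_has_deriv (\<lambda>z. \<phi> z *\<^sub>C f z) (\<phi> z *\<^sub>C D + d *\<^sub>C f z) z"
proof -
  have "isCont \<phi> z" using assms(1) by (rule DERIV_isCont)
  then have "((\<lambda>w. \<phi> w *\<^sub>C (inverse (w - z) *\<^sub>C (f w - f z)) + ((\<phi> w - \<phi> z) / (w - z)) *\<^sub>C f z) \<longlongrightarrow>
      \<phi> z *\<^sub>C D + d *\<^sub>C f z) (at z)"
    using assms unfolding op_has_deriv_def has_field_derivative_iff isCont_def
    by (intro tendsto_intros)
  then show ?thesis
    unfolding op_has_deriv_def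
    by (simp add: scaleC_scaleC complex_vector.scale_right_diff_distrib divide_inverse algebra_simps)
qed

lemma op_analytic_on_scaleC:
  assumes "\<phi> holomorphic_on S" "op_analytic_on f S"
  shows "op_analytic_on (\<lambda>z. \<phi> z *\<^sub>C f z) S"
  unfolding op_analytic_on_iff
proof (intro conjI ballI)
  fix z assume z: "z \<in> S"
  obtain D where "op_has_deriv f D z" using op_analytic_onD(3)[OF assms(2) z] by blast
  then show "\<exists>D. op_has_deriv (\<lambda>z. \<phi> z *\<^sub>C f z) D z"
    using op_has_deriv_scaleC holomorphic_derivI[OF assms(1) op_analytic_onD(1)[OF assms(2)] z] by blast
  show "\<phi> z *\<^sub>C f z \<in> \<B>" using op_analytic_onD(2)[OF assms(2) z] by blast
qed (rule op_analytic_onD(1)[OF assms(2)])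

lemma op_has_deriv_compose:
  assumes "op_has_deriv f D z" "op_has_deriv g E z" "isCont g z" "f z \<in> \<B>"
  shows "op_has_deriv (\<lambda>z. f z o\<^sub>L g z) ((D o\<^sub>L g z) + (f z o\<^sub>L E)) z"
proof -
  have "((\<lambda>w. ((inverse (w - z) *\<^sub>C (f w - f z)) o\<^sub>L g w) + (f z o\<^sub>L (inverse (w - z) *\<^sub>C (g w - g z)))) \<longlongrightarrow>
      (D o\<^sub>L g z) + (f z o\<^sub>L E)) (at z)"
    using assms unfolding op_has_deriv_def isCont_def
    by (intro tendsto_intros bounded_bilinear.tendsto[OF bounded_bilinear_blinfun_compose])
  then show ?thesis
    unfolding op_has_deriv_def
    by (simp add: blinfun_compose_distrib assms(4) flip: scaleC_add_right)
qed

lemma op_analytic_on_compose: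
  assumes "op_analytic_on f S" "op_analytic_on g S"
  shows "op_analytic_on (\<lambda>z. f z o\<^sub>L g z) S"
  unfolding op_analytic_on_iff
proof (intro conjI ballI)
  fix z assume z: "z \<in> S"
  obtain D E where DE: "op_has_deriv f D z" "op_has_deriv g E z"
    using op_analytic_onD(3)[OF _ z] assms by metis
  show "\<exists>D. op_has_deriv (\<lambda>z. f z o\<^sub>L g z) D z"
    by (rule exI) (rule op_has_deriv_compose[OF DE op_analytic_on_isCont[OF assms(2) z]
        op_analytic_onD(2)[OF assms(1) z]])
  show "f z o\<^sub>L g z \<in> \<B>"
    by (intro bounded_ops_intros op_analytic_onD(2)[OF assms(1) z] op_analytic_onD(2)[OF assms(2) z])
qed (rule op_analytic_onD(1)[OF assms(1)])

lemma op_analytic_on_uminus: "op_analytic_on f S \<Longrightarrow> op_analytic_on (\<lambda>z. - f z) S"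
  using op_analytic_on_scaleC[of "\<lambda>_. -1" S f] by simp

lemma op_analytic_on_diff:
  "op_analytic_on f S \<Longrightarrow> op_analytic_on g S \<Longrightarrow> op_analytic_on (\<lambda>z. f z - g z) S"
  using op_analytic_on_add[OF _ op_analytic_on_uminus, of f S g] by simp

lemma op_analytic_on_sum:
  "open S \<Longrightarrow> (\<And>i. i \<in> I \<Longrightarrow> op_analytic_on (f i) S) \<Longrightarrow> op_analytic_on (\<lambda>z. \<Sum>i\<in>I. f i z) S"
  by (induction I rule: infinite_finite_induct) (auto intro: op_analytic_on_const op_analytic_on_add)

text \<open>Everything follows from \<open>g w - g z = - g w (f w - f z) g z\<close>: first local
  boundedness of \<open>g\<close>, then continuity, then the derivative
  \<open>- g f' g\<close>.\<close>

lemma op_analytic_on_inverse: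
  assumes f: "op_analytic_on f S" and g: "\<And>z. z \<in> S \<Longrightarrow> is_inverse (f z) (g z)"
  shows "op_analytic_on g S"
  unfolding op_analytic_on_iff
proof (intro conjI ballI)
  show S: "open S" using f op_analytic_onD by blast
  fix z assume z: "z \<in> S"
  show "g z \<in> \<B>" using g[OF z] is_inverseD by blast
  have ev: "\<forall>\<^sub>F w in at z. w \<in> S" using S z by (auto simp: eventually_at_topological)
  have id: "g w - g z = - (g w o\<^sub>L (f w - f z) o\<^sub>L g z)" if "w \<in> S" for w
    using is_inverseD[OF g[OF that]] is_inverseD[OF g[OF z]]
    by (simp add: blinfun_compose_distrib)
  have lim: "((\<lambda>w. f w - f z) \<longlongrightarrow> 0) (at z)"
    using op_analytic_on_isCont[OF f z] by (simp add: isCont_def LIM_zero)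
  have "((\<lambda>w. norm (f w - f z) * norm (g z)) \<longlongrightarrow> norm (0::'a \<Rightarrow>\<^sub>L 'b) * norm (g z)) (at z)"
    by (intro tendsto_intros lim)
  then have small: "\<forall>\<^sub>F w in at z. norm (f w - f z) * norm (g z) < 1/2"
    by (rule order_tendstoD) simp
  have bound: "\<forall>\<^sub>F w in at z. norm (g w - g z) \<le> 2 * norm (g z) * norm (g z) * norm (f w - f z)"
    using ev small
  proof eventually_elim
    case (elim w)
    have n: "norm (g w - g z) \<le> norm (g w) * (norm (f w - f z) * norm (g z))"
    proof -
      have "norm (g w - g z) \<le> norm (g w o\<^sub>L (f w - f z)) * norm (g z)"
        unfolding id[OF elim(1)] norm_minus_cancel by (rule norm_blinfun_compose)
      also have "\<dots> \<le> (norm (g w) * norm (f w - f z)) * norm (g z)"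
        by (intro mult_right_mono norm_blinfun_compose) simp
      finally show ?thesis by (simp add: mult.assoc)
    qed
    \<comment> \<open>The identity has \<open>g w\<close> on both sides; the factor 1/2 absorbs it
      and bounds \<open>g w\<close> by \<open>2 * norm (g z)\<close> without presupposing continuity
      of \<open>g\<close>.\<close>
    also have "\<dots> \<le> norm (g w) * (1/2)" using elim by (intro mult_left_mono) auto
    finally have "norm (g w) \<le> 2 * norm (g z)"
      using norm_triangle_sub[of "g w" "g z"] by linarith
    then have "norm (g w) * (norm (f w - f z) * norm (g z)) \<le> 2 * norm (g z) * (norm (f w - f z) * norm (g z))"
      by (intro mult_right_mono) auto
    with n show ?case by (simp add: ac_simps)
  qed
  have "((\<lambda>w. g w - g z) \<longlongrightarrow> 0) (at z)"
  proof (rule Lim_null_comparison[OF bound])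
    have "((\<lambda>w. 2 * norm (g z) * norm (g z) * norm (f w - f z)) \<longlongrightarrow>
        2 * norm (g z) * norm (g z) * norm (0::'a \<Rightarrow>\<^sub>L 'b)) (at z)"
      by (intro tendsto_intros lim)
    then show "((\<lambda>w. 2 * norm (g z) * norm (g z) * norm (f w - f z)) \<longlongrightarrow> 0) (at z)" by simp
  qed
  then have gz: "(g \<longlongrightarrow> g z) (at z)" by (rule LIM_zero_cancel)
  obtain D where D: "op_has_deriv f D z" using op_analytic_onD(3)[OF f z] by blast
  have "op_has_deriv g (- (g z o\<^sub>L D o\<^sub>L g z)) z"
    unfolding op_has_deriv_def
  proof (rule Lim_transform_eventually)
    show "((\<lambda>w. - (g w o\<^sub>L (inverse (w - z) *\<^sub>C (f w - f z)) o\<^sub>L g z)) \<longlongrightarrow> - (g z o\<^sub>L D o\<^sub>L g z)) (at z)"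
      using D gz unfolding op_has_deriv_def
      by (intro tendsto_intros bounded_bilinear.tendsto[OF bounded_bilinear_blinfun_compose])
    show "\<forall>\<^sub>F w in at z. - (g w o\<^sub>L (inverse (w - z) *\<^sub>C (f w - f z)) o\<^sub>L g z) =
        inverse (w - z) *\<^sub>C (g w - g z)"
      using ev
    proof eventually_elim
      case (elim w)
      then show ?case using is_inverseD(2)[OF g[OF elim]]
        by (simp add: id blinfun_compose_scaleC_left blinfun_compose_scaleC_right)
    qed
  qed
  then show "\<exists>D. op_has_deriv g D z" ..
qed

lemma op_analytic_on_resolvent:
  "op_analytic_on (resolvent T) (\<rho> (T :: ('a::{complex_normed_vector, banach}, 'a) operator))"
proof (cases "\<rho> T = {}")
  case False
  then obtain w where w: "w \<in> \<rho> T" by blast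
  let ?R = "resolvent T w"
  note R = resolventD(1)[OF w]
  have "op_analytic_on (\<lambda>z. id_blinfun - (z - w) *\<^sub>C ?R) (\<rho> T)"
    using R by (intro op_analytic_on_diff op_analytic_on_const op_analytic_on_scaleC open_resolvent_set
        holomorphic_intros) auto
  then have "op_analytic_on (\<lambda>z. id_blinfun + (z - w) *\<^sub>C resolvent T z) (\<rho> T)"
    by (rule op_analytic_on_inverse) (rule resolvent_is_inverse[OF _ w])
  then have "op_analytic_on (\<lambda>z. ?R o\<^sub>L (id_blinfun + (z - w) *\<^sub>C resolvent T z)) (\<rho> T)"
    using R by (intro op_analytic_on_compose op_analytic_on_const open_resolvent_set)
  then show ?thesis
  proof (rule op_analytic_on_cong)
    fix z assume z: "z \<in> \<rho> T"
    show "?R o\<^sub>L (id_blinfun + (z - w) *\<^sub>C resolvent T z) = resolvent T z"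
      using resolvent_identity[OF z w] resolvent_commute[OF z w] R
      by (simp add: blinfun_compose_distrib algebra_simps)
  qed
qed (simp add: op_analytic_on_iff)

subsection \<open>Operator-valued power series\<close>

text \<open>The sums are prescribed only off \<open>z\<^sub>0\<close>. Convergence at one point at
  distance \<open>r / 2\<close> already bounds the coefficients geometrically, which makes
  \<open>f z - a 0\<close> at most proportional to the distance from
  \<open>z\<^sub>0\<close>.\<close>

lemma power_series_tendsto:
  fixes a :: "nat \<Rightarrow> 'a::{complex_normed_vector, banach}"
  assumes "0 < r" and f: "\<And>z. z \<in> ball z\<^sub>0 r - {z\<^sub>0} \<Longrightarrow> (\<lambda>n. (z - z\<^sub>0) ^ n *\<^sub>C a n) sums f z"
  shows "(f \<longlongrightarrow> a 0) (at z\<^sub>0)"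
proof -
  define s where "s = r / 2"
  have s: "0 < s" "s < r" using assms(1) by (auto simp: s_def)
  have "z\<^sub>0 + complex_of_real s \<in> ball z\<^sub>0 r - {z\<^sub>0}" using s by (simp add: dist_norm)
  from sums_summable[OF f[OF this]] have "(\<lambda>n. complex_of_real s ^ n *\<^sub>C a n) \<longlonglongrightarrow> 0"
    by (auto dest: summable_LIMSEQ_zero)
  then have "Bseq (\<lambda>n. complex_of_real s ^ n *\<^sub>C a n)" by (intro convergent_imp_Bseq convergentI)
  then obtain C where C: "0 < C" "\<And>n. norm (complex_of_real s ^ n *\<^sub>C a n) \<le> C"
    unfolding Bseq_def by blast
  have an: "norm (a n) \<le> C / s ^ n" for n
    using C(2)[of n] s by (simp add: norm_scaleC norm_power field_simps)
  have bound: "norm (f z - a 0) \<le> 2 * C / s * norm (z - z\<^sub>0)" if z: "z \<noteq> z\<^sub>0" "norm (z - z\<^sub>0) < s / 2" for z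
  proof -
    define q where "q = norm (z - z\<^sub>0) / s"
    have q: "0 \<le> q" "q < 1/2" using z s by (auto simp: q_def field_simps)
    have "z \<in> ball z\<^sub>0 r - {z\<^sub>0}" using z s by (auto simp: dist_norm norm_minus_commute)
    from f[OF this] have sums: "(\<lambda>n. (z - z\<^sub>0) ^ Suc n *\<^sub>C a (Suc n)) sums (f z - a 0)"
      by (subst sums_Suc_iff) simp
    have le: "norm ((z - z\<^sub>0) ^ Suc n *\<^sub>C a (Suc n)) \<le> C * q * q ^ n" for n
    proof -
      have "norm ((z - z\<^sub>0) ^ Suc n *\<^sub>C a (Suc n)) \<le> norm (z - z\<^sub>0) ^ Suc n * (C / s ^ Suc n)"
        unfolding norm_scaleC norm_power by (intro mult_left_mono an) simp
      also have "\<dots> = C * q ^ Suc n" by (simp only: q_def power_divide) simp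
      finally show ?thesis by (simp add: mult.assoc)
    qed
    have geo: "(\<lambda>n. C * q * q ^ n) sums (C * q * (1 / (1 - q)))"
      by (intro sums_mult geometric_sums) (use q in simp)
    have sn: "summable (\<lambda>n. norm ((z - z\<^sub>0) ^ Suc n *\<^sub>C a (Suc n)))"
      using le by (intro summable_comparison_test'[OF sums_summable[OF geo], of 0]) simp
    have "norm (f z - a 0) \<le> (\<Sum>n. norm ((z - z\<^sub>0) ^ Suc n *\<^sub>C a (Suc n)))"
      unfolding sums_unique[OF sums] by (rule summable_norm[OF sn])
    also have "\<dots> \<le> C * q * (1 / (1 - q))"
      using suminf_le[OF le sn sums_summable[OF geo]] sums_unique[OF geo] by simp
    also have "\<dots> \<le> C * q * 2"
      using q C by (intro mult_left_mono) (auto simp: field_simps)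
    finally show ?thesis by (simp add: q_def field_simps)
  qed
  have "((\<lambda>z. f z - a 0) \<longlongrightarrow> 0) (at z\<^sub>0)"
  proof (rule Lim_null_comparison)
    show "\<forall>\<^sub>F z in at z\<^sub>0. norm (f z - a 0) \<le> 2 * C / s * norm (z - z\<^sub>0)"
      unfolding eventually_at using bound s by (intro exI[of _ "s/2"]) (auto simp: dist_norm)
    have "((\<lambda>z. 2 * C / s * norm (z - z\<^sub>0)) \<longlongrightarrow> 2 * C / s * norm (z\<^sub>0 - z\<^sub>0)) (at z\<^sub>0)"
      by (intro tendsto_intros)
    then show "((\<lambda>z. 2 * C / s * norm (z - z\<^sub>0)) \<longlongrightarrow> 0) (at z\<^sub>0)" by simp
  qed
  then show ?thesis by (rule LIM_zero_cancel)
qed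

lemma power_series_shift:
  fixes a :: "nat \<Rightarrow> 'a::{complex_normed_vector, banach}"
  assumes "(\<lambda>n. (z - z\<^sub>0) ^ n *\<^sub>C a n) sums s" "z \<noteq> z\<^sub>0"
  shows "(\<lambda>n. (z - z\<^sub>0) ^ n *\<^sub>C a (Suc n)) sums (inverse (z - z\<^sub>0) *\<^sub>C (s - a 0))"
proof -
  have "(\<lambda>n. (z - z\<^sub>0) ^ Suc n *\<^sub>C a (Suc n)) sums (s - a 0)"
    using assms(1) by (subst sums_Suc_iff) simp
  from bounded_linear.sums[OF bounded_linear_scaleC_right this, of "inverse (z - z\<^sub>0)"]
  show ?thesis using assms(2) by (simp add: scaleC_scaleC flip: mult.assoc)
qed

text \<open>The constant term is the limit at \<open>z\<^sub>0\<close>; peeling it off and dividing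
  by \<open>z - z\<^sub>0\<close> lowers the index of the coefficient in question.\<close>

lemma power_series_unique:
  fixes a b :: "nat \<Rightarrow> 'a::{complex_normed_vector, banach}"
  assumes "0 < r"
    and "\<And>z. z \<in> ball z\<^sub>0 r - {z\<^sub>0} \<Longrightarrow> (\<lambda>n. (z - z\<^sub>0) ^ n *\<^sub>C a n) sums f z"
    and "\<And>z. z \<in> ball z\<^sub>0 r - {z\<^sub>0} \<Longrightarrow> (\<lambda>n. (z - z\<^sub>0) ^ n *\<^sub>C b n) sums f z"
  shows "a n = b n"
  using assms(2,3)
proof (induction n arbitrary: a b f)
  case 0
  show ?case
    using power_series_tendsto[OF assms(1) 0(1)] power_series_tendsto[OF assms(1) 0(2)]
    by (rule tendsto_unique[OF at_neq_bot])
next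
  case (Suc n)
  have "a 0 = b 0"
    using power_series_tendsto[OF assms(1) Suc.prems(1)] power_series_tendsto[OF assms(1) Suc.prems(2)]
    by (rule tendsto_unique[OF at_neq_bot])
  show ?case
  proof (rule Suc.IH)
    fix z assume z: "z \<in> ball z\<^sub>0 r - {z\<^sub>0}"
    show "(\<lambda>n. (z - z\<^sub>0) ^ n *\<^sub>C a (Suc n)) sums (inverse (z - z\<^sub>0) *\<^sub>C (f z - a 0))"
      using z by (intro power_series_shift Suc.prems(1)) auto
    show "(\<lambda>n. (z - z\<^sub>0) ^ n *\<^sub>C b (Suc n)) sums (inverse (z - z\<^sub>0) *\<^sub>C (f z - a 0))"
      unfolding \<open>a 0 = b 0\<close> using z by (intro power_series_shift Suc.prems(2)) auto
  qed
qed

subsection \<open>Contour integrals and residues\<close>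

lemma bounded_linear_matrix_element: "bounded_linear (\<lambda>T. cinner y (blinfun_apply T x))"
  by (intro bounded_linear_compose[OF bounded_linear_cinner_right] blinfun.bounded_linear_left)

lemma holomorphic_matrix_element:
  assumes "op_analytic_on f S"
  shows "(\<lambda>z. cinner y (blinfun_apply (f z) x)) holomorphic_on S"
proof (rule holomorphic_onI)
  fix z assume z: "z \<in> S"
  obtain D where "op_has_deriv f D z" using op_analytic_onD(3)[OF assms z] by blast
  from bounded_linear.tendsto[OF bounded_linear_matrix_element this[unfolded op_has_deriv_def], of y x]
  have "((\<lambda>z. cinner y (blinfun_apply (f z) x)) has_field_derivative cinner y (blinfun_apply D x)) (at z)"
    unfolding has_field_derivative_iff
    by (simp add: cinner_scaleC_right cinner_diff_right blinfun.diff_left divide_inverse mult.commute)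
  then have "(\<lambda>z. cinner y (blinfun_apply (f z) x)) field_differentiable at z"
    unfolding field_differentiable_def by (rule exI)
  then show "(\<lambda>z. cinner y (blinfun_apply (f z) x)) field_differentiable at z within S"
    by (rule field_differentiable_at_within)
qed

text \<open>Residues are tested on matrix elements, where scalar residue calculus applies. They
  determine \<open>R\<close>, since matrix elements separate operators.\<close>

definition is_residue ::
  "(complex \<Rightarrow> ('a::complex_inner \<Rightarrow>\<^sub>L 'b::complex_inner)) \<Rightarrow> complex \<Rightarrow> ('a \<Rightarrow>\<^sub>L 'b) \<Rightarrow> bool" where
  "is_residue f z\<^sub>0 R \<longleftrightarrow>
     (\<forall>x y. cinner y (blinfun_apply R x) = residue (\<lambda>z. cinner y (blinfun_apply (f z) x)) z\<^sub>0)"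

lemma is_residue_unique: "is_residue f z\<^sub>0 R \<Longrightarrow> is_residue f z\<^sub>0 R' \<Longrightarrow> R = R'"
  unfolding is_residue_def by (rule blinfun_eqI, rule cinner_ext) simp

lemma circlepath_integrand_continuous:
  assumes "continuous_on (sphere z\<^sub>0 \<epsilon>) f" "0 < \<epsilon>"
  shows "continuous_on {0..1} (\<lambda>t. vector_derivative (circlepath z\<^sub>0 \<epsilon>) (at t within {0..1}) *\<^sub>C f
      (circlepath z\<^sub>0 \<epsilon> t))"
proof -
  have "continuous_on {0..1} (\<lambda>t. (2 * pi * \<i> * \<epsilon> * exp (2 * of_real pi * \<i> * of_real t)) *\<^sub>C f
      (circlepath z\<^sub>0 \<epsilon> t))"
  proof (intro continuous_intros continuous_on_compose2[OF assms(1)])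
    show "continuous_on {0..1} (circlepath z\<^sub>0 \<epsilon>)"
      using valid_path_circlepath valid_path_imp_path unfolding path_def by blast
    show "circlepath z\<^sub>0 \<epsilon> ` {0..1} \<subseteq> sphere z\<^sub>0 \<epsilon>"
      using path_image_circlepath[of z\<^sub>0 \<epsilon>] assms(2) unfolding path_image_def by simp
  qed
  then show ?thesis
    by (rule continuous_on_eq) (simp add: vector_derivative_circlepath01)
qed

lemma norm_path_integral_circlepath_le:
  assumes "continuous_on (sphere z\<^sub>0 \<epsilon>) f" "0 < \<epsilon>" "\<And>z. z \<in> sphere z\<^sub>0 \<epsilon> \<Longrightarrow> norm (f z) \<le> B"
  shows "norm (path_integral (circlepath z\<^sub>0 \<epsilon>) (f :: complex \<Rightarrow> 'a::{complex_normed_vector, banach}))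
      \<le> 2 * pi * \<epsilon> * B"
proof -
  have "norm (vector_derivative (circlepath z\<^sub>0 \<epsilon>) (at t within {0..1}) *\<^sub>C f (circlepath z\<^sub>0 \<epsilon> t))
      \<le> 2 * pi * \<epsilon> * B" if "t \<in> {0..1}" for t
  proof -
    have "circlepath z\<^sub>0 \<epsilon> t \<in> sphere z\<^sub>0 \<epsilon>"
      using path_image_circlepath[of z\<^sub>0 \<epsilon>] assms(2) that unfolding path_image_def by auto
    then have "2 * pi * \<epsilon> * norm (f (circlepath z\<^sub>0 \<epsilon> t)) \<le> 2 * pi * \<epsilon> * B"
      using assms(2) by (intro mult_left_mono assms(3)) auto
    moreover have "norm (exp (2 * of_real pi * \<i> * complex_of_real t)) = 1"
      by (simp add: norm_exp_eq_Re)
    ultimately show ?thesis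
      using that assms(2) by (simp add: vector_derivative_circlepath01 norm_scaleC norm_mult)
  qed
  from integral_bound[OF _ circlepath_integrand_continuous[OF assms(1,2)] this]
  show ?thesis unfolding path_integral_def by simp
qed

lemma path_integral_is_residue:
  fixes f :: "complex \<Rightarrow> ('a::complex_hilbert \<Rightarrow>\<^sub>L 'b::complex_hilbert)"
  assumes f: "op_analytic_on f (ball z\<^sub>0 r - {z\<^sub>0})" and \<epsilon>: "0 < \<epsilon>" "\<epsilon> < r"
  shows "is_residue f z\<^sub>0 ((1 / (2 * of_real pi * \<i>)) *\<^sub>C path_integral (circlepath z\<^sub>0 \<epsilon>) f)"
  unfolding is_residue_def
proof (intro allI)
  fix x y
  let ?\<phi> = "\<lambda>z. cinner y (blinfun_apply (f z) x)"
  let ?G = "\<lambda>t. vector_derivative (circlepath z\<^sub>0 \<epsilon>) (at t within {0..1}) *\<^sub>C f (circlepath z\<^sub>0 \<epsilon> t)"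
  have "sphere z\<^sub>0 \<epsilon> \<subseteq> ball z\<^sub>0 r - {z\<^sub>0}" using \<epsilon> by auto
  then have "continuous_on (sphere z\<^sub>0 \<epsilon>) f"
    using op_analytic_on_continuous_on[OF f] continuous_on_subset by blast
  then have int: "?G integrable_on {0..1}"
    by (intro integrable_continuous_interval circlepath_integrand_continuous \<epsilon>)
  have "cinner y (blinfun_apply (path_integral (circlepath z\<^sub>0 \<epsilon>) f) x) =
      integral {0..1} (\<lambda>t. ?\<phi> (circlepath z\<^sub>0 \<epsilon> t) * vector_derivative (circlepath z\<^sub>0 \<epsilon>) (at t within {0..1}))"
    using integral_linear[OF int bounded_linear_matrix_element[of y x]]
    by (simp add: path_integral_def o_def cinner_scaleC_right mult.commute)
  also have "\<dots> = 2 * pi * \<i> * residue ?\<phi> z\<^sub>0"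
  proof (rule integral_unique)
    have "cball z\<^sub>0 \<epsilon> \<subseteq> ball z\<^sub>0 r" using \<epsilon> by auto
    then have "(?\<phi> has_contour_integral 2 * pi * \<i> * residue ?\<phi> z\<^sub>0) (circlepath z\<^sub>0 \<epsilon>)"
      using \<epsilon> by (intro base_residue[of "ball z\<^sub>0 r"] holomorphic_matrix_element f) auto
    then show "((\<lambda>t. ?\<phi> (circlepath z\<^sub>0 \<epsilon> t) * vector_derivative (circlepath z\<^sub>0 \<epsilon>) (at t within {0..1}))
        has_integral 2 * pi * \<i> * residue ?\<phi> z\<^sub>0) {0..1}"
      by (simp add: has_contour_integral_def)
  qed
  finally show "cinner y (blinfun_apply ((1 / (2 * of_real pi * \<i>)) *\<^sub>C path_integral (circlepath z\<^sub>0 \<epsilon>) f) x) =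
      residue ?\<phi> z\<^sub>0"
    by (simp add: cinner_scaleC_right)
qed

text \<open>The ambient space consists of real linear maps, so complex linearity of a residue has to
  be derived from that of the values; scalar residues are complex linear.\<close>

lemma is_residue_bounded_ops:
  assumes R: "is_residue f z\<^sub>0 R" and f: "op_analytic_on f (ball z\<^sub>0 r - {z\<^sub>0})" and "0 < r"
  shows "R \<in> \<B>"
proof (rule bounded_opsI, rule cinner_ext)
  fix a x y
  have "residue (\<lambda>z. cinner y (blinfun_apply (f z) (a *\<^sub>C x))) z\<^sub>0 =
      residue (\<lambda>z. a * cinner y (blinfun_apply (f z) x)) z\<^sub>0"
  proof (rule residue_cong)
    have "\<forall>\<^sub>F z in at z\<^sub>0. z \<in> ball z\<^sub>0 r - {z\<^sub>0}" using assms(3) by (auto simp: eventually_at dist_commute)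
    then show "\<forall>\<^sub>F z in at z\<^sub>0. cinner y (blinfun_apply (f z) (a *\<^sub>C x)) = a * cinner y (blinfun_apply (f z) x)"
    proof eventually_elim
      case (elim z)
      then show ?case by (simp only: bounded_opsD[OF op_analytic_onD(2)[OF f elim]] cinner_scaleC_right)
    qed
  qed simp
  also have "\<dots> = a * residue (\<lambda>z. cinner y (blinfun_apply (f z) x)) z\<^sub>0"
    using assms(3) by (intro residue_lmul[of "ball z\<^sub>0 r"] holomorphic_matrix_element f) auto
  finally show "cinner y (blinfun_apply R (a *\<^sub>C x)) = cinner y (a *\<^sub>C blinfun_apply R x)"
    using R by (simp add: is_residue_def cinner_scaleC_right)
qed

subsection \<open>Removable singularities and Taylor expansions\<close>

text \<open>The coefficients are operator-valued Cauchy integrals, which bounds their norms; that the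
  series sums to the function is checked on matrix elements.\<close>

lemma op_power_series:
  fixes f :: "complex \<Rightarrow> ('a::complex_hilbert \<Rightarrow>\<^sub>L 'b::complex_hilbert)"
  assumes "0 < r" and f: "op_analytic_on f (ball z\<^sub>0 r - {z\<^sub>0})"
    and bd: "\<forall>\<^sub>F z in at z\<^sub>0. norm (f z) \<le> C"
  shows "\<exists>a. (\<forall>n. a n \<in> \<B>) \<and>
    (\<forall>z\<in>ball z\<^sub>0 r - {z\<^sub>0}. (\<lambda>n. (z - z\<^sub>0) ^ n *\<^sub>C a n) sums f z)"
proof -
  let ?D = "ball z\<^sub>0 r - {z\<^sub>0}"
  \<comment> \<open>Division by \<open>(z - z\<^sub>0) ^ Suc n\<close> moves the Taylor coefficient
    of index \<open>n\<close> into the residue.\<close>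
  define F where "F n z = inverse ((z - z\<^sub>0) ^ Suc n) *\<^sub>C f z" for n z
  have F: "op_analytic_on (F n) ?D" for n
    unfolding F_def by (intro op_analytic_on_scaleC f holomorphic_intros) auto
  have "\<exists>R. is_residue (F n) z\<^sub>0 R" for n
    using path_integral_is_residue[OF F, of "r/2" n] assms(1) by auto
  then obtain a where a: "\<And>n. is_residue (F n) z\<^sub>0 (a n)" by metis
  have aB: "a n \<in> \<B>" for n by (rule is_residue_bounded_ops[OF a F assms(1)])
  have coeff: "(\<lambda>n. (z - z\<^sub>0) ^ n * cinner y (blinfun_apply (a n) x)) sums cinner y (blinfun_apply (f z) x)"
    if z: "z \<in> ?D" for x y z
  proof -
    let ?\<phi> = "\<lambda>z. cinner y (blinfun_apply (f z) x)"
    have "\<forall>\<^sub>F z in at z\<^sub>0. norm (?\<phi> z) \<le> norm y * (C * norm x)"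
      using bd
    proof eventually_elim
      case (elim w)
      have "norm (?\<phi> w) \<le> norm y * norm (blinfun_apply (f w) x)" by (rule Cauchy_Schwarz)
      also have "norm (blinfun_apply (f w) x) \<le> norm (f w) * norm x" by (rule norm_blinfun)
      also have "norm (f w) * norm x \<le> C * norm x" using elim by (rule mult_right_mono) simp
      finally show ?case by (simp add: mult_left_mono)
    qed
    then obtain \<psi> where \<psi>: "\<psi> holomorphic_on ball z\<^sub>0 r" "\<And>z. z \<in> ?D \<Longrightarrow> \<psi> z = ?\<phi> z"
      using holomorphic_on_extend_bounded[of ?\<phi> "ball z\<^sub>0 r" z\<^sub>0] holomorphic_matrix_element[OF f, of y x] assms(1)
      by (auto simp: interior_open)
    have "cinner y (blinfun_apply (a n) x) = (deriv ^^ n) \<psi> z\<^sub>0 / fact n" for n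
    proof -
      have "cinner y (blinfun_apply (a n) x) = residue (\<lambda>z. cinner y (blinfun_apply (F n z) x)) z\<^sub>0"
        using a by (simp add: is_residue_def)
      also have "\<dots> = residue (\<lambda>z. \<psi> z / (z - z\<^sub>0) ^ Suc n) z\<^sub>0"
      proof (rule residue_cong)
        have "\<forall>\<^sub>F z in at z\<^sub>0. z \<in> ?D" using assms(1) by (auto simp: eventually_at dist_commute)
        then show "\<forall>\<^sub>F z in at z\<^sub>0. cinner y (blinfun_apply (F n z) x) = \<psi> z / (z - z\<^sub>0) ^ Suc n"
          by eventually_elim (simp add: \<psi> F_def cinner_scaleC_right divide_inverse mult.commute)
      qed simp
      also have "\<dots> = (deriv ^^ n) \<psi> z\<^sub>0 / fact n"
        using assms(1) \<psi>(1) by (intro residue_holomorphic_over_power[of "ball z\<^sub>0 r"]) auto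
      finally show ?thesis .
    qed
    then show ?thesis
      using holomorphic_power_series[OF \<psi>(1), of z] z \<psi>(2)[OF z] by (auto simp: mult.commute)
  qed
  have "(\<lambda>n. (z - z\<^sub>0) ^ n *\<^sub>C a n) sums f z" if z: "z \<in> ?D" for z
  proof -
    define t where "t = norm (z - z\<^sub>0)"
    \<comment> \<open>The radius of a circle strictly between \<open>z\<close> and the boundary: the
      Cauchy estimate on it makes the terms decay like powers of \<open>t / s < 1\<close>.\<close>
    define s where "s = (t + r) / 2"
    have "t < r" "0 < t" using z by (auto simp: t_def dist_norm norm_minus_commute)
    then have s: "0 < s" "s < r" "t < s" by (auto simp: s_def)
    have sub: "sphere z\<^sub>0 s \<subseteq> ?D" using s by auto
    then have cont: "continuous_on (sphere z\<^sub>0 s) f"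
      using op_analytic_on_continuous_on[OF f] continuous_on_subset by blast
    then have "bounded (f ` sphere z\<^sub>0 s)"
      by (intro compact_imp_bounded compact_continuous_image compact_sphere)
    then obtain M where M: "\<And>w. w \<in> sphere z\<^sub>0 s \<Longrightarrow> norm (f w) \<le> M" unfolding bounded_iff by blast
    have an: "norm (a n) \<le> M / s ^ n" for n
    proof -
      \<comment> \<open>\<open>a n\<close> was fixed as a residue, so it equals the integral over
        every admissible circle, in particular the one that depends on \<open>z\<close>.\<close>
      have "a n = (1 / (2 * of_real pi * \<i>)) *\<^sub>C path_integral (circlepath z\<^sub>0 s) (F n)"
        using a path_integral_is_residue[OF F s(1,2)] is_residue_unique by blast
      then have "norm (a n) = 1 / (2 * pi) * norm (path_integral (circlepath z\<^sub>0 s) (F n))"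
        by (simp add: norm_scaleC norm_divide norm_mult)
      also have "\<dots> \<le> 1 / (2 * pi) * (2 * pi * s * (inverse (s ^ Suc n) * M))"
      proof (intro mult_left_mono norm_path_integral_circlepath_le s)
        show "continuous_on (sphere z\<^sub>0 s) (F n)"
          using op_analytic_on_continuous_on[OF F] sub continuous_on_subset by blast
        fix w assume w: "w \<in> sphere z\<^sub>0 s"
        then have "norm (w - z\<^sub>0) = s" by (simp add: dist_norm norm_minus_commute)
        then show "norm (F n w) \<le> inverse (s ^ Suc n) * M"
          using M[OF w] s by (simp add: F_def norm_scaleC norm_inverse norm_mult norm_power mult_left_mono
              del: power_Suc)
      qed simp
      also have "\<dots> = M / s ^ n" using s by (simp add: field_simps)
      finally show ?thesis .
    qed
    have le: "norm ((z - z\<^sub>0) ^ n *\<^sub>C a n) \<le> M * (t / s) ^ n" for n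
      using mult_left_mono[OF an[of n], of "t ^ n"] \<open>0 < t\<close>
      by (simp add: norm_scaleC norm_power t_def power_divide mult.commute)
    have geo: "summable (\<lambda>n. M * (t / s) ^ n)"
      using s \<open>0 < t\<close> by (intro summable_mult summable_geometric) simp
    have "summable (\<lambda>n. norm ((z - z\<^sub>0) ^ n *\<^sub>C a n))"
      by (rule summable_comparison_test'[OF geo, of 0]) (simp only: real_norm_def abs_norm_cancel le)
    then have "summable (\<lambda>n. (z - z\<^sub>0) ^ n *\<^sub>C a n)" by (rule summable_norm_cancel)
    then obtain g where g: "(\<lambda>n. (z - z\<^sub>0) ^ n *\<^sub>C a n) sums g" by (auto simp: summable_def)
    have "g = f z"
    proof (rule blinfun_eqI, rule cinner_ext)
      fix x y
      have "(\<lambda>n. (z - z\<^sub>0) ^ n * cinner y (blinfun_apply (a n) x)) sums cinner y (blinfun_apply g x)"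
        using bounded_linear.sums[OF bounded_linear_matrix_element g, of y x]
        by (simp add: cinner_scaleC_right)
      then show "cinner y (blinfun_apply g x) = cinner y (blinfun_apply (f z) x)"
        using coeff[OF z] sums_unique2 by blast
    qed
    with g show ?thesis by simp
  qed
  then show ?thesis using aB by blast
qed

text \<open>The value at \<open>z\<^sub>0\<close> is the zeroth coefficient, and differentiability
  there is the limit of the once shifted power series.\<close>

lemma op_removable_singularity:
  fixes f :: "complex \<Rightarrow> ('a::complex_hilbert \<Rightarrow>\<^sub>L 'b::complex_hilbert)"
  assumes "0 < r" and f: "op_analytic_on f (ball z\<^sub>0 r - {z\<^sub>0})"
    and bd: "\<forall>\<^sub>F z in at z\<^sub>0. norm (f z) \<le> C"
  obtains g where "op_analytic_on g (ball z\<^sub>0 r)" "\<And>z. z \<in> ball z\<^sub>0 r - {z\<^sub>0} \<Longrightarrow> f z = g z"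
proof -
  obtain a where a: "\<And>n. a n \<in> \<B>"
    "\<And>z. z \<in> ball z\<^sub>0 r - {z\<^sub>0} \<Longrightarrow> (\<lambda>n. (z - z\<^sub>0) ^ n *\<^sub>C a n) sums f z"
    using op_power_series[OF assms] by blast
  define g where "g z = (if z = z\<^sub>0 then a 0 else f z)" for z
  have "op_has_deriv g (a 1) z\<^sub>0"
  proof -
    have "((\<lambda>z. inverse (z - z\<^sub>0) *\<^sub>C (f z - a 0)) \<longlongrightarrow> a (Suc 0)) (at z\<^sub>0)"
      using power_series_shift[OF a(2)] by (intro power_series_tendsto[OF assms(1), of z\<^sub>0 "\<lambda>n. a (Suc n)"]) auto
    moreover have "\<forall>\<^sub>F z in at z\<^sub>0. inverse (z - z\<^sub>0) *\<^sub>C (f z - a 0) = inverse (z - z\<^sub>0) *\<^sub>C (g z - g z\<^sub>0)"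
      by (auto simp: eventually_at_filter g_def)
    ultimately show ?thesis unfolding op_has_deriv_def One_nat_def by (rule Lim_transform_eventually)
  qed
  moreover have "op_analytic_on g (ball z\<^sub>0 r - {z\<^sub>0})"
    using f by (rule op_analytic_on_cong) (simp add: g_def)
  moreover have "g z\<^sub>0 \<in> \<B>" by (simp add: g_def a)
  ultimately have "op_analytic_on g (ball z\<^sub>0 r)"
    unfolding op_analytic_on_iff by blast
  then show thesis by (rule that) (simp add: g_def)
qed

lemma op_analytic_on_locally_bounded:
  assumes "op_analytic_on g S" "z\<^sub>0 \<in> S"
  shows "\<forall>\<^sub>F z in at z\<^sub>0. norm (g z) \<le> norm (g z\<^sub>0) + 1"
proof -
  have "((\<lambda>z. norm (g z)) \<longlongrightarrow> norm (g z\<^sub>0)) (at z\<^sub>0)"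
    using op_analytic_on_isCont[OF assms] by (intro tendsto_norm) (simp add: isCont_def)
  then have "\<forall>\<^sub>F z in at z\<^sub>0. norm (g z) < norm (g z\<^sub>0) + 1" by (rule order_tendstoD) simp
  then show ?thesis by eventually_elim simp
qed

lemma op_Taylor_series:
  fixes g :: "complex \<Rightarrow> ('a::complex_hilbert \<Rightarrow>\<^sub>L 'b::complex_hilbert)"
  assumes "0 < r" and g: "op_analytic_on g (ball z\<^sub>0 r)"
  obtains a where "\<And>n. a n \<in> \<B>" "a 0 = g z\<^sub>0"
    "\<And>z. z \<in> ball z\<^sub>0 r \<Longrightarrow> (\<lambda>n. (z - z\<^sub>0) ^ n *\<^sub>C a n) sums g z"
proof -
  have z0: "z\<^sub>0 \<in> ball z\<^sub>0 r" using assms(1) by simp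
  obtain a where a: "\<And>n. a n \<in> \<B>"
    "\<And>z. z \<in> ball z\<^sub>0 r - {z\<^sub>0} \<Longrightarrow> (\<lambda>n. (z - z\<^sub>0) ^ n *\<^sub>C a n) sums g z"
  proof -
    have "op_analytic_on g (ball z\<^sub>0 r - {z\<^sub>0})" by (rule op_analytic_on_subset[OF g]) auto
    from op_power_series[OF assms(1) this op_analytic_on_locally_bounded[OF g z0]] show thesis
      using that by blast
  qed
  have "(g \<longlongrightarrow> a 0) (at z\<^sub>0)" using assms(1) a(2) by (rule power_series_tendsto)
  moreover have "(g \<longlongrightarrow> g z\<^sub>0) (at z\<^sub>0)" using op_analytic_on_isCont[OF g z0] by (simp add: isCont_def)
  ultimately have a0: "a 0 = g z\<^sub>0" by (rule tendsto_unique[OF at_neq_bot])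
  have "(\<lambda>n. (z - z\<^sub>0) ^ n *\<^sub>C a n) sums g z" if "z \<in> ball z\<^sub>0 r" for z
  proof (cases "z = z\<^sub>0")
    case True
    have "(\<lambda>n. (0::complex) ^ n *\<^sub>C a n) sums (\<Sum>n\<in>{0}. (0::complex) ^ n *\<^sub>C a n)"
      by (rule sums_finite) auto
    then show ?thesis using True a0 by simp
  qed (use a(2) that in blast)
  then show thesis using a(1) a0 that by blast
qed

text \<open>The difference quotient of \<open>g\<close> tends to the derivative, so its singularity
  is removable; \<open>h\<close> is the extension.\<close>

lemma op_Taylor_divide:
  fixes g :: "complex \<Rightarrow> ('a::complex_hilbert \<Rightarrow>\<^sub>L 'b::complex_hilbert)"
  assumes "0 < r" and g: "op_analytic_on g (ball z\<^sub>0 r)"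
  obtains h where "op_analytic_on h (ball z\<^sub>0 r)"
    "\<And>z. z \<in> ball z\<^sub>0 r - {z\<^sub>0} \<Longrightarrow> inverse (z - z\<^sub>0) *\<^sub>C g z = inverse (z - z\<^sub>0) *\<^sub>C g z\<^sub>0 + h z"
proof -
  let ?q = "\<lambda>z. inverse (z - z\<^sub>0) *\<^sub>C (g z - g z\<^sub>0)"
  have z0: "z\<^sub>0 \<in> ball z\<^sub>0 r" using assms(1) by simp
  have q: "op_analytic_on ?q (ball z\<^sub>0 r - {z\<^sub>0})"
    using op_analytic_onD(2)[OF g z0]
    by (intro op_analytic_on_scaleC op_analytic_on_diff op_analytic_on_const op_analytic_on_subset[OF g]
        holomorphic_intros) auto
  obtain D where "op_has_deriv g D z\<^sub>0" using op_analytic_onD(3)[OF g z0] by blast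
  then have "((\<lambda>z. norm (?q z)) \<longlongrightarrow> norm D) (at z\<^sub>0)" unfolding op_has_deriv_def by (rule tendsto_norm)
  then have "\<forall>\<^sub>F z in at z\<^sub>0. norm (?q z) < norm D + 1" by (rule order_tendstoD) simp
  then have bd: "\<forall>\<^sub>F z in at z\<^sub>0. norm (?q z) \<le> norm D + 1" by eventually_elim simp
  obtain h where "op_analytic_on h (ball z\<^sub>0 r)" "\<And>z. z \<in> ball z\<^sub>0 r - {z\<^sub>0} \<Longrightarrow> ?q z = h z"
    using op_removable_singularity[OF assms(1) q bd] by blast
  then show thesis using that[of h] by (simp add: complex_vector.scale_right_diff_distrib diff_eq_eq add.commute)
qed

text \<open>Iterated division separates the pole created by dividing an analytic function by a
  power. This is the form in which an analytic factor meets a polar term in a product.\<close>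

lemma op_Taylor_split:
  fixes g :: "complex \<Rightarrow> ('a::complex_hilbert \<Rightarrow>\<^sub>L 'b::complex_hilbert)"
  assumes "0 < r" and g: "op_analytic_on g (ball z\<^sub>0 r)"
  shows "\<exists>b h. (\<forall>j. b j \<in> \<B>) \<and> op_analytic_on h (ball z\<^sub>0 r) \<and>
    (\<forall>z\<in>ball z\<^sub>0 r - {z\<^sub>0}. inverse ((z - z\<^sub>0) ^ Suc k) *\<^sub>C g z =
       (\<Sum>j\<le>k. inverse ((z - z\<^sub>0) ^ Suc j) *\<^sub>C b j) + h z)"
proof (induction k)
  case 0
  obtain h where h: "op_analytic_on h (ball z\<^sub>0 r)"
    "\<And>z. z \<in> ball z\<^sub>0 r - {z\<^sub>0} \<Longrightarrow> inverse (z - z\<^sub>0) *\<^sub>C g z = inverse (z - z\<^sub>0) *\<^sub>C g z\<^sub>0 + h z"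
    using op_Taylor_divide[OF assms] by blast
  then show ?case
    using op_analytic_onD(2)[OF g, of z\<^sub>0] assms(1) by (intro exI[of _ "\<lambda>_. g z\<^sub>0"] exI[of _ h]) auto
next
  case (Suc k)
  then obtain b h where b: "\<And>j. b j \<in> \<B>" and h: "op_analytic_on h (ball z\<^sub>0 r)" and
    eq: "\<And>z. z \<in> ball z\<^sub>0 r - {z\<^sub>0} \<Longrightarrow> inverse ((z - z\<^sub>0) ^ Suc k) *\<^sub>C g z =
       (\<Sum>j\<le>k. inverse ((z - z\<^sub>0) ^ Suc j) *\<^sub>C b j) + h z" by blast
  obtain h' where h': "op_analytic_on h' (ball z\<^sub>0 r)"
    "\<And>z. z \<in> ball z\<^sub>0 r - {z\<^sub>0} \<Longrightarrow> inverse (z - z\<^sub>0) *\<^sub>C h z = inverse (z - z\<^sub>0) *\<^sub>C h z\<^sub>0 + h' z"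
    using op_Taylor_divide[OF assms(1) h] by blast
  \<comment> \<open>One more division raises the order of each old coefficient by one and creates a
    new coefficient of order one, the value of \<open>h\<close> at \<open>z\<^sub>0\<close>.\<close>
  define b' where "b' j = (case j of 0 \<Rightarrow> h z\<^sub>0 | Suc i \<Rightarrow> b i)" for j
  have "h z\<^sub>0 \<in> \<B>" using op_analytic_onD(2)[OF h] assms(1) by simp
  then have "b' j \<in> \<B>" for j using b by (simp add: b'_def split: nat.split)
  moreover have "inverse ((z - z\<^sub>0) ^ Suc (Suc k)) *\<^sub>C g z =
      (\<Sum>j\<le>Suc k. inverse ((z - z\<^sub>0) ^ Suc j) *\<^sub>C b' j) + h' z" if z: "z \<in> ball z\<^sub>0 r - {z\<^sub>0}" for z
  proof -
    have "inverse ((z - z\<^sub>0) ^ Suc (Suc k)) *\<^sub>C g z = inverse (z - z\<^sub>0) *\<^sub>C inverse ((z - z\<^sub>0) ^ Suc k) *\<^sub>C g z"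
      by (simp add: scaleC_scaleC)
    also have "\<dots> = (\<Sum>j\<le>k. inverse (z - z\<^sub>0) *\<^sub>C inverse ((z - z\<^sub>0) ^ Suc j) *\<^sub>C b j) + inverse (z - z\<^sub>0) *\<^sub>C h z"
      by (simp only: eq[OF z] scaleC_add_right complex_vector.scale_sum_right)
    also have "\<dots> = (\<Sum>j\<le>k. inverse ((z - z\<^sub>0) ^ Suc (Suc j)) *\<^sub>C b' (Suc j)) +
        (inverse ((z - z\<^sub>0) ^ Suc 0) *\<^sub>C b' 0 + h' z)"
      by (simp add: h'(2)[OF z] b'_def scaleC_scaleC)
    finally show ?thesis by (subst sum.atMost_Suc_shift) (simp only: ac_simps)
  qed
  ultimately show ?case using h'(1) by blast
qed

section \<open>Finitely meromorphic functions and their residues\<close>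

text \<open>Indices are shifted by one: \<open>c k\<close> belongs to the exponent
  \<open>- (k + 1)\<close>, so \<open>c 0\<close> is the residue and orders up to
  \<open>N + 1\<close> occur.\<close>

definition principal_part ::
  "nat \<Rightarrow> (nat \<Rightarrow> 'a::complex_normed_vector) \<Rightarrow> complex \<Rightarrow> complex \<Rightarrow> 'a" where
  "principal_part N c z\<^sub>0 z = (\<Sum>k\<le>N. inverse ((z - z\<^sub>0) ^ Suc k) *\<^sub>C c k)"

text \<open>\<open>N + 1\<close> is only an upper bound for the order of the pole, since
  coefficients may vanish. The decomposition holds on the whole punctured disk of radius
  \<open>r\<close>, so that path integrals can be evaluated for every smaller circle.\<close>

definition has_finite_residue ::
  "(complex \<Rightarrow> ('a::complex_normed_vector \<Rightarrow>\<^sub>L 'b::complex_normed_vector)) \<Rightarrow> complex \<Rightarrow> real \<Rightarrow>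
      ('a \<Rightarrow>\<^sub>L 'b) \<Rightarrow> bool" where
  "has_finite_residue f z\<^sub>0 r R \<longleftrightarrow> (\<exists>N c g. (\<forall>k. c k \<in> \<F>) \<and> c 0 = R \<and> op_analytic_on g (ball z\<^sub>0 r) \<and>
     (\<forall>z\<in>ball z\<^sub>0 r - {z\<^sub>0}. f z = principal_part N c z\<^sub>0 z + g z))"

lemma has_finite_residueI:
  assumes "\<And>k. c k \<in> \<F>" "c 0 = R" "op_analytic_on g (ball z\<^sub>0 r)"
    "\<And>z. z \<in> ball z\<^sub>0 r - {z\<^sub>0} \<Longrightarrow> f z = principal_part N c z\<^sub>0 z + g z"
  shows "has_finite_residue f z\<^sub>0 r R"
  using assms unfolding has_finite_residue_def by blast

lemma has_finite_residueE:
  assumes "has_finite_residue f z\<^sub>0 r R"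
  obtains N c g where "\<And>k. c k \<in> \<F>" "c 0 = R" "op_analytic_on g (ball z\<^sub>0 r)"
    "\<And>z. z \<in> ball z\<^sub>0 r - {z\<^sub>0} \<Longrightarrow> f z = principal_part N c z\<^sub>0 z + g z"
  using assms unfolding has_finite_residue_def by blast

lemma has_finite_residue_finite_rank: "has_finite_residue f z\<^sub>0 r R \<Longrightarrow> R \<in> \<F>"
  unfolding has_finite_residue_def by blast

lemma has_finite_residue_cong:
  assumes "has_finite_residue f z\<^sub>0 r R" "\<And>z. z \<in> ball z\<^sub>0 r - {z\<^sub>0} \<Longrightarrow> f z = g z"
  shows "has_finite_residue g z\<^sub>0 r R"
proof -
  from assms(1) obtain N c h where "\<And>k. c k \<in> \<F>" "c 0 = R" "op_analytic_on h (ball z\<^sub>0 r)"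
    "\<And>z. z \<in> ball z\<^sub>0 r - {z\<^sub>0} \<Longrightarrow> f z = principal_part N c z\<^sub>0 z + h z"
    by (rule has_finite_residueE) blast
  then show ?thesis using assms(2) by (intro has_finite_residueI[of c R h z\<^sub>0 r g N]) auto
qed

lemma principal_part_analytic:
  assumes "\<And>k. c k \<in> \<B>"
  shows "op_analytic_on (principal_part N c z\<^sub>0) (ball z\<^sub>0 r - {z\<^sub>0})"
  unfolding principal_part_def
  by (intro op_analytic_on_sum op_analytic_on_scaleC op_analytic_on_const assms holomorphic_intros) auto

lemma has_finite_residue_analytic:
  assumes "has_finite_residue f z\<^sub>0 r R"
  shows "op_analytic_on f (ball z\<^sub>0 r - {z\<^sub>0})"
proof -
  from assms obtain N c g where c: "\<And>k. c k \<in> \<F>" and g: "op_analytic_on g (ball z\<^sub>0 r)"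
    and eq: "\<And>z. z \<in> ball z\<^sub>0 r - {z\<^sub>0} \<Longrightarrow> f z = principal_part N c z\<^sub>0 z + g z"
    by (rule has_finite_residueE) blast
  have "op_analytic_on (\<lambda>z. principal_part N c z\<^sub>0 z + g z) (ball z\<^sub>0 r - {z\<^sub>0})"
    using c finite_rank_opsD
    by (intro op_analytic_on_add principal_part_analytic op_analytic_on_subset[OF g]) auto
  then show ?thesis by (rule op_analytic_on_cong) (simp add: eq)
qed

lemma has_finite_residue_is_residue:
  fixes f :: "complex \<Rightarrow> ('a::complex_hilbert \<Rightarrow>\<^sub>L 'b::complex_hilbert)"
  assumes "has_finite_residue f z\<^sub>0 r R" "0 < r"
  shows "is_residue f z\<^sub>0 R"
  unfolding is_residue_def
proof (intro allI)
  fix x y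
  from assms(1) obtain N c g where c: "\<And>k. c k \<in> \<F>" "c 0 = R" and g: "op_analytic_on g (ball z\<^sub>0 r)"
    and eq: "\<And>z. z \<in> ball z\<^sub>0 r - {z\<^sub>0} \<Longrightarrow> f z = principal_part N c z\<^sub>0 z + g z"
    by (rule has_finite_residueE) blast
  let ?D = "ball z\<^sub>0 r - {z\<^sub>0}"
  let ?c = "\<lambda>k. cinner y (blinfun_apply (c k) x)"
  let ?p = "\<lambda>M z. \<Sum>k\<le>M. ?c k / (z - z\<^sub>0) ^ Suc k"
  have hol: "?p M holomorphic_on ?D" for M by (intro holomorphic_intros) auto
  have single: "residue (\<lambda>z. d / (z - z\<^sub>0) ^ Suc k) z\<^sub>0 = (if k = 0 then d else 0)" for d k
    using residue_holomorphic_over_power[of UNIV z\<^sub>0 "\<lambda>_. d" k] by simp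
  have sum: "residue (?p M) z\<^sub>0 = ?c 0" for M
  proof (induction M)
    case 0
    show ?case using single[of "?c 0" 0] by simp
  next
    case (Suc M)
    have "residue (\<lambda>z. ?p M z + ?c (Suc M) / (z - z\<^sub>0) ^ Suc (Suc M)) z\<^sub>0 =
        residue (?p M) z\<^sub>0 + residue (\<lambda>z. ?c (Suc M) / (z - z\<^sub>0) ^ Suc (Suc M)) z\<^sub>0"
      using assms(2) by (intro residue_add[of "ball z\<^sub>0 r"] hol holomorphic_intros) auto
    then show ?case using Suc single[of "?c (Suc M)" "Suc M"] by (simp del: power_Suc)
  qed
  have "residue (\<lambda>z. cinner y (blinfun_apply (f z) x)) z\<^sub>0 =
      residue (\<lambda>z. ?p N z + cinner y (blinfun_apply (g z) x)) z\<^sub>0"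
  proof (rule residue_cong)
    have "\<forall>\<^sub>F z in at z\<^sub>0. z \<in> ?D" using assms(2) by (auto simp: eventually_at dist_commute)
    then show "\<forall>\<^sub>F z in at z\<^sub>0. cinner y (blinfun_apply (f z) x) = ?p N z + cinner y (blinfun_apply (g z) x)"
    proof eventually_elim
      case (elim z)
      then show ?case
        by (simp add: eq principal_part_def blinfun.add_left blinfun.sum_left cinner_add_right
            cinner_sum_right cinner_scaleC_right divide_inverse mult.commute)
    qed
  qed simp
  also have "\<dots> = residue (?p N) z\<^sub>0 + residue (\<lambda>z. cinner y (blinfun_apply (g z) x)) z\<^sub>0"
    using assms(2)
    by (intro residue_add[of "ball z\<^sub>0 r"] hol holomorphic_on_subset[OF holomorphic_matrix_element[OF g]]) auto
  also have "residue (\<lambda>z. cinner y (blinfun_apply (g z) x)) z\<^sub>0 = 0"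
    using assms(2) by (intro residue_holo[of "ball z\<^sub>0 r"] holomorphic_matrix_element[OF g]) auto
  finally show "cinner y (blinfun_apply R x) = residue (\<lambda>z. cinner y (blinfun_apply (f z) x)) z\<^sub>0"
    using sum c by simp
qed

lemma has_finite_residue_path_integral:
  fixes f :: "complex \<Rightarrow> ('a::complex_hilbert \<Rightarrow>\<^sub>L 'b::complex_hilbert)"
  assumes "has_finite_residue f z\<^sub>0 r R" "0 < \<epsilon>" "\<epsilon> < r"
  shows "(1 / (2 * of_real pi * \<i>)) *\<^sub>C path_integral (circlepath z\<^sub>0 \<epsilon>) f = R"
  using path_integral_is_residue[OF has_finite_residue_analytic[OF assms(1)] assms(2,3)]
    has_finite_residue_is_residue[OF assms(1)] assms(2,3) by (intro is_residue_unique) auto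

lemma has_finite_residue_unique:
  fixes f :: "complex \<Rightarrow> ('a::complex_hilbert \<Rightarrow>\<^sub>L 'b::complex_hilbert)"
  assumes "has_finite_residue f z\<^sub>0 r R" "has_finite_residue f z\<^sub>0 r R'" "0 < r"
  shows "R = R'"
  using has_finite_residue_is_residue is_residue_unique assms by metis

lemma has_finite_residue_of_analytic:
  assumes "op_analytic_on g (ball z\<^sub>0 r)" shows "has_finite_residue g z\<^sub>0 r 0"
  by (rule has_finite_residueI[of "\<lambda>_. 0" _ g _ _ _ 0]) (use assms in \<open>auto simp: principal_part_def\<close>)

lemma principal_part_pad:
  assumes "M \<le> N"
  shows "principal_part N (\<lambda>k. if k \<le> M then c k else 0) z\<^sub>0 z = principal_part M c z\<^sub>0 z"
  unfolding principal_part_def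
  using assms by (intro sum.mono_neutral_cong_right) auto

lemma principal_part_add:
  "principal_part N (\<lambda>k. c k + d k) z\<^sub>0 z = principal_part N c z\<^sub>0 z + principal_part N d z\<^sub>0 z"
  by (simp add: principal_part_def scaleC_add_right sum.distrib)

lemma has_finite_residue_add:
  assumes "has_finite_residue f z\<^sub>0 r R" "has_finite_residue f' z\<^sub>0 r R'"
  shows "has_finite_residue (\<lambda>z. f z + f' z) z\<^sub>0 r (R + R')"
proof -
  from assms(1) obtain N c g where 1: "\<And>k. c k \<in> \<F>" "c 0 = R" "op_analytic_on g (ball z\<^sub>0 r)"
    "\<And>z. z \<in> ball z\<^sub>0 r - {z\<^sub>0} \<Longrightarrow> f z = principal_part N c z\<^sub>0 z + g z"
    by (rule has_finite_residueE) blast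
  from assms(2) obtain N' c' g' where 2: "\<And>k. c' k \<in> \<F>" "c' 0 = R'" "op_analytic_on g' (ball z\<^sub>0 r)"
    "\<And>z. z \<in> ball z\<^sub>0 r - {z\<^sub>0} \<Longrightarrow> f' z = principal_part N' c' z\<^sub>0 z + g' z"
    by (rule has_finite_residueE) blast
  let ?c = "\<lambda>k. (if k \<le> N then c k else 0) + (if k \<le> N' then c' k else 0)"
  show ?thesis
  proof (rule has_finite_residueI[of ?c _ "\<lambda>z. g z + g' z" _ _ _ "max N N'"])
    fix z assume "z \<in> ball z\<^sub>0 r - {z\<^sub>0}"
    then show "f z + f' z = principal_part (max N N') ?c z\<^sub>0 z + (g z + g' z)"
      using 1(4) 2(4) unfolding principal_part_add by (simp add: principal_part_pad)
  qed (use 1 2 op_analytic_on_add in auto)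
qed

lemma principal_part_compose_left:
  "A \<in> \<B> \<Longrightarrow> A o\<^sub>L principal_part N c z\<^sub>0 z = principal_part N (\<lambda>k. A o\<^sub>L c k) z\<^sub>0 z"
  by (simp add: principal_part_def blinfun_compose_sum_right blinfun_compose_scaleC_right)

lemma principal_part_compose_right:
  "principal_part N c z\<^sub>0 z o\<^sub>L A = principal_part N (\<lambda>k. c k o\<^sub>L A) z\<^sub>0 z"
  by (simp add: principal_part_def blinfun_compose_sum_left blinfun_compose_scaleC_left)

lemma has_finite_residue_compose_left:
  assumes "has_finite_residue f z\<^sub>0 r R" "A \<in> \<B>"
  shows "has_finite_residue (\<lambda>z. A o\<^sub>L f z) z\<^sub>0 r (A o\<^sub>L R)"
proof -
  from assms(1) obtain N c g where c: "\<And>k. c k \<in> \<F>" "c 0 = R" and g: "op_analytic_on g (ball z\<^sub>0 r)"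
    and eq: "\<And>z. z \<in> ball z\<^sub>0 r - {z\<^sub>0} \<Longrightarrow> f z = principal_part N c z\<^sub>0 z + g z"
    by (rule has_finite_residueE) blast
  show ?thesis
  proof (rule has_finite_residueI[of "\<lambda>k. A o\<^sub>L c k" _ "\<lambda>z. A o\<^sub>L g z" _ _ _ N])
    show "op_analytic_on (\<lambda>z. A o\<^sub>L g z) (ball z\<^sub>0 r)"
      by (intro op_analytic_on_compose op_analytic_on_const g assms(2)) simp
  qed (use c assms(2) in \<open>auto simp: eq blinfun_compose_distrib principal_part_compose_left\<close>)
qed

lemma has_finite_residue_compose_right:
  assumes "has_finite_residue f z\<^sub>0 r R" "A \<in> \<B>"
  shows "has_finite_residue (\<lambda>z. f z o\<^sub>L A) z\<^sub>0 r (R o\<^sub>L A)"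
proof -
  from assms(1) obtain N c g where c: "\<And>k. c k \<in> \<F>" "c 0 = R" and g: "op_analytic_on g (ball z\<^sub>0 r)"
    and eq: "\<And>z. z \<in> ball z\<^sub>0 r - {z\<^sub>0} \<Longrightarrow> f z = principal_part N c z\<^sub>0 z + g z"
    by (rule has_finite_residueE) blast
  show ?thesis
  proof (rule has_finite_residueI[of "\<lambda>k. c k o\<^sub>L A" _ "\<lambda>z. g z o\<^sub>L A" _ _ _ N])
    show "op_analytic_on (\<lambda>z. g z o\<^sub>L A) (ball z\<^sub>0 r)"
      by (intro op_analytic_on_compose op_analytic_on_const g assms(2)) simp
  qed (use c assms(2) in \<open>auto simp: eq blinfun_compose_distrib principal_part_compose_right\<close>)
qed

lemma has_finite_residue_uminus:
  assumes "has_finite_residue f z\<^sub>0 r R"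
  shows "has_finite_residue (\<lambda>z. - f z) z\<^sub>0 r (- R)"
  using has_finite_residue_compose_left[OF assms, of "- id_blinfun"] by (simp add: blinfun_compose_distrib)

lemma has_finite_residue_diff:
  assumes "has_finite_residue f z\<^sub>0 r R" "has_finite_residue f' z\<^sub>0 r R'"
  shows "has_finite_residue (\<lambda>z. f z - f' z) z\<^sub>0 r (R - R')"
  using has_finite_residue_add[OF assms(1) has_finite_residue_uminus[OF assms(2)]] by simp

lemma has_finite_residue_single:
  assumes "c \<in> \<F>"
  shows "has_finite_residue (\<lambda>z. inverse ((z - z\<^sub>0) ^ Suc k) *\<^sub>C c) z\<^sub>0 r (if k = 0 then c else 0)"
proof (rule has_finite_residueI[of "\<lambda>j. if j = k then c else 0" _ "\<lambda>_. 0" _ _ _ k])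
  show "op_analytic_on (\<lambda>_. 0) (ball z\<^sub>0 r)" by (rule op_analytic_on_const) auto
  show "inverse ((z - z\<^sub>0) ^ Suc k) *\<^sub>C c = principal_part k (\<lambda>j. if j = k then c else 0) z\<^sub>0 z + 0" for z
    by (simp add: principal_part_def if_distrib[of "scaleC _"] cong: if_cong del: power_Suc)
qed (use assms in auto)

text \<open>Subtracting the principal part leaves a function analytic on the large punctured disk
  that agrees with \<open>g\<close> near \<open>z\<^sub>0\<close>; the two glue together. Thus
  arguments valid only close to \<open>z\<^sub>0\<close> still give expansions of radius
  \<open>r\<close>.\<close>

lemma has_finite_residue_extend:
  assumes loc: "has_finite_residue f z\<^sub>0 \<delta> R" and "0 < \<delta>" and f: "op_analytic_on f (ball z\<^sub>0 r - {z\<^sub>0})"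
  shows "has_finite_residue f z\<^sub>0 r R"
proof -
  from loc obtain N c g where c: "\<And>k. c k \<in> \<F>" "c 0 = R" and g: "op_analytic_on g (ball z\<^sub>0 \<delta>)"
    and eq: "\<And>z. z \<in> ball z\<^sub>0 \<delta> - {z\<^sub>0} \<Longrightarrow> f z = principal_part N c z\<^sub>0 z + g z"
    by (rule has_finite_residueE) blast
  define h where "h z = (if z = z\<^sub>0 then g z\<^sub>0 else f z - principal_part N c z\<^sub>0 z)" for z
  have "op_analytic_on h (ball z\<^sub>0 \<delta>)" using g by (rule op_analytic_on_cong) (simp add: h_def eq)
  moreover have "op_analytic_on h (ball z\<^sub>0 r - {z\<^sub>0})"
  proof (rule op_analytic_on_cong)
    show "op_analytic_on (\<lambda>z. f z - principal_part N c z\<^sub>0 z) (ball z\<^sub>0 r - {z\<^sub>0})"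
      using c finite_rank_opsD by (intro op_analytic_on_diff f principal_part_analytic) auto
  qed (simp add: h_def)
  ultimately have "op_analytic_on h (ball z\<^sub>0 \<delta> \<union> (ball z\<^sub>0 r - {z\<^sub>0}))" by (rule op_analytic_on_Un)
  then have "op_analytic_on h (ball z\<^sub>0 r)"
    by (rule op_analytic_on_subset) (use \<open>0 < \<delta>\<close> in auto)
  then show ?thesis
    by (intro has_finite_residueI[of c R h z\<^sub>0 r f N]) (auto simp: c h_def)
qed

text \<open>The growth bound limits the order of the pole. Since composing with \<open>P\<close>
  does not change \<open>f\<close>, all Laurent coefficients may be composed with \<open>P\<close>
  as well, which makes the polar ones of finite rank.\<close>

lemma has_finite_residueI_growth:
  fixes f :: "complex \<Rightarrow> ('a::complex_hilbert \<Rightarrow>\<^sub>L 'b::complex_hilbert)"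
  assumes "0 < r" and f: "op_analytic_on f (ball z\<^sub>0 r - {z\<^sub>0})"
    and growth: "\<forall>\<^sub>F z in at z\<^sub>0. norm ((z - z\<^sub>0) ^ Suc N *\<^sub>C f z) \<le> C"
    and P: "P \<in> \<F>" "\<And>z. z \<in> ball z\<^sub>0 r - {z\<^sub>0} \<Longrightarrow> f z o\<^sub>L P = f z"
  shows "\<exists>R. has_finite_residue f z\<^sub>0 r R"
proof -
  have "op_analytic_on (\<lambda>z. (z - z\<^sub>0) ^ Suc N *\<^sub>C f z) (ball z\<^sub>0 r - {z\<^sub>0})"
    by (intro op_analytic_on_scaleC f holomorphic_intros)
  then obtain g where g: "op_analytic_on g (ball z\<^sub>0 r)"
    "\<And>z. z \<in> ball z\<^sub>0 r - {z\<^sub>0} \<Longrightarrow> (z - z\<^sub>0) ^ Suc N *\<^sub>C f z = g z"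
    using op_removable_singularity[OF assms(1) _ growth] by blast
  obtain b h where b: "\<And>j. b j \<in> \<B>" and h: "op_analytic_on h (ball z\<^sub>0 r)"
    and eq: "\<And>z. z \<in> ball z\<^sub>0 r - {z\<^sub>0} \<Longrightarrow> inverse ((z - z\<^sub>0) ^ Suc N) *\<^sub>C g z =
       (\<Sum>j\<le>N. inverse ((z - z\<^sub>0) ^ Suc j) *\<^sub>C b j) + h z"
    using op_Taylor_split[OF assms(1) g(1), of N] by blast
  have PB: "P \<in> \<B>" using P finite_rank_opsD by blast
  have "f z = principal_part N (\<lambda>k. b k o\<^sub>L P) z\<^sub>0 z + (h z o\<^sub>L P)" if z: "z \<in> ball z\<^sub>0 r - {z\<^sub>0}" for z
  proof -
    have "f z = inverse ((z - z\<^sub>0) ^ Suc N) *\<^sub>C g z"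
    proof -
      have nz: "(z - z\<^sub>0) ^ Suc N \<noteq> 0" using z by simp
      then show ?thesis
        by (simp only: g(2)[OF z, symmetric] scaleC_scaleC left_inverse[OF nz] scaleC_one)
    qed
    also have "\<dots> = principal_part N b z\<^sub>0 z + h z" unfolding principal_part_def by (rule eq[OF z])
    finally have "f z o\<^sub>L P = (principal_part N b z\<^sub>0 z + h z) o\<^sub>L P" by simp
    then show ?thesis using P(2)[OF z] by (simp add: blinfun_compose_distrib principal_part_compose_right)
  qed
  moreover have "op_analytic_on (\<lambda>z. h z o\<^sub>L P) (ball z\<^sub>0 r)"
    by (intro op_analytic_on_compose op_analytic_on_const h PB) simp
  ultimately show ?thesis
    using b P by (intro exI has_finite_residueI[of "\<lambda>k. b k o\<^sub>L P" _ "\<lambda>z. h z o\<^sub>L P" z\<^sub>0 r f N]) auto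
qed

subsection \<open>Residues of products\<close>

text \<open>The trace of the residue of a product does not depend on the order of the factors, although
  the two products need not be of trace class away from the singularity.\<close>

definition commuting_residues ::
  "(complex \<Rightarrow> ('b::complex_hilbert \<Rightarrow>\<^sub>L 'a::complex_hilbert)) \<Rightarrow> (complex \<Rightarrow>
      ('a \<Rightarrow>\<^sub>L 'b)) \<Rightarrow> complex \<Rightarrow> real \<Rightarrow> bool" where
  "commuting_residues f g z\<^sub>0 r \<longleftrightarrow> (\<exists>R S. has_finite_residue (\<lambda>z. f z o\<^sub>L g z) z\<^sub>0 r R \<and>
     has_finite_residue (\<lambda>z. g z o\<^sub>L f z) z\<^sub>0 r S \<and> op_trace R = op_trace S)"

lemma commuting_residues_sym: "commuting_residues f g z\<^sub>0 r \<Longrightarrow> commuting_residues g f z\<^sub>0 r"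
  unfolding commuting_residues_def by metis

lemma commuting_residues_add:
  assumes "commuting_residues f g z\<^sub>0 r" "commuting_residues f' g z\<^sub>0 r"
  shows "commuting_residues (\<lambda>z. f z + f' z) g z\<^sub>0 r"
proof -
  obtain R S where 1: "has_finite_residue (\<lambda>z. f z o\<^sub>L g z) z\<^sub>0 r R"
    "has_finite_residue (\<lambda>z. g z o\<^sub>L f z) z\<^sub>0 r S" "op_trace R = op_trace S"
    using assms(1) unfolding commuting_residues_def by blast
  obtain R' S' where 2: "has_finite_residue (\<lambda>z. f' z o\<^sub>L g z) z\<^sub>0 r R'"
    "has_finite_residue (\<lambda>z. g z o\<^sub>L f' z) z\<^sub>0 r S'" "op_trace R' = op_trace S'"
    using assms(2) unfolding commuting_residues_def by blast
  have "has_finite_residue (\<lambda>z. (f z + f' z) o\<^sub>L g z) z\<^sub>0 r (R + R')"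
    using has_finite_residue_add[OF 1(1) 2(1)] by (simp add: blinfun_compose_distrib)
  moreover have "has_finite_residue (\<lambda>z. g z o\<^sub>L (f z + f' z)) z\<^sub>0 r (S + S')"
    using has_finite_residue_add[OF 1(2) 2(2)] by (simp add: blinfun_compose_distrib)
  moreover have "op_trace (R + R') = op_trace (S + S')"
    using 1 2 by (simp add: op_trace_add has_finite_residue_finite_rank)
  ultimately show ?thesis unfolding commuting_residues_def by blast
qed

lemma commuting_residues_cong:
  assumes "commuting_residues f g z\<^sub>0 r" "\<And>z. z \<in> ball z\<^sub>0 r - {z\<^sub>0} \<Longrightarrow> f z = f' z"
  shows "commuting_residues f' g z\<^sub>0 r"
proof -
  obtain R S where 1: "has_finite_residue (\<lambda>z. f z o\<^sub>L g z) z\<^sub>0 r R"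
    "has_finite_residue (\<lambda>z. g z o\<^sub>L f z) z\<^sub>0 r S" "op_trace R = op_trace S"
    using assms(1) unfolding commuting_residues_def by blast
  have "has_finite_residue (\<lambda>z. f' z o\<^sub>L g z) z\<^sub>0 r R"
    using 1(1) by (rule has_finite_residue_cong) (simp add: assms(2))
  moreover have "has_finite_residue (\<lambda>z. g z o\<^sub>L f' z) z\<^sub>0 r S"
    using 1(2) by (rule has_finite_residue_cong) (simp add: assms(2))
  ultimately show ?thesis using 1(3) unfolding commuting_residues_def by blast
qed

lemma commuting_residues_analytic:
  assumes "op_analytic_on f (ball z\<^sub>0 r)" "op_analytic_on g (ball z\<^sub>0 r)"
  shows "commuting_residues f g z\<^sub>0 r"
  unfolding commuting_residues_def
  using has_finite_residue_of_analytic[OF op_analytic_on_compose[OF assms]]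
    has_finite_residue_of_analytic[OF op_analytic_on_compose[OF assms(2,1)]]
    op_trace_eq[of 0 "{}"]
  by (intro exI[of _ 0] conjI) (auto simp: op_trace_def)

text \<open>The scalar power is moved from \<open>c\<close> to \<open>g\<close>. Every polar
  coefficient then contains the finite rank factor \<open>c\<close>, and \<open>b 0\<close> is the
  Taylor coefficient of \<open>g\<close> of index \<open>k\<close>.\<close>

lemma has_finite_residue_single_compose_left:
  assumes c: "c \<in> \<F>" and b: "\<And>j. b j \<in> \<B>" and h: "op_analytic_on h (ball z\<^sub>0 r)"
    and eq: "\<And>z. z \<in> ball z\<^sub>0 r - {z\<^sub>0} \<Longrightarrow> inverse ((z - z\<^sub>0) ^ Suc k) *\<^sub>C g z = principal_part k b z\<^sub>0 z + h z"
  shows "has_finite_residue (\<lambda>z. (inverse ((z - z\<^sub>0) ^ Suc k) *\<^sub>C c) o\<^sub>L g z) z\<^sub>0 r (c o\<^sub>L b 0)"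
proof (rule has_finite_residueI[of "\<lambda>j. c o\<^sub>L b j" _ "\<lambda>z. c o\<^sub>L h z" _ _ _ k])
  have cB: "c \<in> \<B>" using c finite_rank_opsD by blast
  fix z assume z: "z \<in> ball z\<^sub>0 r - {z\<^sub>0}"
  have "(inverse ((z - z\<^sub>0) ^ Suc k) *\<^sub>C c) o\<^sub>L g z = c o\<^sub>L (inverse ((z - z\<^sub>0) ^ Suc k) *\<^sub>C g z)"
    by (simp only: blinfun_compose_scaleC_left blinfun_compose_scaleC_right[OF cB])
  then show "(inverse ((z - z\<^sub>0) ^ Suc k) *\<^sub>C c) o\<^sub>L g z =
      principal_part k (\<lambda>j. c o\<^sub>L b j) z\<^sub>0 z + (c o\<^sub>L h z)"
    by (simp only: eq[OF z] principal_part_compose_left[OF cB] blinfun_compose_distrib)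
next
  show "op_analytic_on (\<lambda>z. c o\<^sub>L h z) (ball z\<^sub>0 r)"
    using c finite_rank_opsD by (intro op_analytic_on_compose op_analytic_on_const h) auto
qed (use c b in auto)

lemma has_finite_residue_single_compose_right:
  assumes c: "c \<in> \<F>" and b: "\<And>j. b j \<in> \<B>" and h: "op_analytic_on h (ball z\<^sub>0 r)"
    and g: "\<And>z. z \<in> ball z\<^sub>0 r - {z\<^sub>0} \<Longrightarrow> g z \<in> \<B>"
    and eq: "\<And>z. z \<in> ball z\<^sub>0 r - {z\<^sub>0} \<Longrightarrow> inverse ((z - z\<^sub>0) ^ Suc k) *\<^sub>C g z = principal_part k b z\<^sub>0 z + h z"
  shows "has_finite_residue (\<lambda>z. g z o\<^sub>L (inverse ((z - z\<^sub>0) ^ Suc k) *\<^sub>C c)) z\<^sub>0 r (b 0 o\<^sub>L c)"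
proof (rule has_finite_residueI[of "\<lambda>j. b j o\<^sub>L c" _ "\<lambda>z. h z o\<^sub>L c" _ _ _ k])
  fix z assume z: "z \<in> ball z\<^sub>0 r - {z\<^sub>0}"
  have "g z o\<^sub>L (inverse ((z - z\<^sub>0) ^ Suc k) *\<^sub>C c) = (inverse ((z - z\<^sub>0) ^ Suc k) *\<^sub>C g z) o\<^sub>L c"
    using g[OF z] by (simp only: blinfun_compose_scaleC_left blinfun_compose_scaleC_right)
  then show "g z o\<^sub>L (inverse ((z - z\<^sub>0) ^ Suc k) *\<^sub>C c) =
      principal_part k (\<lambda>j. b j o\<^sub>L c) z\<^sub>0 z + (h z o\<^sub>L c)"
    by (simp only: eq[OF z] principal_part_compose_right blinfun_compose_distrib)
next
  show "op_analytic_on (\<lambda>z. h z o\<^sub>L c) (ball z\<^sub>0 r)"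
    using c finite_rank_opsD by (intro op_analytic_on_compose op_analytic_on_const h) auto
qed (use c b in auto)

text \<open>The two residues are \<open>b 0 o\<^sub>L c\<close> and \<open>c o\<^sub>L b 0\<close>
  with the same \<open>b 0\<close>; cyclicity of the trace applies because \<open>c\<close> has
  finite rank.\<close>

lemma commuting_residues_single_analytic:
  assumes "0 < r" "c \<in> \<F>" and g: "op_analytic_on g (ball z\<^sub>0 r)"
  shows "commuting_residues (\<lambda>z. inverse ((z - z\<^sub>0) ^ Suc k) *\<^sub>C c) g z\<^sub>0 r"
proof -
  obtain b h where *: "\<And>j. b j \<in> \<B>" "op_analytic_on h (ball z\<^sub>0 r)"
    "\<And>z. z \<in> ball z\<^sub>0 r - {z\<^sub>0} \<Longrightarrow> inverse ((z - z\<^sub>0) ^ Suc k) *\<^sub>C g z = principal_part k b z\<^sub>0 z + h z"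
    using op_Taylor_split[OF assms(1) g, of k] unfolding principal_part_def by blast
  have "g z \<in> \<B>" if "z \<in> ball z\<^sub>0 r - {z\<^sub>0}" for z using op_analytic_onD(2)[OF g] that by blast
  from has_finite_residue_single_compose_right[OF assms(2) *(1,2) this *(3)]
    has_finite_residue_single_compose_left[OF assms(2) *] op_trace_cyclic[OF assms(2) *(1)[of 0]]
  show ?thesis unfolding commuting_residues_def by blast
qed

text \<open>The exponents add up to at least two, so no residue arises.\<close>

lemma has_finite_residue_single_single:
  assumes "c \<in> \<F>" "d \<in> \<F>"
  shows "has_finite_residue (\<lambda>z. (inverse ((z - z\<^sub>0) ^ Suc k) *\<^sub>C c) o\<^sub>L (inverse ((z -
      z\<^sub>0) ^ Suc l) *\<^sub>C d)) z\<^sub>0 r 0"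
proof -
  have B: "c \<in> \<B>" "d \<in> \<B>" using assms finite_rank_opsD by blast+
  show ?thesis
    using has_finite_residue_single[of "c o\<^sub>L d" z\<^sub>0 "Suc (k + l)" r] assms B
    by (simp add: blinfun_compose_scaleC_left blinfun_compose_scaleC_right scaleC_scaleC power_add ac_simps)
qed

lemma commuting_residues_single_single:
  assumes "c \<in> \<F>" "d \<in> \<F>"
  shows "commuting_residues (\<lambda>z. inverse ((z - z\<^sub>0) ^ Suc k) *\<^sub>C c) (\<lambda>z. inverse ((z - z\<^sub>0) ^ Suc l) *\<^sub>C d) z\<^sub>0 r"
  unfolding commuting_residues_def
  using has_finite_residue_single_single[OF assms] has_finite_residue_single_single[OF assms(2,1)]
  by (intro exI[of _ 0] conjI) (simp_all add: op_trace_def del: power_Suc)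

lemma commuting_residues_principal_part:
  assumes "\<And>k. commuting_residues (\<lambda>z. inverse ((z - z\<^sub>0) ^ Suc k) *\<^sub>C c k) g z\<^sub>0 r"
  shows "commuting_residues (principal_part N c z\<^sub>0) g z\<^sub>0 r"
  unfolding principal_part_def
proof (induction N)
  case 0
  show ?case using assms[of 0] by simp
next
  case (Suc N)
  then show ?case using commuting_residues_add[OF Suc assms[of "Suc N"]] by simp
qed

text \<open>By additivity in each factor only three kinds of pairs remain: two analytic functions, a
  polar term against an analytic function, and two polar terms.\<close>

lemma has_finite_residue_commuting:
  assumes "0 < r" "has_finite_residue f z\<^sub>0 r R" "has_finite_residue g z\<^sub>0 r S"
  shows "commuting_residues f g z\<^sub>0 r"
proof -
  from assms(2) obtain N c f' where f: "\<And>k. c k \<in> \<F>" "op_analytic_on f' (ball z\<^sub>0 r)"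
    "\<And>z. z \<in> ball z\<^sub>0 r - {z\<^sub>0} \<Longrightarrow> f z = principal_part N c z\<^sub>0 z + f' z"
    by (rule has_finite_residueE) blast
  from assms(3) obtain M d g' where g: "\<And>k. d k \<in> \<F>" "op_analytic_on g' (ball z\<^sub>0 r)"
    "\<And>z. z \<in> ball z\<^sub>0 r - {z\<^sub>0} \<Longrightarrow> g z = principal_part M d z\<^sub>0 z + g' z"
    by (rule has_finite_residueE) blast
  \<comment> \<open>Additivity is available in the first factor; symmetry is used to expand the
    second one.\<close>
  have split_g: "commuting_residues h g z\<^sub>0 r"
    if "\<And>k. commuting_residues (\<lambda>z. inverse ((z -
        z\<^sub>0) ^ Suc k) *\<^sub>C d k) h z\<^sub>0 r" "commuting_residues g' h z\<^sub>0 r" for h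
  proof (rule commuting_residues_sym)
    have "commuting_residues (\<lambda>z. principal_part M d z\<^sub>0 z + g' z) h z\<^sub>0 r"
      using that by (intro commuting_residues_add commuting_residues_principal_part)
    then show "commuting_residues g h z\<^sub>0 r" by (rule commuting_residues_cong) (simp add: g(3))
  qed
  have "commuting_residues (\<lambda>z. inverse ((z - z\<^sub>0) ^ Suc k) *\<^sub>C c k) g z\<^sub>0 r" for k
    by (intro split_g commuting_residues_single_single f g
        commuting_residues_sym[OF commuting_residues_single_analytic] assms(1))
  moreover have "commuting_residues f' g z\<^sub>0 r"
    by (rule split_g[OF commuting_residues_single_analytic[OF assms(1) g(1) f(2)]
          commuting_residues_analytic[OF g(2) f(2)]])
  ultimately have "commuting_residues (\<lambda>z. principal_part N c z\<^sub>0 z + f' z) g z\<^sub>0 r"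
    by (intro commuting_residues_add commuting_residues_principal_part)
  then show ?thesis by (rule commuting_residues_cong) (simp add: f(3))
qed

lemma has_finite_residue_sum:
  assumes "\<And>k. k \<le> (N::nat) \<Longrightarrow> \<exists>R. has_finite_residue (f k) z\<^sub>0 r R"
  shows "\<exists>R. has_finite_residue (\<lambda>z. \<Sum>k\<le>N. f k z) z\<^sub>0 r R"
  using assms
proof (induction N)
  case (Suc N)
  then obtain R R' where "has_finite_residue (\<lambda>z. \<Sum>k\<le>N. f k z) z\<^sub>0 r R" "has_finite_residue (f (Suc N)) z\<^sub>0 r R'"
    by (meson le_Suc_eq)
  from has_finite_residue_add[OF this] show ?case by auto
qed simp

text \<open>The composite may connect three different spaces, so there need not be a product in the
  other order to compare with. Of the four products of polar and analytic parts, those with a polar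
  factor have finite rank, and the remaining one has no pole.\<close>

lemma has_finite_residue_compose:
  fixes f :: "complex \<Rightarrow> ('b::complex_hilbert \<Rightarrow>\<^sub>L 'c::complex_hilbert)"
    and g :: "complex \<Rightarrow> ('a::complex_hilbert \<Rightarrow>\<^sub>L 'b)"
  assumes "0 < r" "has_finite_residue f z\<^sub>0 r R" "has_finite_residue g z\<^sub>0 r S"
  shows "\<exists>R. has_finite_residue (\<lambda>z. f z o\<^sub>L g z) z\<^sub>0 r R"
proof -
  from assms(2) obtain N c f' where f: "\<And>k. c k \<in> \<F>" "op_analytic_on f' (ball z\<^sub>0 r)"
    "\<And>z. z \<in> ball z\<^sub>0 r - {z\<^sub>0} \<Longrightarrow> f z = principal_part N c z\<^sub>0 z + f' z"
    by (rule has_finite_residueE) blast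
  from assms(3) obtain M d g' where g: "\<And>k. d k \<in> \<F>" "op_analytic_on g' (ball z\<^sub>0 r)"
    "\<And>z. z \<in> ball z\<^sub>0 r - {z\<^sub>0} \<Longrightarrow> g z = principal_part M d z\<^sub>0 z + g' z"
    by (rule has_finite_residueE) blast
  have f'B: "f' z \<in> \<B>" if "z \<in> ball z\<^sub>0 r - {z\<^sub>0}" for z
    using op_analytic_onD(2)[OF f(2)] that by blast
  have "\<exists>R. has_finite_residue (\<lambda>z. (inverse ((z - z\<^sub>0) ^ Suc k) *\<^sub>C c k) o\<^sub>L (inverse ((z -
      z\<^sub>0) ^ Suc l) *\<^sub>C d l)) z\<^sub>0 r R" for k l
    using has_finite_residue_single_single[OF f(1) g(1)] by blast
  then have "\<exists>R. has_finite_residue (\<lambda>z. \<Sum>l\<le>M. \<Sum>k\<le>N. (inverse ((z - z\<^sub>0) ^ Suc k) *\<^sub>C c k) o\<^sub>L (inverse ((z -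
      z\<^sub>0) ^ Suc l) *\<^sub>C d l)) z\<^sub>0 r R"
    by (intro has_finite_residue_sum)
  then obtain R1 where R1: "has_finite_residue (\<lambda>z. principal_part N c z\<^sub>0 z o\<^sub>L principal_part M d z\<^sub>0 z) z\<^sub>0 r R1"
    unfolding principal_part_def blinfun_compose_sum_left blinfun_compose_sum_right by blast
  have "\<exists>R. has_finite_residue (\<lambda>z. (inverse ((z - z\<^sub>0) ^ Suc k) *\<^sub>C c k) o\<^sub>L g' z) z\<^sub>0 r R" for k
  proof -
    obtain b h where "\<And>j. b j \<in> \<B>" "op_analytic_on h (ball z\<^sub>0 r)"
      "\<And>z. z \<in> ball z\<^sub>0 r - {z\<^sub>0} \<Longrightarrow> inverse ((z - z\<^sub>0) ^ Suc k) *\<^sub>C g' z = principal_part k b z\<^sub>0 z + h z"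
      using op_Taylor_split[OF assms(1) g(2), of k] unfolding principal_part_def by blast
    from has_finite_residue_single_compose_left[OF f(1) this] show ?thesis by blast
  qed
  then have "\<exists>R. has_finite_residue (\<lambda>z. \<Sum>k\<le>N. (inverse ((z - z\<^sub>0) ^ Suc k) *\<^sub>C c k) o\<^sub>L g' z) z\<^sub>0 r R"
    by (intro has_finite_residue_sum)
  then obtain R2 where R2: "has_finite_residue (\<lambda>z. principal_part N c z\<^sub>0 z o\<^sub>L g' z) z\<^sub>0 r R2"
    unfolding principal_part_def blinfun_compose_sum_left by blast
  have "\<exists>R. has_finite_residue (\<lambda>z. f' z o\<^sub>L (inverse ((z - z\<^sub>0) ^ Suc k) *\<^sub>C d k)) z\<^sub>0 r R" for k
  proof -
    obtain b h where *: "\<And>j. b j \<in> \<B>" "op_analytic_on h (ball z\<^sub>0 r)"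
      "\<And>z. z \<in> ball z\<^sub>0 r - {z\<^sub>0} \<Longrightarrow> inverse ((z - z\<^sub>0) ^ Suc k) *\<^sub>C f' z = principal_part k b z\<^sub>0 z + h z"
      using op_Taylor_split[OF assms(1) f(2), of k] unfolding principal_part_def by blast
    from has_finite_residue_single_compose_right[OF g(1) *(1,2) f'B *(3)] show ?thesis by blast
  qed
  then have "\<exists>R. has_finite_residue (\<lambda>z. \<Sum>k\<le>M. f' z o\<^sub>L (inverse ((z - z\<^sub>0) ^ Suc k) *\<^sub>C d k)) z\<^sub>0 r R"
    by (intro has_finite_residue_sum)
  then obtain R3 where R3: "has_finite_residue (\<lambda>z. f' z o\<^sub>L principal_part M d z\<^sub>0 z) z\<^sub>0 r R3"
    unfolding principal_part_def blinfun_compose_sum_right by blast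
  have R4: "has_finite_residue (\<lambda>z. f' z o\<^sub>L g' z) z\<^sub>0 r 0"
    by (intro has_finite_residue_of_analytic op_analytic_on_compose f g)
  have "has_finite_residue (\<lambda>z. f z o\<^sub>L g z) z\<^sub>0 r ((R1 + R2) + (R3 + 0))"
    by (rule has_finite_residue_cong[OF has_finite_residue_add[OF
          has_finite_residue_add[OF R1 R2] has_finite_residue_add[OF R3 R4]]])
      (simp only: f(3) g(3) blinfun_compose_distrib ac_simps)
  then show ?thesis by blast
qed

subsection \<open>Laurent expansions\<close>

text \<open>An exponent \<open>P\<close> above \<open>N\<close> is allowed so that two expansions
  with different numbers of negative powers can be turned into comparable power series.\<close>

lemma op_laurent_expansion_power_series:
  assumes L: "op_laurent_expansion f z\<^sub>0 r N c" and "N \<le> P" and z: "z \<in> ball z\<^sub>0 r - {z\<^sub>0}"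
  shows "(\<lambda>n. (z - z\<^sub>0) ^ n *\<^sub>C c (int n - int P)) sums ((z - z\<^sub>0) ^ P *\<^sub>C f z)"
proof -
  let ?t = "\<lambda>n. (z - z\<^sub>0) powi (int n - int P) *\<^sub>C c (int n - int P)"
  have nz: "z - z\<^sub>0 \<noteq> 0" using z by simp
  have "?t n = 0" if "n < P - N" for n
    using L that unfolding op_laurent_expansion_def by simp
  then have 0: "(\<Sum>n<P - N. ?t n) = 0" by (intro sum.neutral) blast
  have "(\<lambda>n. (z - z\<^sub>0) powi (int n - int N) *\<^sub>C c (int n - int N)) sums f z"
    using L z unfolding op_laurent_expansion_def by blast
  moreover have "int (n + (P - N)) - int P = int n - int N" for n using assms(2) by simp
  ultimately have "(\<lambda>n. ?t (n + (P - N))) sums f z" by (simp only:)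
  then have "?t sums (f z + (\<Sum>n<P - N. ?t n))" by (rule sums_iff_shift[THEN iffD1])
  then have "?t sums f z" by (simp only: 0 add_0_right)
  from bounded_linear.sums[OF bounded_linear_scaleC_right this, of "(z - z\<^sub>0) ^ P"]
  have "(\<lambda>n. ((z - z\<^sub>0) ^ P * (z - z\<^sub>0) powi (int n - int P)) *\<^sub>C c (int n - int P)) sums ((z - z\<^sub>0) ^ P *\<^sub>C f z)"
    by (simp add: scaleC_scaleC)
  moreover have "(z - z\<^sub>0) ^ P * (z - z\<^sub>0) powi (int n - int P) = (z - z\<^sub>0) ^ n" for n
    using nz power_int_add[of "z - z\<^sub>0" "int P" "int n - int P"] by (simp add: power_int_of_nat)
  ultimately show ?thesis by simp
qed

lemma op_laurent_expansion_unique: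
  fixes f :: "complex \<Rightarrow> ('a::complex_normed_vector \<Rightarrow>\<^sub>L 'b::{complex_normed_vector, banach})"
  assumes L: "op_laurent_expansion f z\<^sub>0 r N c" "op_laurent_expansion f z\<^sub>0 r' N' c'" and r: "0 < r" "0 < r'"
  shows "c = c'"
proof
  fix k
  let ?P = "max N N'"
  have eq: "c (int n - int ?P) = c' (int n - int ?P)" for n
  proof (rule power_series_unique[of "min r r'" z\<^sub>0 "\<lambda>n. c (int n - int ?P)" "\<lambda>z. (z - z\<^sub>0) ^ ?P *\<^sub>C f z"
        "\<lambda>n. c' (int n - int ?P)"])
    show "0 < min r r'" using r by simp
    fix z assume "z \<in> ball z\<^sub>0 (min r r') - {z\<^sub>0}"
    then show "(\<lambda>n. (z - z\<^sub>0) ^ n *\<^sub>C c (int n - int ?P)) sums ((z - z\<^sub>0) ^ ?P *\<^sub>C f z)"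
      "(\<lambda>n. (z - z\<^sub>0) ^ n *\<^sub>C c' (int n - int ?P)) sums ((z - z\<^sub>0) ^ ?P *\<^sub>C f z)"
      using op_laurent_expansion_power_series[OF L(1), of ?P z]
        op_laurent_expansion_power_series[OF L(2), of ?P z] by auto
  qed
  show "c k = c' k"
  proof (cases "k < - int ?P")
    case True
    then show ?thesis using L unfolding op_laurent_expansion_def by simp
  next
    case False
    then show ?thesis using eq[of "nat (k + int ?P)"] by simp
  qed
qed

lemma laurent_coeff_eq:
  fixes f :: "complex \<Rightarrow> ('a::complex_normed_vector \<Rightarrow>\<^sub>L 'b::{complex_normed_vector, banach})"
  assumes "op_laurent_expansion f z\<^sub>0 r N c" "0 < r"
  shows "laurent_coeff f z\<^sub>0 = c"
  unfolding laurent_coeff_def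
  using assms op_laurent_expansion_unique by (intro the_equality) blast+

lemma op_laurent_expansion_exists:
  fixes f :: "complex \<Rightarrow> ('a::complex_hilbert \<Rightarrow>\<^sub>L 'b::complex_hilbert)"
  assumes "0 < r" and c: "\<And>k. c k \<in> \<F>" and g: "op_analytic_on g (ball z\<^sub>0 r)"
    and f: "\<And>z. z \<in> ball z\<^sub>0 r - {z\<^sub>0} \<Longrightarrow> f z = principal_part N c z\<^sub>0 z + g z"
  obtains L where "op_laurent_expansion f z\<^sub>0 r (Suc N) L" "L 0 = g z\<^sub>0" "\<And>k. L k \<in> \<B>"
    "\<And>k. 1 \<le> k \<Longrightarrow> L (- k) \<in> \<F>"
proof -
  obtain a where a: "\<And>n. a n \<in> \<B>" "a 0 = g z\<^sub>0"
    "\<And>z. z \<in> ball z\<^sub>0 r \<Longrightarrow> (\<lambda>n. (z - z\<^sub>0) ^ n *\<^sub>C a n) sums g z"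
    using op_Taylor_series[OF assms(1) g] by metis
  \<comment> \<open>\<open>c j\<close> sits at exponent \<open>- int (Suc j)\<close>, whence the
    index \<open>nat (- k - 1)\<close>; there are \<open>Suc N\<close> negative exponents in
    all.\<close>
  define L where "L k = (if 0 \<le> k then a (nat k) else if - int (Suc N) \<le> k then c (nat (- k - 1)) else 0)" for k
  have "op_laurent_expansion f z\<^sub>0 r (Suc N) L"
    unfolding op_laurent_expansion_def
  proof (intro conjI allI impI ballI)
    fix k assume "k < - int (Suc N)"
    then show "L k = 0" by (simp add: L_def)
  next
    fix z assume z: "z \<in> ball z\<^sub>0 r - {z\<^sub>0}"
    let ?t = "\<lambda>n. (z - z\<^sub>0) powi (int n - int (Suc N)) *\<^sub>C L (int n - int (Suc N))"
    have "?t (n + Suc N) = (z - z\<^sub>0) ^ n *\<^sub>C a n" for n by (simp add: L_def power_int_of_nat)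
    then have "(\<lambda>n. ?t (n + Suc N)) sums g z" using a(3) z by simp
    then have "?t sums (g z + (\<Sum>n<Suc N. ?t n))" by (rule sums_iff_shift[THEN iffD1])
    moreover have "(\<Sum>n<Suc N. ?t n) = principal_part N c z\<^sub>0 z"
    proof -
      have "(\<Sum>n<Suc N. ?t n) = (\<Sum>n<Suc N. inverse ((z - z\<^sub>0) ^ Suc (Suc N - Suc n)) *\<^sub>C c (Suc N - Suc n))"
      proof (intro sum.cong refl)
        fix n assume "n \<in> {..<Suc N}"
        then have n: "n < Suc N" by simp
        then have e: "int n - int (Suc N) = - int (Suc (Suc N - Suc n))" by simp
        have "nat (- (- int (Suc (Suc N - Suc n))) - 1) = Suc N - Suc n" by simp
        then have "L (int n - int (Suc N)) = c (Suc N - Suc n)"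
          unfolding L_def e by simp
        then show "?t n = inverse ((z - z\<^sub>0) ^ Suc (Suc N - Suc n)) *\<^sub>C c (Suc N - Suc n)"
          by (simp only: e power_int_minus power_int_of_nat)
      qed
      also have "\<dots> = (\<Sum>n<Suc N. inverse ((z - z\<^sub>0) ^ Suc n) *\<^sub>C c n)"
        by (rule sum.nat_diff_reindex)
      finally show ?thesis by (simp only: principal_part_def lessThan_Suc_atMost)
    qed
    ultimately show "?t sums f z" by (simp only: f[OF z] add.commute)
  qed
  moreover have "L 0 = g z\<^sub>0" by (simp add: L_def a)
  moreover have "L k \<in> \<B>" for k using a c finite_rank_opsD by (auto simp: L_def)
  moreover have "L (- k) \<in> \<F>" if "1 \<le> k" for k using c that by (auto simp: L_def)
  ultimately show thesis by (rule that)
qed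

lemma has_finite_residue_meromorphic_at:
  fixes f :: "complex \<Rightarrow> ('a::complex_hilbert \<Rightarrow>\<^sub>L 'b::complex_hilbert)"
  assumes "0 < r" "has_finite_residue f z\<^sub>0 r R"
  shows "finitely_meromorphic_at f z\<^sub>0"
proof -
  from assms(2) obtain N c g where *: "\<And>k. c k \<in> \<F>" "op_analytic_on g (ball z\<^sub>0 r)"
    "\<And>z. z \<in> ball z\<^sub>0 r - {z\<^sub>0} \<Longrightarrow> f z = principal_part N c z\<^sub>0 z + g z"
    by (rule has_finite_residueE) blast
  show ?thesis
  proof (rule op_laurent_expansion_exists[OF assms(1) *])
    fix L assume L: "op_laurent_expansion f z\<^sub>0 r (Suc N) L" "\<And>k. L k \<in> \<B>" "\<And>k. 1 \<le> k \<Longrightarrow> L (- k) \<in> \<F>"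
    show "finitely_meromorphic_at f z\<^sub>0"
      unfolding finitely_meromorphic_at_def
      using L assms(1) has_finite_residue_analytic[OF assms(2)]
      by (intro exI[of _ r] conjI exI[of _ "Suc N"] exI[of _ L]) auto
  qed
qed

lemma has_finite_residue_meromorphic_on:
  fixes f :: "complex \<Rightarrow> ('a::complex_hilbert \<Rightarrow>\<^sub>L 'b::complex_hilbert)"
  assumes "0 < r" "has_finite_residue f z\<^sub>0 r R"
  shows "finitely_meromorphic_on f (ball z\<^sub>0 r)"
  unfolding finitely_meromorphic_on_def
proof (intro conjI exI[of _ "{z\<^sub>0}"])
  show "{z\<^sub>0} sparse_in ball z\<^sub>0 r" by (rule finite_imp_sparse) simp
  show "op_analytic_on f (ball z\<^sub>0 r - {z\<^sub>0})" by (rule has_finite_residue_analytic[OF assms(2)])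
  show "\<forall>p\<in>{z\<^sub>0}. finitely_meromorphic_at f p" using has_finite_residue_meromorphic_at[OF assms] by simp
qed (use assms(1) in auto)

subsection \<open>Linear systems with meromorphic coefficients\<close>

text \<open>Gaussian elimination over the field of germs of meromorphic functions.\<close>

lemma meromorphic_linear_system:
  fixes S :: "complex \<Rightarrow> 'i \<Rightarrow> 'j \<Rightarrow> complex"
  assumes "finite J" "finite I"
    and "\<And>i j. i \<in> I \<Longrightarrow> j \<in> J \<Longrightarrow> (\<lambda>z. S z i j) meromorphic_on {z\<^sub>0}"
    and "\<And>i. i \<in> I \<Longrightarrow> (\<lambda>z. b z i) meromorphic_on {z\<^sub>0}"
    and "\<forall>\<^sub>F z in at z\<^sub>0. \<forall>v. (\<forall>i\<in>I. (\<Sum>j\<in>J. S z i j * v j) = 0) \<longrightarrow> (\<forall>j\<in>J. v j = 0)"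
    and "\<forall>\<^sub>F z in at z\<^sub>0. \<forall>i\<in>I. (\<Sum>j\<in>J. S z i j * m z j) = b z i"
  shows "\<forall>j\<in>J. (\<lambda>z. m z j) meromorphic_on {z\<^sub>0}"
  using assms
proof (induction J arbitrary: I S b rule: finite_induct)
  case (insert p J)
  note S = insert.prems(2) and b = insert.prems(3)
  \<comment> \<open>If the whole column \<open>p\<close> vanished near \<open>z\<^sub>0\<close>, its
    unit vector would be a nonzero solution of the homogeneous system.\<close>
  have "\<exists>i\<in>I. \<exists>\<^sub>F z in at z\<^sub>0. S z i p \<noteq> 0"
  proof (rule ccontr)
    assume "\<not> ?thesis"
    then have "\<forall>i\<in>I. \<forall>\<^sub>F z in at z\<^sub>0. S z i p = 0" by (simp add: frequently_def)
    then have "\<forall>\<^sub>F z in at z\<^sub>0. \<forall>i\<in>I. S z i p = 0" using insert.prems(1) by (simp add: eventually_ball_finite)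
    with insert.prems(4) have "\<forall>\<^sub>F z in at z\<^sub>0. False"
    proof eventually_elim
      case (elim z)
      have "(\<Sum>j\<in>insert p J. S z i j * (if j = p then 1 else 0)) = 0" if "i \<in> I" for i
      proof -
        have "(\<Sum>j\<in>J. S z i j * (if j = p then 1 else 0)) = 0"
          using insert.hyps by (intro sum.neutral) auto
        then show ?thesis using elim(2) that insert.hyps by simp
      qed
      then have "\<forall>j\<in>insert p J. (if j = p then 1 else 0 :: complex) = 0"
        using elim(1)[rule_format, of "\<lambda>j. if j = p then 1 else 0"] by blast
      then show False by simp
    qed
    then show False by simp
  qed
  then obtain i where i: "i \<in> I" "\<exists>\<^sub>F z in at z\<^sub>0. S z i p \<noteq> 0" by blast
  have "(\<lambda>z. S z i p) meromorphic_on {z\<^sub>0}" using S i by blast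
  \<comment> \<open>A meromorphic function that is not eventually zero has no zeros close to
    \<open>z\<^sub>0\<close>, so one pivot serves all nearby points.\<close>
  then have piv: "\<forall>\<^sub>F z in at z\<^sub>0. S z i p \<noteq> 0"
    using non_zero_neighbour[of "\<lambda>z. S z i p" z\<^sub>0] i(2) by (simp add: meromorphic_at_iff)
  let ?I = "I - {i}"
  define S' where "S' z l j = S z l j - S z l p * S z i j / S z i p" for z l j
  define b' where "b' z l = b z l - S z l p * b z i / S z i p" for z l
  have IH: "\<forall>j\<in>J. (\<lambda>z. m z j) meromorphic_on {z\<^sub>0}"
  proof (rule insert.IH[of ?I S' b'])
    show "finite ?I" using insert.prems(1) by simp
    show "(\<lambda>z. S' z l j) meromorphic_on {z\<^sub>0}" if "l \<in> ?I" "j \<in> J" for l j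
      unfolding S'_def using that i S by (intro meromorphic_intros) auto
    show "(\<lambda>z. b' z l) meromorphic_on {z\<^sub>0}" if "l \<in> ?I" for l
      unfolding b'_def using that i S b by (intro meromorphic_intros) auto
    show "\<forall>\<^sub>F z in at z\<^sub>0. \<forall>v. (\<forall>l\<in>?I. (\<Sum>j\<in>J. S' z l j * v j) = 0) \<longrightarrow> (\<forall>j\<in>J. v j = 0)"
      using insert.prems(4) piv
    proof eventually_elim
      case (elim z)
      show ?case
      proof (intro allI impI)
        fix v assume v: "\<forall>l\<in>?I. (\<Sum>j\<in>J. S' z l j * v j) = 0"
        \<comment> \<open>The pivot row is solved for the coordinate \<open>p\<close>, which extends
          a solution of the reduced system to one of the full system.\<close>
        define v' where "v' = v(p := - (\<Sum>j\<in>J. S z i j * v j) / S z i p)"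
        have v'J: "(\<Sum>j\<in>J. f j * v' j) = (\<Sum>j\<in>J. f j * v j)" for f
          using insert.hyps by (intro sum.cong) (auto simp: v'_def)
        have "(\<Sum>j\<in>insert p J. S z l j * v' j) = 0" if "l \<in> I" for l
        proof -
          have "(\<Sum>j\<in>insert p J. S z l j * v' j) = S z l p * v' p + (\<Sum>j\<in>J. S z l j * v j)"
            using insert.hyps v'J[of "S z l"] by simp
          also have "\<dots> = (\<Sum>j\<in>J. S z l j * v j) - S z l p / S z i p * (\<Sum>j\<in>J. S z i j * v j)"
            by (simp add: v'_def)
          also have "\<dots> = (\<Sum>j\<in>J. S' z l j * v j)"
            by (simp add: S'_def sum_subtractf sum_distrib_left algebra_simps)
          \<comment> \<open>For \<open>l = i\<close> the reduced row is zero by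
            construction.\<close>
          also have "\<dots> = 0" using v that elim(2) by (cases "l = i") (auto simp: S'_def)
          finally show ?thesis .
        qed
        then have "\<forall>j\<in>insert p J. v' j = 0" using elim(1) by blast
        then show "\<forall>j\<in>J. v j = 0" using insert.hyps by (auto simp: v'_def split: if_splits)
      qed
    qed
    show "\<forall>\<^sub>F z in at z\<^sub>0. \<forall>l\<in>?I. (\<Sum>j\<in>J. S' z l j * m z j) = b' z l"
      using insert.prems(5) piv
    proof eventually_elim
      case (elim z)
      have eq: "(\<Sum>j\<in>J. S z l j * m z j) = b z l - S z l p * m z p" if "l \<in> I" for l
        using elim(1) that insert.hyps by (simp add: eq_diff_eq add.commute)
      show ?case
      proof
        fix l assume l: "l \<in> ?I"
        have "(\<Sum>j\<in>J. S' z l j * m z j) =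
            (\<Sum>j\<in>J. S z l j * m z j) - S z l p / S z i p * (\<Sum>j\<in>J. S z i j * m z j)"
          by (simp add: S'_def sum_subtractf sum_distrib_left algebra_simps)
        also have "\<dots> = (b z l - S z l p * m z p) - S z l p / S z i p * (b z i - S z i p * m z p)"
          using l i by (simp only: eq Diff_iff)
        also have "\<dots> = b' z l" using elim(2) by (simp add: b'_def field_simps)
        finally show "(\<Sum>j\<in>J. S' z l j * m z j) = b' z l" .
      qed
    qed
  qed
  \<comment> \<open>Back substitution for the pivot unknown.\<close>
  have "(\<lambda>z. (b z i - (\<Sum>j\<in>J. S z i j * m z j)) / S z i p) meromorphic_on {z\<^sub>0}"
    using IH S b i by (intro meromorphic_intros) auto
  moreover have "\<forall>\<^sub>F z in at z\<^sub>0. (b z i - (\<Sum>j\<in>J. S z i j * m z j)) / S z i p = m z p"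
    using insert.prems(5) piv
  proof eventually_elim
    case (elim z)
    have "S z i p * m z p + (\<Sum>j\<in>J. S z i j * m z j) = b z i"
      using elim(1) i insert.hyps by simp
    then show ?case using elim(2) by (simp add: field_simps)
  qed
  ultimately have "(\<lambda>z. m z p) meromorphic_on {z\<^sub>0}"
    using meromorphic_on_cong[of "{z\<^sub>0}" "\<lambda>z. (b z i - (\<Sum>j\<in>J. S z i j * m z j)) / S z i p" "\<lambda>z. m z p" "{z\<^sub>0}"]
    by simp
  then show ?case using IH by simp
qed simp

section \<open>Polynomial growth at a pole\<close>

lemma meromorphic_growth:
  assumes "\<phi> meromorphic_on {z\<^sub>0}"
  shows "\<exists>N C. \<forall>\<^sub>F z in at z\<^sub>0. cmod (z - z\<^sub>0) ^ N * cmod (\<phi> z) \<le> C"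
proof (cases "\<exists>\<^sub>F z in at z\<^sub>0. \<phi> z \<noteq> 0")
  case False
  then have "\<forall>\<^sub>F z in at z\<^sub>0. \<phi> z = 0" by (simp add: frequently_def)
  then have "\<forall>\<^sub>F z in at z\<^sub>0. cmod (z - z\<^sub>0) ^ 0 * cmod (\<phi> z) \<le> 0" by eventually_elim simp
  then show ?thesis by blast
next
  case True
  define n where "n = zorder \<phi> z\<^sub>0"
  obtain g r where r: "0 < r" "g holomorphic_on cball z\<^sub>0 r"
    "\<And>w. w \<in> cball z\<^sub>0 r - {z\<^sub>0} \<Longrightarrow> \<phi> w = g w * (w - z\<^sub>0) powi n"
    using zorder_exist[of \<phi> z\<^sub>0] assms True unfolding n_def meromorphic_at_iff by metis
  \<comment> \<open>With the absolute value of the order, \<open>int N + n\<close> is nonnegative at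
    zeros and poles alike.\<close>
  define N where "N = nat \<bar>n\<bar>"
  have "bounded (g ` cball z\<^sub>0 r)"
    by (intro compact_imp_bounded compact_continuous_image holomorphic_on_imp_continuous_on r compact_cball)
  then obtain C where C: "\<And>w. w \<in> cball z\<^sub>0 r \<Longrightarrow> cmod (g w) \<le> C" unfolding bounded_iff by blast
  have "\<forall>\<^sub>F z in at z\<^sub>0. z \<in> cball z\<^sub>0 (min r 1) - {z\<^sub>0}"
    using r(1) unfolding eventually_at by (intro exI[of _ "min r 1"]) (auto simp: dist_commute)
  then have "\<forall>\<^sub>F z in at z\<^sub>0. cmod (z - z\<^sub>0) ^ N * cmod (\<phi> z) \<le> C"
  proof eventually_elim
    case (elim z)
    let ?u = "z - z\<^sub>0"
    have u: "?u \<noteq> 0" "cmod ?u \<le> 1" using elim by (auto simp: dist_norm norm_minus_commute)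
    have "?u ^ N * ?u powi n = ?u ^ nat (int N + n)"
      using u power_int_add[of ?u "int N" n] by (simp add: power_int_of_nat N_def power_int_def split: if_splits)
    then have "cmod ?u ^ N * cmod (\<phi> z) = cmod (g z) * cmod ?u ^ nat (int N + n)"
      using elim r(3)[of z] by (simp add: norm_mult norm_power mult.left_commute flip: norm_power norm_mult)
    also have "\<dots> \<le> cmod (g z) * 1" using u by (intro mult_left_mono power_le_one) auto
    also have "\<dots> \<le> C" using C elim by simp
    finally show ?case .
  qed
  then show ?thesis by blast
qed

lemma meromorphic_growth_finite:
  assumes "finite A" "\<And>i. i \<in> A \<Longrightarrow> \<phi> i meromorphic_on {z\<^sub>0}"
  shows "\<exists>N C. \<forall>\<^sub>F z in at z\<^sub>0. cmod (z - z\<^sub>0) ^ N * (\<Sum>i\<in>A. cmod (\<phi> i z)) \<le> C"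
  using assms
proof (induction A)
  case empty
  show ?case by (intro exI[of _ 0]) simp
next
  case (insert i A)
  then obtain N C where 1: "\<forall>\<^sub>F z in at z\<^sub>0. cmod (z - z\<^sub>0) ^ N * (\<Sum>i\<in>A. cmod (\<phi> i z)) \<le> C" by auto
  obtain N' C' where 2: "\<forall>\<^sub>F z in at z\<^sub>0. cmod (z - z\<^sub>0) ^ N' * cmod (\<phi> i z) \<le> C'"
    using meromorphic_growth[of "\<phi> i"] insert.prems by blast
  have "\<forall>\<^sub>F z in at z\<^sub>0. cmod (z - z\<^sub>0) \<le> 1"
    unfolding eventually_at by (intro exI[of _ 1]) (auto simp: dist_norm)
  with 1 2 have "\<forall>\<^sub>F z in at z\<^sub>0. cmod (z - z\<^sub>0) ^ (N + N') * (\<Sum>i\<in>insert i A. cmod (\<phi> i z)) \<le> C' + C"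
  proof eventually_elim
    case (elim z)
    let ?u = "cmod (z - z\<^sub>0)" and ?s = "\<Sum>i\<in>A. cmod (\<phi> i z)"
    have "?u ^ N * (?u ^ N' * cmod (\<phi> i z)) \<le> 1 * (?u ^ N' * cmod (\<phi> i z))"
      by (intro mult_right_mono power_le_one elim) auto
    moreover have "?u ^ N' * (?u ^ N * ?s) \<le> 1 * (?u ^ N * ?s)"
      by (intro mult_right_mono power_le_one elim) (auto intro!: mult_nonneg_nonneg sum_nonneg)
    ultimately show ?case using elim insert.hyps by (simp add: power_add algebra_simps)
  qed
  then show ?case by blast
qed

text \<open>The entries of \<open>m\<close> solve a linear system whose coefficients are the
  meromorphic matrix elements of \<open>s\<close>, so they are meromorphic and grow at most like a
  power. Projections stand for the identities on the two spans, because \<open>E\<close> and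
  \<open>F\<close> are not assumed to be equinumerous.\<close>

lemma finite_dim_inverse_growth:
  fixes s m :: "complex \<Rightarrow> ('a::complex_hilbert \<Rightarrow>\<^sub>L 'a)"
  assumes "0 < r" and E: "finite E" "orthonormal E" and F: "finite F" "orthonormal F"
    and s: "has_finite_residue s z\<^sub>0 r R"
    and m: "\<And>z. z \<in> ball z\<^sub>0 r - {z\<^sub>0} \<Longrightarrow> m z \<in> \<B>"
    and ms: "\<And>z. z \<in> ball z\<^sub>0 r - {z\<^sub>0} \<Longrightarrow> m z o\<^sub>L s z = ortho_projection E"
    and sm: "\<And>z. z \<in> ball z\<^sub>0 r - {z\<^sub>0} \<Longrightarrow> s z o\<^sub>L m z = ortho_projection F"
    and Em: "\<And>z. z \<in> ball z\<^sub>0 r - {z\<^sub>0} \<Longrightarrow> ortho_projection E o\<^sub>L m z = m z"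
    and mF: "\<And>z. z \<in> ball z\<^sub>0 r - {z\<^sub>0} \<Longrightarrow> m z o\<^sub>L ortho_projection F = m z"
    and Fs: "\<And>z. z \<in> ball z\<^sub>0 r - {z\<^sub>0} \<Longrightarrow> ortho_projection F o\<^sub>L s z = s z"
  shows "\<exists>N C. \<forall>\<^sub>F z in at z\<^sub>0. norm ((z - z\<^sub>0) ^ Suc N *\<^sub>C m z) \<le> C"
proof -
  let ?D = "ball z\<^sub>0 r - {z\<^sub>0}"
  have evD: "\<forall>\<^sub>F z in at z\<^sub>0. z \<in> ?D" using assms(1) by (auto simp: eventually_at dist_commute)
  have sB: "s z \<in> \<B>" if "z \<in> ?D" for z
    using op_analytic_onD(2)[OF has_finite_residue_analytic[OF s] that] .
  have app: "blinfun_apply A (blinfun_apply B x) = blinfun_apply C x" if "A o\<^sub>L B = C"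
      for A B C :: "'a \<Rightarrow>\<^sub>L 'a" and x
    using that by (metis blinfun_apply_blinfun_compose)
  have mer: "(\<lambda>z. cinner y (blinfun_apply (s z) x)) meromorphic_on {z\<^sub>0}" for x y
  proof -
    from s obtain N c g where c: "\<And>k. c k \<in> \<F>" and g: "op_analytic_on g (ball z\<^sub>0 r)"
      and eq: "\<And>z. z \<in> ?D \<Longrightarrow> s z = principal_part N c z\<^sub>0 z + g z"
      by (rule has_finite_residueE) blast
    let ?\<psi> = "\<lambda>z. (\<Sum>k\<le>N. inverse ((z - z\<^sub>0) ^ Suc k) * cinner y (blinfun_apply (c k) x)) + cinner y
        (blinfun_apply (g z) x)"
    have "(\<lambda>z. cinner y (blinfun_apply (g z) x)) analytic_on {z\<^sub>0}"
      using holomorphic_matrix_element[OF g] assms(1) analytic_at by (metis centre_in_ball open_ball)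
    then have "?\<psi> meromorphic_on {z\<^sub>0}"
      by (intro meromorphic_intros analytic_on_imp_meromorphic_on)
    moreover have "\<forall>\<^sub>F z in at z\<^sub>0. ?\<psi> z = cinner y (blinfun_apply (s z) x)"
      using evD
    proof eventually_elim
      case (elim z)
      then show ?case
        by (simp add: eq principal_part_def blinfun.add_left blinfun.sum_left cinner_add_right
            cinner_sum_right cinner_scaleC_right)
    qed
    ultimately show ?thesis using meromorphic_on_cong[of "{z\<^sub>0}" ?\<psi> _ "{z\<^sub>0}"] by simp
  qed
  \<comment> \<open>A combination \<open>u\<close> of \<open>E\<close> annihilated by
    \<open>s z\<close> is also annihilated by \<open>m z o\<^sub>L s z\<close>, which fixes it;
    hence the columns of \<open>s z\<close> are independent.\<close>
  have inj: "\<forall>\<^sub>F z in at z\<^sub>0. \<forall>v. (\<forall>y\<in>F. (\<Sum>x\<in>E. cinner y (blinfun_apply (s z) x) * v x) = 0) \<longrightarrow> (\<forall>x\<in>E. v x = 0)"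
    using evD
  proof eventually_elim
    case (elim z)
    show ?case
    proof (intro allI impI ballI)
      fix v x assume v: "\<forall>y\<in>F. (\<Sum>x\<in>E. cinner y (blinfun_apply (s z) x) * v x) = 0" and x: "x \<in> E"
      define u where "u = (\<Sum>x\<in>E. v x *\<^sub>C x)"
      have "cinner y (blinfun_apply (s z) u) = 0" if "y \<in> F" for y
        using v that by (simp add: u_def blinfun.sum_right bounded_opsD[OF sB[OF elim]] cinner_sum_right
            cinner_scaleC_right mult.commute)
      then have "orthogonal_sum F (blinfun_apply (s z) u) = 0" by (simp add: orthogonal_sum_def)
      then have "blinfun_apply (s z) u = 0" using app[OF Fs[OF elim], of u] by simp
      then have "orthogonal_sum E u = 0" using app[OF ms[OF elim], of u] by simp
      moreover have "u \<in> cspan E"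
        unfolding u_def by (intro complex_vector.span_sum complex_vector.span_scale complex_vector.span_base)
      ultimately have "u = 0" using orthogonal_sum_id[OF E] by metis
      have "cinner x u = (\<Sum>x'\<in>E. if x' = x then v x' else 0)"
        unfolding u_def cinner_sum_right using E x
        by (intro sum.cong) (auto simp: cinner_scaleC_right orthonormalD)
      then show "v x = 0" using E x \<open>u = 0\<close> by simp
    qed
  qed
  \<comment> \<open>For a fixed \<open>y\<close> the unknowns are the entries of \<open>m z\<close>
    in that column, and \<open>s z\<close> sends the column back to \<open>y\<close>. No regularity
    of \<open>m\<close> in \<open>z\<close> is presupposed.\<close>
  have "\<forall>x\<in>E. (\<lambda>z. cinner x (blinfun_apply (m z) y)) meromorphic_on {z\<^sub>0}" if y: "y \<in> F" for y
  proof (rule meromorphic_linear_system[OF E(1) F(1), of "\<lambda>z y x. cinner y (blinfun_apply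
      (s z) x)" z\<^sub>0 "\<lambda>_ y'. cinner y' y"])
    show "\<forall>\<^sub>F z in at z\<^sub>0. \<forall>y'\<in>F. (\<Sum>x\<in>E. cinner y' (blinfun_apply (s z) x) * cinner x (blinfun_apply (m z) y)) =
        cinner y' y"
      using evD
    proof eventually_elim
      case (elim z)
      show ?case
      proof
        fix y' assume "y' \<in> F"
        have "(\<Sum>x\<in>E. cinner y' (blinfun_apply (s z) x) * cinner x (blinfun_apply (m z) y)) =
            cinner y' (blinfun_apply (s z) (orthogonal_sum E (blinfun_apply (m z) y)))"
          by (simp add: orthogonal_sum_def blinfun.sum_right bounded_opsD[OF sB[OF elim]] cinner_sum_right
              cinner_scaleC_right mult.commute)
        also have "orthogonal_sum E (blinfun_apply (m z) y) = blinfun_apply (m z) y"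
          using app[OF Em[OF elim], of y] by simp
        also have "blinfun_apply (s z) (blinfun_apply (m z) y) = orthogonal_sum F y"
          using app[OF sm[OF elim], of y] by simp
        also have "\<dots> = y" using y by (intro orthogonal_sum_id F complex_vector.span_base)
        finally show "(\<Sum>x\<in>E. cinner y' (blinfun_apply (s z) x) * cinner x (blinfun_apply (m z) y)) = cinner y' y" .
      qed
    qed
  qed (use mer inj in auto)
  then have "\<exists>N C. \<forall>\<^sub>F z in at z\<^sub>0. cmod (z - z\<^sub>0) ^ N *
      (\<Sum>p\<in>E \<times> F. cmod (cinner (fst p) (blinfun_apply (m z) (snd p)))) \<le> C"
    using E(1) F(1) by (intro meromorphic_growth_finite) auto
  then obtain N C where NC: "\<forall>\<^sub>F z in at z\<^sub>0. cmod (z - z\<^sub>0) ^ N *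
      (\<Sum>p\<in>E \<times> F. cmod (cinner (fst p) (blinfun_apply (m z) (snd p)))) \<le> C" by blast
  have "\<forall>\<^sub>F z in at z\<^sub>0. cmod (z - z\<^sub>0) \<le> 1"
    unfolding eventually_at by (intro exI[of _ 1]) (auto simp: dist_norm)
  with NC evD have "\<forall>\<^sub>F z in at z\<^sub>0. norm ((z - z\<^sub>0) ^ Suc N *\<^sub>C m z) \<le> C"
  proof eventually_elim
    case (elim z)
    let ?s = "\<Sum>p\<in>E \<times> F. cmod (cinner (fst p) (blinfun_apply (m z) (snd p)))"
    have "norm (m z) \<le> ?s"
    proof (rule norm_blinfun_bound)
      fix u
      have "blinfun_apply (m z) u = orthogonal_sum E (blinfun_apply (m z) (orthogonal_sum F u))"
        using app[OF Em[OF elim(2)], of "orthogonal_sum F u"] app[OF mF[OF elim(2)], of u] by simp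
      also have "\<dots> = (\<Sum>x\<in>E. \<Sum>y\<in>F. (cinner x (blinfun_apply (m z) y) * cinner y u) *\<^sub>C x)"
        unfolding orthogonal_sum_def
        by (simp add: blinfun.sum_right bounded_opsD[OF m[OF elim(2)]] cinner_sum_right
            cinner_scaleC_right complex_vector.scale_sum_left mult.commute)
      also have "norm \<dots> \<le> (\<Sum>x\<in>E. \<Sum>y\<in>F. norm ((cinner x (blinfun_apply (m z) y) * cinner y u) *\<^sub>C x))"
        by (intro order_trans[OF norm_sum] sum_mono norm_sum)
      also have "\<dots> \<le> (\<Sum>x\<in>E. \<Sum>y\<in>F. cmod (cinner x (blinfun_apply (m z) y)) * norm u)"
      proof (intro sum_mono)
        fix x y assume "x \<in> E" "y \<in> F"
        then have "norm x = 1" "cmod (cinner y u) \<le> norm u"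
          using orthonormal_norm[OF E(2)] orthonormal_norm[OF F(2)] Cauchy_Schwarz[of y u] by auto
        then show "norm ((cinner x (blinfun_apply (m z) y) * cinner y u) *\<^sub>C x) \<le>
            cmod (cinner x (blinfun_apply (m z) y)) * norm u"
          by (simp add: norm_scaleC norm_mult mult_left_mono)
      qed
      also have "\<dots> = ?s * norm u"
        by (simp add: sum_distrib_right sum.cartesian_product case_prod_beta)
      finally show "norm (blinfun_apply (m z) u) \<le> ?s * norm u" .
    qed (auto intro: sum_nonneg)
    \<comment> \<open>The growth criterion is stated with \<open>Suc N\<close>; the additional
      factor is at most 1 near \<open>z\<^sub>0\<close>.\<close>
    then have "norm ((z - z\<^sub>0) ^ Suc N *\<^sub>C m z) \<le> cmod (z - z\<^sub>0) * (cmod (z - z\<^sub>0) ^ N * ?s)"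
      by (simp add: norm_scaleC norm_power norm_mult mult.assoc mult_left_mono)
    also have "\<dots> \<le> 1 * (cmod (z - z\<^sub>0) ^ N * ?s)"
      by (intro mult_right_mono elim) (auto intro!: mult_nonneg_nonneg sum_nonneg)
    finally show ?case using elim(1) by simp
  qed
  then show ?thesis by blast
qed

section \<open>Fredholm operators and inverses of meromorphic families\<close>

lemma compose_eq_assoc: "A o\<^sub>L B = C \<Longrightarrow> A o\<^sub>L (B o\<^sub>L D) = C o\<^sub>L D"
  by (simp flip: blinfun_compose_assoc)

text \<open>\<open>S\<close> is the image of an orthonormal basis of the range under the adjoint,
  since \<open>c x\<close> is recovered from its inner products with that basis.\<close>

lemma finite_rank_kernel:
  assumes "(c :: 'a::complex_hilbert \<Rightarrow>\<^sub>L 'b::complex_hilbert) \<in> \<F>"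
  obtains S where "finite S" "\<And>x. (\<forall>s\<in>S. cinner s x = 0) \<Longrightarrow> blinfun_apply c x = 0"
proof -
  obtain E where E: "finite E" "orthonormal E" "cspan E = range (blinfun_apply c)"
    using finite_rank_basis[OF assms] by blast
  obtain a where a: "\<And>k x. cinner (blinfun_apply a k) x = cinner k (blinfun_apply c x)"
    using adjoint_exists[of c] assms finite_rank_opsD by blast
  show thesis
  proof (rule that[of "blinfun_apply a ` E"])
    fix x assume x: "\<forall>s\<in>blinfun_apply a ` E. cinner s x = 0"
    have "blinfun_apply c x \<in> cspan E" using E by blast
    then have "blinfun_apply c x = orthogonal_sum E (blinfun_apply c x)" by (simp add: orthogonal_sum_id E)
    also have "\<dots> = 0" using x by (simp add: orthogonal_sum_def a)
    finally show "blinfun_apply c x = 0" .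
  qed (use E in simp)
qed

lemma orthogonal_complement_memI: "(\<And>y. y \<in> S \<Longrightarrow> cinner y x = 0) \<Longrightarrow> x \<in> orthogonal_complement S"
  by (simp add: orthogonal_complement_def)

lemma orthogonal_complement_Int: "x \<in> S \<Longrightarrow> x \<in> orthogonal_complement S \<Longrightarrow> x = 0"
  unfolding orthogonal_complement_def by auto

lemma orthogonal_complement_cspan: "x \<in> orthogonal_complement E \<Longrightarrow> y \<in> cspan E \<Longrightarrow> cinner y x = 0"
  by (rule cinner_cspan_zero[of y E]) (simp_all add: orthogonal_complement_def)

lemma orthogonal_sum_residual:
  assumes "finite E" "orthonormal E"
  shows "x - orthogonal_sum E x \<in> orthogonal_complement E"
  using assms by (intro orthogonal_complement_memI) (simp add: cinner_diff_right cinner_orthogonal_sum)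

lemma orthogonal_sum_eq_0: "x \<in> orthogonal_complement E \<Longrightarrow> orthogonal_sum E x = 0"
  by (simp add: orthogonal_sum_def orthogonal_complement_def)

text \<open>The closed graph theorem for the inverse of \<open>T\<close> restricted to the
  complement of its kernel; the domain of this inverse is the range, which is closed.\<close>

lemma Fredholm_bounded_below:
  fixes T :: "'a::complex_hilbert \<Rightarrow>\<^sub>L 'b::complex_hilbert"
  assumes T: "T \<in> \<B>" "closed (range (blinfun_apply T))"
  obtains C where "\<And>x. x \<in> orthogonal_complement {x. blinfun_apply T x = 0} \<Longrightarrow> norm x \<le> C * norm (blinfun_apply T x)"
proof -
  let ?K = "{x. blinfun_apply T x = 0}"
  let ?X = "orthogonal_complement ?K"
  have K: "csubspace ?K"
    by (intro complex_vector.subspaceI) (auto simp: blinfun.add_right bounded_opsD[OF T(1)])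
  have "closed ?K" by (intro closed_Collect_eq continuous_intros)
  note X = csubspace_orthogonal_complement[of ?K]
  let ?G = "{p. fst p = blinfun_apply T (snd p) \<and> snd p \<in> ?X}"
  have G1: "csubspace ?G"
    using X by (intro complex_vector.subspaceI)
      (auto simp: scaleC_prod_def blinfun.add_right bounded_opsD[OF T(1)] complex_vector.subspace_0
        complex_vector.subspace_add complex_vector.subspace_scale)
  have G2: "closed ?G"
  proof -
    have "?G = {p. fst p = blinfun_apply T (snd p)} \<inter> snd -` ?X" by auto
    moreover have "closed {p :: 'b \<times> 'a. fst p = blinfun_apply T (snd p)}"
      by (intro closed_Collect_eq continuous_intros)
    ultimately show ?thesis
      by (simp add: closed_Int closed_vimage_snd closed_orthogonal_complement)
  qed
  have G3: "single_valued ?G"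
  proof (rule single_valuedI)
    fix y x x' assume "(y, x) \<in> ?G" "(y, x') \<in> ?G"
    then have *: "x \<in> ?X" "x' \<in> ?X" "blinfun_apply T x = blinfun_apply T x'" by auto
    then have "x - x' \<in> ?X" "x - x' \<in> ?K"
      using X complex_vector.subspace_diff by (auto simp: blinfun.diff_right)
    then show "x = x'" using orthogonal_complement_Int[of "x - x'" ?K] by simp
  qed
  have "Domain ?G = range (blinfun_apply T)"
  proof
    show "range (blinfun_apply T) \<subseteq> Domain ?G"
    proof
      fix y assume "y \<in> range (blinfun_apply T)"
      then obtain x where x: "y = blinfun_apply T x" by blast
      obtain p where "p \<in> ?K" "x - p \<in> ?X"
        using orthogonal_projection_exists[OF K \<open>closed ?K\<close>, of x] by blast
      then have "(y, x - p) \<in> ?G" using x by (simp add: blinfun.diff_right)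
      then show "y \<in> Domain ?G" by blast
    qed
  qed auto
  then have G4: "closed (Domain ?G)" using T(2) by simp
  obtain C where C: "\<And>y x. (y, x) \<in> ?G \<Longrightarrow> norm x \<le> C * norm y"
    by (rule closed_graph[OF G1 G2 G3 G4]) blast
  show thesis by (rule that[of C]) (use C in auto)
qed

text \<open>\<open>Q\<close> inverts \<open>T\<close> from the orthogonal complement of \<open>E\<close> onto that of \<open>F\<close>.  The dimensions of the two
  spans need not be equal.\<close>

lemma Fredholm_parametrix:
  fixes T :: "'a::complex_hilbert \<Rightarrow>\<^sub>L 'b::complex_hilbert"
  assumes T: "T \<in> \<Phi>" and S: "finite S"
  obtains E F Q where "finite E" "orthonormal E" "S \<subseteq> cspan E" "finite F" "orthonormal F" "Q \<in> \<B>"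
    "ortho_projection E o\<^sub>L Q = 0" "Q o\<^sub>L ortho_projection F = 0"
    "T o\<^sub>L Q = id_blinfun - ortho_projection F"
    "Q o\<^sub>L T o\<^sub>L (id_blinfun - ortho_projection E) = id_blinfun - ortho_projection E"
proof -
  let ?T = "blinfun_apply T"
  have TB: "T \<in> \<B>" and cl: "closed (range ?T)" using T by (auto simp: Fredholm_ops_def)
  have kerT: "op_ker (graph_of T) = {x. ?T x = 0}" by (auto simp: op_ker_def)
  have coker: "op_ker (adjoint_op (graph_of T)) = orthogonal_complement (range ?T)"
  proof -
    have "cinner k y = 0 \<longleftrightarrow> cinner y k = 0" for k y :: 'b
      by (metis cinner_commute complex_cnj_zero)
    then show ?thesis
      unfolding op_ker_def adjoint_op_iff orthogonal_complement_def by auto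
  qed
  have "cfinite_dim (op_ker (graph_of T))" "cfinite_dim (op_ker (adjoint_op (graph_of T)))"
    using T by (simp_all add: Fredholm_ops_def)
  then have fin: "cfinite_dim {x. ?T x = 0}" "cfinite_dim (orthogonal_complement (range ?T))"
    by (simp_all only: kerT coker)
  obtain B0 where B0: "finite B0" "{x. ?T x = 0} \<subseteq> cspan B0"
    using fin(1) unfolding cfinite_dim_def by blast
  obtain B1 where B1: "finite B1" "orthogonal_complement (range ?T) \<subseteq> cspan B1"
    using fin(2) unfolding cfinite_dim_def by blast
  \<comment> \<open>\<open>cspan E\<close> contains the kernel, which makes \<open>T\<close> bounded
    below on the complement of \<open>E\<close>; \<open>S\<close> adds the directions prescribed
    from outside.\<close>
  obtain E where E: "finite E" "orthonormal E" "cspan E = cspan (B0 \<union> S)"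
    using finite_orthonormalization[of "B0 \<union> S"] B0 S by auto
  have SE: "S \<subseteq> cspan E" unfolding E(3) by (auto intro: complex_vector.span_base)
  have kerE: "{x. ?T x = 0} \<subseteq> cspan E"
    using B0(2) complex_vector.span_mono[of B0 "B0 \<union> S"] unfolding E(3) by blast
  let ?X = "orthogonal_complement E"
  note X = csubspace_orthogonal_complement[of E]
  have Xker: "?X \<subseteq> orthogonal_complement {x. ?T x = 0}"
    using kerE orthogonal_complement_cspan by (auto intro!: orthogonal_complement_memI)
  obtain C where "\<And>x. x \<in> orthogonal_complement {x. ?T x = 0} \<Longrightarrow> norm x \<le> C * norm (?T x)"
    by (rule Fredholm_bounded_below[OF TB cl]) blast
  then have C: "\<And>x. x \<in> ?X \<Longrightarrow> norm x \<le> C * norm (?T x)" using Xker by blast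
  have inj: "x = x'" if "x \<in> ?X" "x' \<in> ?X" "?T x = ?T x'" for x x'
    using C[of "x - x'"] complex_vector.subspace_diff[OF X that(1,2)] that(3) by (simp add: blinfun.diff_right)
  define TX where "TX = ?T ` ?X"
  have TX: "csubspace TX"
  proof (rule complex_vector.subspaceI)
    show "0 \<in> TX" using complex_vector.subspace_0[OF X] unfolding TX_def by (force simp: image_iff)
    show "y + y' \<in> TX" if "y \<in> TX" "y' \<in> TX" for y y'
      using that complex_vector.subspace_add[OF X] unfolding TX_def
      by (auto simp flip: blinfun.add_right)
    show "c *\<^sub>C y \<in> TX" if "y \<in> TX" for c y
    proof -
      obtain x where "x \<in> ?X" "y = ?T x" using \<open>y \<in> TX\<close> unfolding TX_def by blast
      then have "c *\<^sub>C x \<in> ?X" "c *\<^sub>C y = ?T (c *\<^sub>C x)"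
        by (simp_all add: complex_vector.subspace_scale[OF X] bounded_opsD[OF TB])
      then show ?thesis unfolding TX_def by blast
    qed
  qed
  have TXcl: "closed TX"
    unfolding closed_sequential_limits
  proof (intro allI impI, elim conjE)
    fix f y assume f: "\<forall>n. f n \<in> TX" and y: "f \<longlonglongrightarrow> y"
    have "\<exists>u. u \<in> ?X \<and> f n = ?T u" for n
      using f unfolding TX_def by blast
    then obtain x where x: "\<And>n. x n \<in> ?X" "\<And>n. f n = ?T (x n)" by metis
    have "Cauchy x"
    proof (rule metric_CauchyI)
      fix e :: real assume "0 < e"
      \<comment> \<open>Positive even if \<open>C\<close> is not, so that \<open>e / C'\<close> is a
        legitimate tolerance.\<close>
      define C' where "C' = max C 1"
      have C': "0 < C'" "C \<le> C'" by (auto simp: C'_def)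
      have "Cauchy f" using y by (rule LIMSEQ_imp_Cauchy)
      then obtain N where N: "\<And>m n. m \<ge> N \<Longrightarrow> n \<ge> N \<Longrightarrow> dist (f m) (f n) < e / C'"
        using metric_CauchyD[of f "e / C'"] \<open>0 < e\<close> C' by auto
      show "\<exists>M. \<forall>m\<ge>M. \<forall>n\<ge>M. dist (x m) (x n) < e"
      proof (intro exI allI impI)
        fix m n assume mn: "N \<le> m" "N \<le> n"
        have "dist (x m) (x n) \<le> C * dist (f m) (f n)"
          using C[OF complex_vector.subspace_diff[OF X x(1) x(1)], of m n]
          by (simp add: dist_norm x(2) blinfun.diff_right)
        also have "\<dots> \<le> C' * dist (f m) (f n)" using C' by (intro mult_right_mono) auto
        also have "\<dots> < e" using N[OF mn] C' by (simp add: field_simps)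
        finally show "dist (x m) (x n) < e" .
      qed
    qed
    then obtain u where u: "x \<longlonglongrightarrow> u" using Cauchy_convergent convergent_def by blast
    have "u \<in> ?X" by (rule closed_sequentially[OF closed_orthogonal_complement x(1) u])
    moreover have "f \<longlonglongrightarrow> ?T u" unfolding x(2) by (rule blinfun.tendsto[OF tendsto_const u])
    then have "y = ?T u" using y LIMSEQ_unique by blast
    ultimately show "y \<in> TX" unfolding TX_def by blast
  qed
  \<comment> \<open>\<open>TX\<close> can miss two kinds of directions: the complement of the range
    of \<open>T\<close>, covered by \<open>B1\<close>, and the images of the vectors of
    \<open>E\<close>.\<close>
  define B2 where "B2 = B1 \<union> ?T ` E"
  have decomp: "\<exists>t\<in>TX. \<exists>w\<in>cspan B2. y = t + w" for y
  proof -
    obtain p where p: "p \<in> range ?T" "y - p \<in> orthogonal_complement (range ?T)"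
      using orthogonal_projection_exists[OF csubspace_range_bounded_op[OF TB] cl, of y] by blast
    then obtain x where x: "p = ?T x" by blast
    let ?q = "orthogonal_sum E x"
    have "?T (x - ?q) \<in> TX" unfolding TX_def using orthogonal_sum_residual[OF E(1,2)] by blast
    moreover have "?T ?q \<in> cspan (?T ` E)" by (rule bounded_op_in_cspan[OF TB orthogonal_sum_in_cspan])
    then have "?T ?q \<in> cspan B2" unfolding B2_def using complex_vector.span_mono by blast
    moreover have "y - p \<in> cspan B2"
      using p(2) B1(2) complex_vector.span_mono[of B1 B2] unfolding B2_def by blast
    moreover have "y = ?T (x - ?q) + (?T ?q + (y - p))" by (simp add: x blinfun.diff_right)
    ultimately show ?thesis using complex_vector.span_add by metis
  qed
  have "cfinite_dim (orthogonal_complement TX)"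
  proof -
    \<comment> \<open>\<open>q b\<close> is the component of \<open>b\<close> orthogonal to
      \<open>TX\<close>. The vectors \<open>q b\<close> with \<open>b\<close> in \<open>B2\<close>
      span the space modulo \<open>TX\<close>, hence they span the orthogonal complement of
      \<open>TX\<close>.\<close>
    have "\<exists>q. q \<in> orthogonal_complement TX \<and> b - q \<in> TX" for b
    proof -
      obtain p where "p \<in> TX" "b - p \<in> orthogonal_complement TX"
        using orthogonal_projection_exists[OF TX TXcl, of b] by blast
      then show ?thesis by (intro exI[of _ "b - p"]) simp
    qed
    then obtain q where q: "\<And>b. q b \<in> orthogonal_complement TX" "\<And>b. b - q b \<in> TX" by metis
    have span: "\<exists>v\<in>cspan (q ` B2). w - v \<in> TX" if "w \<in> cspan B2" for w
      using that
    proof (induction rule: complex_vector.span_induct_alt)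
      case base
      show ?case by (intro bexI[of _ 0]) (auto simp: complex_vector.subspace_0[OF TX] complex_vector.span_zero)
    next
      case (step c b w)
      then obtain v where v: "v \<in> cspan (q ` B2)" "w - v \<in> TX" by blast
      have "q b \<in> cspan (q ` B2)" using step by (intro complex_vector.span_base) blast
      then have "c *\<^sub>C q b + v \<in> cspan (q ` B2)"
        using v(1) by (intro complex_vector.span_add complex_vector.span_scale)
      moreover have "c *\<^sub>C (b - q b) + (w - v) \<in> TX"
        using q v by (intro complex_vector.subspace_add[OF TX] complex_vector.subspace_scale[OF TX])
      moreover have "c *\<^sub>C (b - q b) + (w - v) = c *\<^sub>C b + w - (c *\<^sub>C q b + v)"
        by (simp add: complex_vector.scale_right_diff_distrib)
      ultimately show ?case by metis
    qed
    have qs: "cspan (q ` B2) \<subseteq> orthogonal_complement TX"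
      using q(1) by (intro complex_vector.span_minimal csubspace_orthogonal_complement) auto
    have "orthogonal_complement TX \<subseteq> cspan (q ` B2)"
    proof
      fix y assume y: "y \<in> orthogonal_complement TX"
      obtain t w where tw: "t \<in> TX" "w \<in> cspan B2" "y = t + w" using decomp[of y] by blast
      obtain v where v: "v \<in> cspan (q ` B2)" "w - v \<in> TX" using span[OF tw(2)] by blast
      have "y - v = t + (w - v)" by (simp add: tw(3))
      then have "y - v \<in> TX" using complex_vector.subspace_add[OF TX tw(1) v(2)] by (simp only:)
      moreover have "y - v \<in> orthogonal_complement TX"
        using y v qs by (intro complex_vector.subspace_diff[OF csubspace_orthogonal_complement]) auto
      ultimately have "y - v = 0" by (rule orthogonal_complement_Int)
      then show "y \<in> cspan (q ` B2)" using v by simp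
    qed
    moreover have "finite (q ` B2)" using B1(1) E(1) by (simp add: B2_def)
    ultimately show ?thesis unfolding cfinite_dim_def by blast
  qed
  then obtain F where F: "finite F" "orthonormal F" "cspan F = orthogonal_complement TX"
    using finite_dim_orthonormal_basis[OF csubspace_orthogonal_complement] by blast
  have F_TX: "orthogonal_sum F t = 0" if "t \<in> TX" for t
  proof (rule orthogonal_sum_eq_0, rule orthogonal_complement_memI)
    fix f assume "f \<in> F"
    then have "f \<in> orthogonal_complement TX" using F(3) complex_vector.span_base by blast
    then have "cinner t f = 0" using that unfolding orthogonal_complement_def by blast
    then show "cinner f t = 0" by (metis cinner_commute complex_cnj_zero)
  qed
  have in_TX: "y - orthogonal_sum F y \<in> TX" for y
  proof -
    obtain p where p: "p \<in> TX" "y - p \<in> orthogonal_complement TX"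
      using orthogonal_projection_exists[OF TX TXcl] by blast
    have "orthogonal_sum F (y - p) = y - p" using p(2) F by (intro orthogonal_sum_id) auto
    moreover have "orthogonal_sum F (y - p) = orthogonal_sum F y - orthogonal_sum F p"
      using blinfun.diff_right[of "ortho_projection F" y p] by simp
    ultimately show ?thesis using F_TX[OF p(1)] p(1) by simp
  qed
  \<comment> \<open>The graph of \<open>Q\<close>: it sends \<open>y\<close> to the preimage in
    \<open>?X\<close> of the component of \<open>y\<close> in \<open>TX\<close>. Boundedness is then
    supplied by the closed graph theorem.\<close>
  let ?G = "{p. ?T (snd p) = fst p - blinfun_apply (ortho_projection F) (fst p) \<and> snd p \<in> ?X}"
  have FB: "ortho_projection F \<in> \<B>" using ortho_projection_finite_rank[OF F(1)] finite_rank_opsD by blast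
  have "csubspace ?G"
    using X by (intro complex_vector.subspaceI)
      (auto simp: scaleC_prod_def blinfun.add_right bounded_opsD[OF TB] bounded_opsD[OF FB]
          complex_vector.subspace_0
        complex_vector.subspace_add complex_vector.subspace_scale complex_vector.scale_right_diff_distrib
        simp del: ortho_projection_apply)
  moreover have "closed ?G"
  proof -
    have "?G = {p. ?T (snd p) = fst p - blinfun_apply (ortho_projection F) (fst p)} \<inter> snd -` ?X" by auto
    moreover have "closed {p :: 'b \<times> 'a. ?T (snd p) = fst p - blinfun_apply (ortho_projection F) (fst p)}"
      by (intro closed_Collect_eq continuous_intros)
    ultimately show ?thesis
      by (simp add: closed_Int closed_vimage_snd closed_orthogonal_complement del: ortho_projection_apply)
  qed
  moreover have "single_valued ?G" using inj by (intro single_valuedI) auto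
  moreover have "Domain ?G = UNIV"
  proof -
    have "\<exists>x. (y, x) \<in> ?G" for y
    proof -
      obtain x where "x \<in> ?X" "y - orthogonal_sum F y = ?T x"
        using in_TX[of y] unfolding TX_def by blast
      then show ?thesis by (intro exI[of _ x]) simp
    qed
    then show ?thesis by blast
  qed
  ultimately have "everywhere_bounded ?G" by (rule everywhere_boundedI)
  from as_boundedD[OF this] obtain Q where QB: "Q \<in> \<B>" and QG: "graph_of Q = ?G" by blast
  have Q: "?T (blinfun_apply Q y) = y - orthogonal_sum F y" "blinfun_apply Q y \<in> ?X" for y
  proof -
    have "(y, blinfun_apply Q y) \<in> ?G" unfolding QG[symmetric] by simp
    then show "?T (blinfun_apply Q y) = y - orthogonal_sum F y" "blinfun_apply Q y \<in> ?X" by auto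
  qed
  show thesis
  proof (rule that[OF E(1,2) SE F(1,2) QB])
    show "ortho_projection E o\<^sub>L Q = 0"
      using Q(2) by (intro blinfun_eqI) (simp add: orthogonal_sum_eq_0)
    show "T o\<^sub>L Q = id_blinfun - ortho_projection F"
      by (intro blinfun_eqI) (simp add: Q blinfun.diff_left)
    show "Q o\<^sub>L ortho_projection F = 0"
    proof (rule blinfun_eqI)
      fix y
      have "orthogonal_sum F (orthogonal_sum F y) = orthogonal_sum F y"
        by (intro orthogonal_sum_id F orthogonal_sum_in_cspan)
      then have "blinfun_apply Q (orthogonal_sum F y) = 0"
        using Q[of "orthogonal_sum F y"] by (intro inj) (simp_all add: complex_vector.subspace_0[OF X])
      then show "blinfun_apply (Q o\<^sub>L ortho_projection F) y = blinfun_apply 0 y" by simp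
    qed
    show "Q o\<^sub>L T o\<^sub>L (id_blinfun - ortho_projection E) = id_blinfun - ortho_projection E"
    proof (rule blinfun_eqI)
      fix x
      let ?u = "x - orthogonal_sum E x"
      have u: "?u \<in> ?X" by (rule orthogonal_sum_residual[OF E(1,2)])
      then have "?T ?u \<in> TX" unfolding TX_def by blast
      then have "?T (blinfun_apply Q (?T ?u)) = ?T ?u" using Q(1)[of "?T ?u"] F_TX by simp
      then have "blinfun_apply Q (?T ?u) = ?u" by (intro inj Q(2) u)
      then show "blinfun_apply (Q o\<^sub>L T o\<^sub>L (id_blinfun - ortho_projection E)) x =
          blinfun_apply (id_blinfun - ortho_projection E) x"
        by (simp add: blinfun.diff_left)
    qed
  qed
qed

text \<open>The Schur complement \<open>s\<close> of the block of \<open>M\<close> treated by the parametrix acts between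
  finite-dimensional spaces.  It is bijective wherever \<open>M\<close> is invertible, so that its inverse has at most
  a pole; this replaces any argument with Fredholm indices.\<close>

lemma Fredholm_inverse_meromorphic:
  fixes M Mi :: "complex \<Rightarrow> ('a::complex_hilbert \<Rightarrow>\<^sub>L 'a)"
  assumes r: "0 < r" and c: "\<And>k. c k \<in> \<F>" and g: "op_analytic_on g (ball z\<^sub>0 r)"
    and M: "\<And>z. z \<in> ball z\<^sub>0 r - {z\<^sub>0} \<Longrightarrow> M z = principal_part N c z\<^sub>0 z + g z"
    and T: "g z\<^sub>0 \<in> \<Phi>"
    and inv: "\<And>z. z \<in> ball z\<^sub>0 r - {z\<^sub>0} \<Longrightarrow> is_inverse (M z) (Mi z)"
  shows "\<exists>R. has_finite_residue Mi z\<^sub>0 r R"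
proof -
  define T where "T = g z\<^sub>0"
  have resM: "has_finite_residue M z\<^sub>0 r (c 0)" using c g M by (intro has_finite_residueI) auto
  have Mi_an: "op_analytic_on Mi (ball z\<^sub>0 r - {z\<^sub>0})"
    by (rule op_analytic_on_inverse[OF has_finite_residue_analytic[OF resM] inv])
  have "\<exists>S. finite S \<and> (\<forall>x. (\<forall>s\<in>S. cinner s x = 0) \<longrightarrow> blinfun_apply (c k) x = 0)" for k
    using finite_rank_kernel[OF c, of k] by metis
  then obtain Sk where Sk: "\<And>k. finite (Sk k)"
    "\<And>k x. (\<forall>s\<in>Sk k. cinner s x = 0) \<Longrightarrow> blinfun_apply (c k) x = 0" by metis
  \<comment> \<open>All polar coefficients vanish on the orthogonal complement of \<open>S\<close>,
    so that \<open>M\<close> coincides with its regular part there.\<close>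
  define S where "S = (\<Union>k\<le>N. Sk k)"
  have "finite S" using Sk by (simp add: S_def)
  obtain E F Q where E: "finite E" "orthonormal E" "S \<subseteq> cspan E" and F: "finite F" "orthonormal F"
    and Q: "Q \<in> \<B>" and PQ: "ortho_projection E o\<^sub>L Q = 0" and QP': "Q o\<^sub>L ortho_projection F = 0"
    and TQ: "T o\<^sub>L Q = id_blinfun - ortho_projection F"
    and QT: "Q o\<^sub>L T o\<^sub>L (id_blinfun - ortho_projection E) = id_blinfun - ortho_projection E"
    using T unfolding T_def[symmetric] by (rule Fredholm_parametrix[OF _ \<open>finite S\<close>]) blast
  define P where "P = ortho_projection E"
  define P' where "P' = ortho_projection F"
  have P: "P \<in> \<F>" "P \<in> \<B>" "P o\<^sub>L P = P" and P': "P' \<in> \<F>" "P' \<in> \<B>" "P' o\<^sub>L P' = P'"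
    using ortho_projection_finite_rank E F finite_rank_opsD
    by (auto intro!: blinfun_eqI orthogonal_sum_id orthogonal_sum_in_cspan simp: P_def P'_def)
  note PQ = PQ[folded P_def] and QP' = QP'[folded P'_def] and TQ = TQ[folded P'_def] and QT = QT[folded P_def]
  have cP: "principal_part N c z\<^sub>0 z o\<^sub>L (id_blinfun - P) = 0" for z
  proof -
    have "c k o\<^sub>L (id_blinfun - P) = 0" if "k \<le> N" for k
    proof (rule blinfun_eqI)
      fix x
      have "x - orthogonal_sum E x \<in> orthogonal_complement E" by (rule orthogonal_sum_residual[OF E(1,2)])
      then have "cinner s (x - orthogonal_sum E x) = 0" if "s \<in> Sk k" for s
        using orthogonal_complement_cspan E(3) that \<open>k \<le> N\<close> unfolding S_def by blast
      then have "blinfun_apply (c k) (x - orthogonal_sum E x) = 0" using Sk(2) by blast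
      then show "blinfun_apply (c k o\<^sub>L (id_blinfun - P)) x = blinfun_apply 0 x"
        by (simp add: P_def blinfun.diff_left)
    qed
    then show ?thesis by (simp add: principal_part_def blinfun_compose_sum_left blinfun_compose_scaleC_left)
  qed
  have TP: "T o\<^sub>L (id_blinfun - P) = (id_blinfun - P') o\<^sub>L (T o\<^sub>L (id_blinfun - P))"
    using QT TQ by (metis blinfun_compose_assoc)
  have P'TP: "P' o\<^sub>L (T o\<^sub>L (id_blinfun - P)) = 0"
  proof -
    have "P' o\<^sub>L (T o\<^sub>L (id_blinfun - P)) = P' o\<^sub>L ((id_blinfun - P') o\<^sub>L (T o\<^sub>L (id_blinfun - P)))"
      using TP by simp
    also have "\<dots> = (P' o\<^sub>L (id_blinfun - P')) o\<^sub>L (T o\<^sub>L (id_blinfun - P))"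
      by (simp only: blinfun_compose_assoc)
    also have "P' o\<^sub>L (id_blinfun - P') = 0"
      using bounded_bilinear.diff_right[OF bounded_bilinear_blinfun_compose, of P' id_blinfun P'] P'(3) by simp
    finally show ?thesis by simp
  qed
  define \<Delta> where "\<Delta> z = g z - T" for z
  have "isCont (\<lambda>z. norm (\<Delta> z) * norm Q) z\<^sub>0"
    unfolding \<Delta>_def using op_analytic_on_isCont[OF g] r by (intro continuous_intros) auto
  then have "((\<lambda>z. norm (\<Delta> z) * norm Q) \<longlongrightarrow> norm (\<Delta> z\<^sub>0) * norm Q) (nhds z\<^sub>0)"
    using tendsto_at_iff_tendsto_nhds[of "\<lambda>z. norm (\<Delta> z) * norm Q" z\<^sub>0] by (simp add: isCont_def)
  then have "\<forall>\<^sub>F z in nhds z\<^sub>0. norm (\<Delta> z) * norm Q < 1" by (rule order_tendstoD) (simp add: \<Delta>_def T_def)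
  then obtain \<delta>' where \<delta>': "0 < \<delta>'" "\<And>z. z \<in> ball z\<^sub>0 \<delta>' \<Longrightarrow> norm (\<Delta> z) * norm Q < 1"
    unfolding eventually_nhds_metric by (auto simp: dist_commute)
  define \<delta> where "\<delta> = min \<delta>' r"
  have \<delta>: "0 < \<delta>" "ball z\<^sub>0 \<delta> \<subseteq> ball z\<^sub>0 r" "\<And>z. z \<in> ball z\<^sub>0 \<delta> \<Longrightarrow> norm (\<Delta> z) * norm Q < 1"
    using \<delta>' r by (auto simp: \<delta>_def)
  have g\<delta>: "op_analytic_on g (ball z\<^sub>0 \<delta>)" by (rule op_analytic_on_subset[OF g \<delta>(2)]) simp
  have TB: "T \<in> \<B>" using op_analytic_onD(2)[OF g] r by (simp add: T_def)
  have \<Delta>_an: "op_analytic_on \<Delta> (ball z\<^sub>0 \<delta>)"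
    unfolding \<Delta>_def by (intro op_analytic_on_diff g\<delta> op_analytic_on_const TB) simp
  \<comment> \<open>Since \<open>T o\<^sub>L Q\<close> is the identity minus \<open>P'\<close>,
    perturbing \<open>T\<close> to \<open>T + \<Delta> z\<close> gives \<open>a z - P'\<close>. The
    factor \<open>a z\<close> is close to the identity near \<open>z\<^sub>0\<close>, hence
    invertible with analytic inverse.\<close>
  define a where "a z = id_blinfun + (\<Delta> z o\<^sub>L Q)" for z
  have a_an: "op_analytic_on a (ball z\<^sub>0 \<delta>)"
    unfolding a_def by (intro op_analytic_on_add op_analytic_on_compose op_analytic_on_const \<Delta>_an Q) auto
  have "\<exists>G. is_inverse (a z) G" if z: "z \<in> ball z\<^sub>0 \<delta>" for z
  proof -
    have "norm (- (\<Delta> z o\<^sub>L Q)) < 1"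
      using norm_blinfun_compose[of "\<Delta> z" Q] \<delta>(3)[OF z] by simp
    then show ?thesis
      using Neumann_inverse[of "- (\<Delta> z o\<^sub>L Q)"] op_analytic_onD(2)[OF \<Delta>_an z] Q by (simp add: a_def)
  qed
  then obtain ai where ai: "\<And>z. z \<in> ball z\<^sub>0 \<delta> \<Longrightarrow> is_inverse (a z) (ai z)" by metis
  have ai_an: "op_analytic_on ai (ball z\<^sub>0 \<delta>)" by (rule op_analytic_on_inverse[OF a_an ai])
  \<comment> \<open>Applying \<open>ai\<close> clears the block handled by \<open>Q\<close> and
    leaves \<open>s z\<close>, which acts from the range of \<open>P\<close> to that of
    \<open>P'\<close>. Its inverse \<open>m z\<close> is the corresponding block of
    \<open>Mi z\<close>.\<close>
  define s where "s z = (P' o\<^sub>L ai z) o\<^sub>L (M z o\<^sub>L P)" for z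
  define m where "m z = P o\<^sub>L (Mi z o\<^sub>L P')" for z
  have resM\<delta>: "has_finite_residue M z\<^sub>0 \<delta> (c 0)"
    using c g\<delta> M \<delta>(2) by (intro has_finite_residueI[of c _ g z\<^sub>0 \<delta> M N]) auto
  have res_an: "has_finite_residue f z\<^sub>0 \<delta> 0" if "op_analytic_on f (ball z\<^sub>0 \<delta>)" for f :: "complex \<Rightarrow> ('a \<Rightarrow>\<^sub>L 'a)"
    using that by (rule has_finite_residue_of_analytic)
  have const: "op_analytic_on (\<lambda>_. A) (ball z\<^sub>0 \<delta>)" if "A \<in> \<B>" for A :: "'a \<Rightarrow>\<^sub>L 'a"
    using that by (intro op_analytic_on_const) auto
  obtain Rs where res_s: "has_finite_residue s z\<^sub>0 \<delta> Rs"
    unfolding s_def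
    using has_finite_residue_compose[OF \<delta>(1) res_an[OF op_analytic_on_compose[OF const[OF P'(2)] ai_an]]
        has_finite_residue_compose_right[OF resM\<delta> P(2)]] by blast
  have key: "m z o\<^sub>L s z = P" "s z o\<^sub>L m z = P'" "Mi z =
      (Q o\<^sub>L ai z) + ((m z - (Q o\<^sub>L (ai z o\<^sub>L (M z o\<^sub>L m z)))) o\<^sub>L ai z)"
    if z: "z \<in> ball z\<^sub>0 \<delta> - {z\<^sub>0}" for z
  proof -
    have zr: "z \<in> ball z\<^sub>0 r - {z\<^sub>0}" and z\<delta>: "z \<in> ball z\<^sub>0 \<delta>" using z \<delta>(2) by auto
    note I = is_inverseD[OF inv[OF zr]] and A = is_inverseD[OF ai[OF z\<delta>]]
    have NQ: "(T + \<Delta> z) o\<^sub>L Q = a z - P'"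
      using TQ by (simp add: a_def blinfun_compose_distrib)
    have MP: "M z o\<^sub>L (id_blinfun - P) = (T + \<Delta> z) o\<^sub>L (id_blinfun - P)"
    proof -
      have "M z = principal_part N c z\<^sub>0 z + (T + \<Delta> z)" using M[OF zr] by (simp add: \<Delta>_def)
      then have "M z o\<^sub>L (id_blinfun - P) =
          (principal_part N c z\<^sub>0 z o\<^sub>L (id_blinfun - P)) + ((T + \<Delta> z) o\<^sub>L (id_blinfun - P))"
        by (simp only: bounded_bilinear.add_left[OF bounded_bilinear_blinfun_compose])
      then show ?thesis using cP by simp
    qed
    have "(id_blinfun - P) o\<^sub>L Q = Q" using PQ by (simp add: blinfun_compose_distrib)
    then have "M z o\<^sub>L Q = (M z o\<^sub>L (id_blinfun - P)) o\<^sub>L Q" by (simp only: blinfun_compose_assoc)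
    also have "\<dots> = (T + \<Delta> z) o\<^sub>L Q"
      using \<open>(id_blinfun - P) o\<^sub>L Q = Q\<close> unfolding MP by (simp only: blinfun_compose_assoc)
    finally have MQ: "M z o\<^sub>L Q = a z - P'" using NQ by simp
    have aP': "a z o\<^sub>L P' = P'" by (simp add: a_def blinfun_compose_distrib QP')
    have aiP': "ai z o\<^sub>L P' = P'" using A(8)[of P'] aP' by simp
    \<comment> \<open>Multiplying \<open>M z o\<^sub>L Q = a z - P'\<close> by the inverses of
      \<open>M z\<close> and \<open>a z\<close> expresses \<open>Mi z\<close> through
      \<open>Q o\<^sub>L ai z\<close> and the single unknown piece
      \<open>Mi z o\<^sub>L P'\<close>.\<close>
    have "Q = Mi z o\<^sub>L (a z - P')" using I(8)[of Q] MQ by simp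
    then have Q1: "Q o\<^sub>L ai z = Mi z o\<^sub>L ((a z - P') o\<^sub>L ai z)" by (metis blinfun_compose_assoc)
    have "(a z - P') o\<^sub>L ai z = id_blinfun - (P' o\<^sub>L ai z)"
      using A(3) by (simp add: blinfun_compose_distrib)
    with Q1 have Q2: "Q o\<^sub>L ai z = Mi z - (Mi z o\<^sub>L (P' o\<^sub>L ai z))" by (simp add: blinfun_compose_distrib)
    then have MiP'a: "Mi z o\<^sub>L (P' o\<^sub>L ai z) = Mi z - (Q o\<^sub>L ai z)" by simp
    have ms': "Mi z o\<^sub>L (P' o\<^sub>L s z) = P - (Q o\<^sub>L (ai z o\<^sub>L (M z o\<^sub>L P)))"
    proof -
      have "Mi z o\<^sub>L (P' o\<^sub>L s z) = Mi z o\<^sub>L ((P' o\<^sub>L P') o\<^sub>L (ai z o\<^sub>L (M z o\<^sub>L P)))"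
        by (simp only: s_def blinfun_compose_assoc)
      also have "\<dots> = (Mi z o\<^sub>L (P' o\<^sub>L ai z)) o\<^sub>L (M z o\<^sub>L P)"
        by (simp only: P'(3) blinfun_compose_assoc)
      also have "\<dots> = (Mi z o\<^sub>L (M z o\<^sub>L P)) - (Q o\<^sub>L (ai z o\<^sub>L (M z o\<^sub>L P)))"
        unfolding MiP'a by (simp add: blinfun_compose_distrib)
      finally show ?thesis by (simp add: I(8))
    qed
    have "m z o\<^sub>L s z = P o\<^sub>L (Mi z o\<^sub>L (P' o\<^sub>L s z))" by (simp only: m_def blinfun_compose_assoc)
    also have "\<dots> = P - ((P o\<^sub>L Q) o\<^sub>L (ai z o\<^sub>L (M z o\<^sub>L P)))"
      unfolding ms' by (simp add: blinfun_compose_distrib P(3))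
    finally show "m z o\<^sub>L s z = P" by (simp add: PQ)
    \<comment> \<open>An off-diagonal block vanishes. Therefore \<open>P\<close> may be inserted
      between \<open>M z\<close> and \<open>Mi z\<close> when computing
      \<open>s z o\<^sub>L m z\<close>.\<close>
    have aMP: "P' o\<^sub>L (ai z o\<^sub>L (M z o\<^sub>L (id_blinfun - P))) = 0"
    proof -
      have "M z o\<^sub>L (id_blinfun - P) = (T + \<Delta> z) o\<^sub>L (Q o\<^sub>L (T o\<^sub>L (id_blinfun - P)))"
        unfolding MP using QT by (simp only: blinfun_compose_assoc)
      also have "\<dots> = (a z - P') o\<^sub>L (T o\<^sub>L (id_blinfun - P))"
        using NQ by (metis blinfun_compose_assoc)
      also have "\<dots> = a z o\<^sub>L (T o\<^sub>L (id_blinfun - P))"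
        by (simp add: bounded_bilinear.diff_left[OF bounded_bilinear_blinfun_compose, of "a z" P'] P'TP)
      finally show ?thesis by (simp add: A(8) P'TP)
    qed
    have "s z o\<^sub>L m z = P' o\<^sub>L (ai z o\<^sub>L (M z o\<^sub>L (P o\<^sub>L (Mi z o\<^sub>L P'))))"
      using P(3) by (simp only: s_def m_def blinfun_compose_assoc compose_eq_assoc[OF P(3)])
    also have "\<dots> = (P' o\<^sub>L (ai z o\<^sub>L (M z o\<^sub>L (Mi z o\<^sub>L P')))) -
        ((P' o\<^sub>L (ai z o\<^sub>L (M z o\<^sub>L (id_blinfun - P)))) o\<^sub>L (Mi z o\<^sub>L P'))"
      by (simp add: blinfun_compose_distrib)
    also have "\<dots> = P' o\<^sub>L (ai z o\<^sub>L P')" unfolding aMP by (simp add: I(7))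
    finally show sm: "s z o\<^sub>L m z = P'" by (simp add: aiP' P'(3))
    have "Mi z o\<^sub>L P' = Mi z o\<^sub>L (P' o\<^sub>L (s z o\<^sub>L m z))" by (simp add: sm P'(3))
    also have "\<dots> = (P o\<^sub>L m z) - (Q o\<^sub>L (ai z o\<^sub>L (M z o\<^sub>L (P o\<^sub>L m z))))"
      using ms' by (simp add: blinfun_compose_distrib flip: blinfun_compose_assoc)
    also have "P o\<^sub>L m z = m z" by (simp add: m_def compose_eq_assoc[OF P(3)])
    finally have "Mi z o\<^sub>L P' = m z - (Q o\<^sub>L (ai z o\<^sub>L (M z o\<^sub>L m z)))" .
    then show "Mi z = (Q o\<^sub>L ai z) + ((m z - (Q o\<^sub>L (ai z o\<^sub>L (M z o\<^sub>L m z)))) o\<^sub>L ai z)"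
      using Q2 by (simp flip: blinfun_compose_assoc)
  qed
  have m_an: "op_analytic_on m (ball z\<^sub>0 \<delta> - {z\<^sub>0})"
    unfolding m_def using \<delta>(2)
    by (intro op_analytic_on_compose op_analytic_on_const P P' op_analytic_on_subset[OF Mi_an]) auto
  have "\<exists>N C. \<forall>\<^sub>F z in at z\<^sub>0. norm ((z - z\<^sub>0) ^ Suc N *\<^sub>C m z) \<le> C"
  proof (rule finite_dim_inverse_growth[OF \<delta>(1) E(1,2) F res_s])
    fix z assume z: "z \<in> ball z\<^sub>0 \<delta> - {z\<^sub>0}"
    show "m z \<in> \<B>" using op_analytic_onD(2)[OF m_an z] .
    show "m z o\<^sub>L s z = ortho_projection E" "s z o\<^sub>L m z = ortho_projection F"
      using key(1,2)[OF z] by (simp_all add: P_def P'_def)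
    show "ortho_projection E o\<^sub>L m z = m z" unfolding m_def P_def[symmetric]
        by (simp add: compose_eq_assoc[OF P(3)])
    show "m z o\<^sub>L ortho_projection F = m z" unfolding m_def P'_def[symmetric]
        by (simp add: blinfun_compose_assoc P'(3))
    show "ortho_projection F o\<^sub>L s z = s z" unfolding s_def P'_def[symmetric]
      by (simp add: blinfun_compose_assoc compose_eq_assoc[OF P'(3)])
  qed
  then obtain N' C where growth: "\<forall>\<^sub>F z in at z\<^sub>0. norm ((z - z\<^sub>0) ^ Suc N' *\<^sub>C m z) \<le> C" by blast
  have "m z o\<^sub>L P' = m z" for z unfolding m_def by (simp add: blinfun_compose_assoc P'(3))
  then obtain Rm where res_m: "has_finite_residue m z\<^sub>0 \<delta> Rm"
    using has_finite_residueI_growth[OF \<delta>(1) m_an growth P'(1)] by blast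
  have res_ai: "has_finite_residue ai z\<^sub>0 \<delta> 0" by (rule res_an[OF ai_an])
  obtain R1 where "has_finite_residue (\<lambda>z. M z o\<^sub>L m z) z\<^sub>0 \<delta> R1"
    using has_finite_residue_compose[OF \<delta>(1) resM\<delta> res_m] by blast
  then obtain R2 where "has_finite_residue (\<lambda>z. ai z o\<^sub>L (M z o\<^sub>L m z)) z\<^sub>0 \<delta> R2"
    using has_finite_residue_compose[OF \<delta>(1) res_ai] by blast
  then have "has_finite_residue (\<lambda>z. m z - (Q o\<^sub>L (ai z o\<^sub>L (M z o\<^sub>L m z)))) z\<^sub>0 \<delta> (Rm - (Q o\<^sub>L R2))"
    by (intro has_finite_residue_diff res_m has_finite_residue_compose_left Q)
  then obtain R3 where "has_finite_residue (\<lambda>z. (m z - (Q o\<^sub>L (ai z o\<^sub>L (M z o\<^sub>L m z)))) o\<^sub>L ai z) z\<^sub>0 \<delta> R3"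
    using has_finite_residue_compose[OF \<delta>(1) _ res_ai] by blast
  then have "has_finite_residue (\<lambda>z. (Q o\<^sub>L ai z) + ((m z - (Q o\<^sub>L (ai z o\<^sub>L (M z o\<^sub>L m z)))) o\<^sub>L ai z)) z\<^sub>0 \<delta>
      ((Q o\<^sub>L 0) + R3)"
    by (intro has_finite_residue_add has_finite_residue_compose_left res_ai Q)
  then have "has_finite_residue Mi z\<^sub>0 \<delta> ((Q o\<^sub>L 0) + R3)"
    by (rule has_finite_residue_cong) (rule key(3)[symmetric])
  \<comment> \<open>The construction lives on the disk of radius \<open>\<delta>\<close>, where
    \<open>a z\<close> is invertible; analyticity of \<open>Mi\<close> extends the expansion to
    radius \<open>r\<close>.\<close>
  then show ?thesis using has_finite_residue_extend[OF _ \<delta>(1) Mi_an] by blast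
qed

section \<open>Isolated points of the spectrum\<close>

lemma path_integral_bounded_linear:
  fixes F :: "complex \<Rightarrow> 'a::{complex_normed_vector, banach}" and h :: "'a \<Rightarrow> 'b::{complex_normed_vector, banach}"
  assumes "continuous_on (sphere z\<^sub>0 \<epsilon>) F" "0 < \<epsilon>" "bounded_linear h" "\<And>c x. h (c *\<^sub>C x) = c *\<^sub>C h x"
  shows "path_integral (circlepath z\<^sub>0 \<epsilon>) (\<lambda>z. h (F z)) = h (path_integral (circlepath z\<^sub>0 \<epsilon>) F)"
  using integral_linear[OF integrable_continuous_interval[OF circlepath_integrand_continuous[OF assms(1,2)]]
      assms(3)]
  by (simp add: path_integral_def o_def assms(4))

lemma path_integral_add:
  fixes F G :: "complex \<Rightarrow> 'a::{complex_normed_vector, banach}"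
  assumes "continuous_on (sphere z\<^sub>0 \<epsilon>) F" "continuous_on (sphere z\<^sub>0 \<epsilon>) G" "0 < \<epsilon>"
  shows "path_integral (circlepath z\<^sub>0 \<epsilon>) (\<lambda>z. F z + G z) =
    path_integral (circlepath z\<^sub>0 \<epsilon>) F + path_integral (circlepath z\<^sub>0 \<epsilon>) G"
  unfolding path_integral_def scaleC_add_right
  by (intro integral_add integrable_continuous_interval circlepath_integrand_continuous assms)

lemma path_integral_cong:
  assumes "\<And>z. z \<in> sphere z\<^sub>0 \<epsilon> \<Longrightarrow> F z = G z" "0 < \<epsilon>"
  shows "path_integral (circlepath z\<^sub>0 \<epsilon>) F = path_integral (circlepath z\<^sub>0 \<epsilon>) G"
proof -
  have "circlepath z\<^sub>0 \<epsilon> t \<in> sphere z\<^sub>0 \<epsilon>" if "t \<in> {0..1}" for t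
    using path_image_circlepath[of z\<^sub>0 \<epsilon>] assms(2) that unfolding path_image_def by auto
  then show ?thesis unfolding path_integral_def by (intro integral_cong) (simp add: assms(1))
qed

lemma path_integral_Cauchy_kernel:
  assumes "z \<in> ball z\<^sub>0 \<epsilon>"
  shows "path_integral (circlepath z\<^sub>0 \<epsilon>) (\<lambda>\<zeta>. 1 / (\<zeta> - z)) = 2 * of_real pi * \<i>"
proof -
  have "((\<lambda>\<zeta>. 1 / (\<zeta> - z)) has_contour_integral 2 * of_real pi * \<i> * 1) (circlepath z\<^sub>0 \<epsilon>)"
    using assms by (intro Cauchy_integral_circlepath_simple) (auto simp: dist_norm norm_minus_commute)
  then have "((\<lambda>t. 1 / (circlepath z\<^sub>0 \<epsilon> t - z) * vector_derivative (circlepath z\<^sub>0 \<epsilon>) (at t within {0..1}))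
      has_integral 2 * of_real pi * \<i>) {0..1}"
    by (simp add: has_contour_integral_def)
  then show ?thesis
    unfolding path_integral_def scaleC_complex_def by (subst mult.commute) (rule integral_unique)
qed

text \<open>With \<open>-c\<close> the Riesz projection, \<open>R + R c\<close> is the regular part of the resolvent \<open>R\<close>: it is the
  Cauchy integral of \<open>R\<close> over a fixed circle, because
  \<open>R(z) R(\<zeta>) = (R(\<zeta>) - R(z)) / (\<zeta> - z)\<close>.\<close>

lemma resolvent_regular_part_bounded:
  fixes T :: "('a::complex_hilbert, 'a) operator"
  assumes "0 < r" and D: "ball z\<^sub>0 r - {z\<^sub>0} \<subseteq> \<rho> T" and c: "is_residue (resolvent T) z\<^sub>0 c"
  shows "\<exists>C. \<forall>\<^sub>F z in at z\<^sub>0. norm (resolvent T z + (resolvent T z o\<^sub>L c)) \<le> C"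
    "\<And>z. z \<in> ball z\<^sub>0 r - {z\<^sub>0} \<Longrightarrow> resolvent T z o\<^sub>L c = c o\<^sub>L resolvent T z"
proof -
  let ?R = "resolvent T"
  have an: "op_analytic_on ?R (ball z\<^sub>0 r - {z\<^sub>0})"
    by (rule op_analytic_on_subset[OF op_analytic_on_resolvent D]) auto
  define \<epsilon> where "\<epsilon> = r / 2"
  have \<epsilon>: "0 < \<epsilon>" "\<epsilon> < r" using assms(1) by (auto simp: \<epsilon>_def)
  have sub: "sphere z\<^sub>0 \<epsilon> \<subseteq> ball z\<^sub>0 r - {z\<^sub>0}" using \<epsilon> by auto
  then have cont: "continuous_on (sphere z\<^sub>0 \<epsilon>) ?R"
    using op_analytic_on_continuous_on[OF an] continuous_on_subset by blast
  have "c = (1 / (2 * of_real pi * \<i>)) *\<^sub>C path_integral (circlepath z\<^sub>0 \<epsilon>) ?R"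
    by (rule is_residue_unique[OF c path_integral_is_residue[OF an \<epsilon>]])
  then have int: "path_integral (circlepath z\<^sub>0 \<epsilon>) ?R = (2 * of_real pi * \<i>) *\<^sub>C c"
    by (simp add: scaleC_scaleC)
  have RB: "?R z \<in> \<B>" if "z \<in> ball z\<^sub>0 r - {z\<^sub>0}" for z using D that resolventD(1) by blast
  have left: "path_integral (circlepath z\<^sub>0 \<epsilon>) (\<lambda>\<zeta>. ?R z o\<^sub>L ?R \<zeta>) = (2 * of_real pi * \<i>) *\<^sub>C (?R z o\<^sub>L c)"
    if z: "z \<in> ball z\<^sub>0 r - {z\<^sub>0}" for z
    using path_integral_bounded_linear[OF cont \<epsilon>(1), of "\<lambda>X. ?R z o\<^sub>L X"] RB[OF z]
    by (simp add: bounded_bilinear.bounded_linear_right[OF bounded_bilinear_blinfun_compose] int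
        blinfun_compose_scaleC_right)
  have right: "path_integral (circlepath z\<^sub>0 \<epsilon>) (\<lambda>\<zeta>. ?R \<zeta> o\<^sub>L ?R z) = (2 * of_real pi * \<i>) *\<^sub>C (c o\<^sub>L ?R z)" for z
    using path_integral_bounded_linear[OF cont \<epsilon>(1), of "\<lambda>X. X o\<^sub>L ?R z"]
    by (simp add: bounded_bilinear.bounded_linear_left[OF bounded_bilinear_blinfun_compose] int
        blinfun_compose_scaleC_left)
  show "?R z o\<^sub>L c = c o\<^sub>L ?R z" if z: "z \<in> ball z\<^sub>0 r - {z\<^sub>0}" for z
  proof -
    have "path_integral (circlepath z\<^sub>0 \<epsilon>) (\<lambda>\<zeta>. ?R z o\<^sub>L ?R \<zeta>) =
        path_integral (circlepath z\<^sub>0 \<epsilon>) (\<lambda>\<zeta>. ?R \<zeta> o\<^sub>L ?R z)"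
      using z sub D by (intro path_integral_cong \<epsilon> resolvent_commute) auto
    then show ?thesis unfolding left[OF z] right by simp
  qed
  have "bounded (?R ` sphere z\<^sub>0 \<epsilon>)"
    by (intro compact_imp_bounded compact_continuous_image cont compact_sphere)
  then obtain B where B: "\<And>\<zeta>. \<zeta> \<in> sphere z\<^sub>0 \<epsilon> \<Longrightarrow> norm (?R \<zeta>) \<le> B" unfolding bounded_iff by blast
  \<comment> \<open>Points within \<open>\<epsilon> / 2\<close> of the center keep distance
    \<open>\<epsilon> / 2\<close> from the circle, so the Cauchy kernel is at most
    \<open>2 / \<epsilon>\<close> there. Dividing
    \<open>2 * pi * \<epsilon> * (2 / \<epsilon> * B)\<close> by \<open>2 * pi\<close> leaves
    \<open>2 * B\<close>.\<close>
  have "\<forall>\<^sub>F z in at z\<^sub>0. z \<in> ball z\<^sub>0 (\<epsilon> / 2) - {z\<^sub>0}"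
    using \<epsilon> unfolding eventually_at by (intro exI[of _ "\<epsilon>/2"]) (auto simp: dist_commute)
  then have "\<forall>\<^sub>F z in at z\<^sub>0. norm (?R z + (?R z o\<^sub>L c)) \<le> 2 * B"
  proof eventually_elim
    case (elim z)
    then have z: "z \<in> ball z\<^sub>0 r - {z\<^sub>0}" "z \<in> ball z\<^sub>0 \<epsilon>" "dist z\<^sub>0 z < \<epsilon> / 2" using \<epsilon> by auto
    have far: "\<epsilon> / 2 \<le> cmod (\<zeta> - z)" if "\<zeta> \<in> sphere z\<^sub>0 \<epsilon>" for \<zeta>
    proof -
      have "dist z\<^sub>0 \<zeta> \<le> dist z\<^sub>0 z + dist z \<zeta>" by (rule dist_triangle)
      then show ?thesis using that z(3) by (simp add: dist_norm norm_minus_commute)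
    qed
    have ne: "\<zeta> - z \<noteq> 0" if "\<zeta> \<in> sphere z\<^sub>0 \<epsilon>" for \<zeta> using far[OF that] \<epsilon> by auto
    have id: "(1 / (\<zeta> - z)) *\<^sub>C ?R \<zeta> = (?R z o\<^sub>L ?R \<zeta>) + (1 / (\<zeta> - z)) *\<^sub>C ?R z" if \<zeta>: "\<zeta> \<in> sphere z\<^sub>0 \<epsilon>" for \<zeta>
    proof -
      have "\<zeta> \<in> \<rho> T" "z \<in> \<rho> T" using \<zeta> z sub D by blast+
      then have "?R \<zeta> - ?R z = (\<zeta> - z) *\<^sub>C (?R z o\<^sub>L ?R \<zeta>)"
        using resolvent_identity[of \<zeta> T z] resolvent_commute[of \<zeta> T z] by simp
      then have "(1 / (\<zeta> - z)) *\<^sub>C (?R \<zeta> - ?R z) = ?R z o\<^sub>L ?R \<zeta>"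
        using ne[OF \<zeta>] by (simp add: scaleC_scaleC)
      then show ?thesis by (simp add: complex_vector.scale_right_diff_distrib diff_eq_eq)
    qed
    have c1: "continuous_on (sphere z\<^sub>0 \<epsilon>) (\<lambda>\<zeta>. ?R z o\<^sub>L ?R \<zeta>)"
      by (intro bounded_bilinear.continuous_on[OF bounded_bilinear_blinfun_compose] continuous_on_const cont)
    have c0: "continuous_on (sphere z\<^sub>0 \<epsilon>) (\<lambda>\<zeta>. 1 / (\<zeta> - z))"
      using ne by (intro continuous_intros) auto
    then have c2: "continuous_on (sphere z\<^sub>0 \<epsilon>) (\<lambda>\<zeta>. (1 / (\<zeta> - z)) *\<^sub>C ?R z)"
      by (intro continuous_on_scaleC continuous_on_const)
    have "path_integral (circlepath z\<^sub>0 \<epsilon>) (\<lambda>\<zeta>. (1 / (\<zeta> - z)) *\<^sub>C ?R \<zeta>) =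
        path_integral (circlepath z\<^sub>0 \<epsilon>) (\<lambda>\<zeta>. (?R z o\<^sub>L ?R \<zeta>) + (1 / (\<zeta> - z)) *\<^sub>C ?R z)"
      by (intro path_integral_cong id \<epsilon>)
    also have "\<dots> = path_integral (circlepath z\<^sub>0 \<epsilon>) (\<lambda>\<zeta>. ?R z o\<^sub>L ?R \<zeta>) +
        path_integral (circlepath z\<^sub>0 \<epsilon>) (\<lambda>\<zeta>. (1 / (\<zeta> - z)) *\<^sub>C ?R z)"
      by (intro path_integral_add c1 c2 \<epsilon>)
    also have "path_integral (circlepath z\<^sub>0 \<epsilon>) (\<lambda>\<zeta>. (1 / (\<zeta> - z)) *\<^sub>C ?R z) =
        path_integral (circlepath z\<^sub>0 \<epsilon>) (\<lambda>\<zeta>. 1 / (\<zeta> - z)) *\<^sub>C ?R z"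
      by (rule path_integral_bounded_linear[OF c0 \<epsilon>(1), of "\<lambda>d. d *\<^sub>C ?R z"])
        (simp_all add: bounded_bilinear.bounded_linear_left[OF bounded_bilinear_scaleC] scaleC_scaleC)
    finally have eq: "path_integral (circlepath z\<^sub>0 \<epsilon>) (\<lambda>\<zeta>. (1 / (\<zeta> - z)) *\<^sub>C ?R \<zeta>) =
        (2 * of_real pi * \<i>) *\<^sub>C (?R z + (?R z o\<^sub>L c))"
      unfolding left[OF z(1)] path_integral_Cauchy_kernel[OF z(2)] by (simp add: scaleC_add_right add.commute)
    have "norm (path_integral (circlepath z\<^sub>0 \<epsilon>) (\<lambda>\<zeta>. (1 / (\<zeta> - z)) *\<^sub>C ?R \<zeta>)) \<le> 2 * pi * \<epsilon> * (2 / \<epsilon> * B)"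
    proof (rule norm_path_integral_circlepath_le)
      show "continuous_on (sphere z\<^sub>0 \<epsilon>) (\<lambda>\<zeta>. (1 / (\<zeta> - z)) *\<^sub>C ?R \<zeta>)"
        by (intro continuous_on_scaleC c0 cont)
      fix \<zeta> assume \<zeta>: "\<zeta> \<in> sphere z\<^sub>0 \<epsilon>"
      have "1 / cmod (\<zeta> - z) \<le> 2 / \<epsilon>" using far[OF \<zeta>] \<epsilon> ne[OF \<zeta>] by (simp add: field_simps)
      then show "norm ((1 / (\<zeta> - z)) *\<^sub>C ?R \<zeta>) \<le> 2 / \<epsilon> * B"
        unfolding norm_scaleC norm_divide norm_one by (intro mult_mono B[OF \<zeta>]) (use \<epsilon> in auto)
    qed (rule \<epsilon>)
    then have "2 * pi * norm (?R z + (?R z o\<^sub>L c)) \<le> 2 * pi * (2 * B)"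
      using \<epsilon> by (simp add: eq norm_scaleC norm_mult)
    then show ?case by simp
  qed
  then show "\<exists>C. \<forall>\<^sub>F z in at z\<^sub>0. norm (?R z + (?R z o\<^sub>L c)) \<le> C" ..
qed

lemma resolvent_regular_part:
  fixes T :: "('a::complex_hilbert, 'a) operator"
  assumes "0 < r" and D: "ball z\<^sub>0 r - {z\<^sub>0} \<subseteq> \<rho> T" and c: "is_residue (resolvent T) z\<^sub>0 c"
  shows "has_finite_residue (\<lambda>z. resolvent T z + (resolvent T z o\<^sub>L c)) z\<^sub>0 r 0"
proof -
  have an: "op_analytic_on (resolvent T) (ball z\<^sub>0 r - {z\<^sub>0})"
    by (rule op_analytic_on_subset[OF op_analytic_on_resolvent D]) auto
  have cB: "c \<in> \<B>" by (rule is_residue_bounded_ops[OF c an assms(1)])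
  have an2: "op_analytic_on (\<lambda>z. resolvent T z + (resolvent T z o\<^sub>L c)) (ball z\<^sub>0 r - {z\<^sub>0})"
    by (intro op_analytic_on_add op_analytic_on_compose op_analytic_on_const an cB) auto
  obtain C where C: "\<forall>\<^sub>F z in at z\<^sub>0. norm (resolvent T z + (resolvent T z o\<^sub>L c)) \<le> C"
    using resolvent_regular_part_bounded(1)[OF assms] by blast
  obtain g where g: "op_analytic_on g (ball z\<^sub>0 r)"
    "\<And>z. z \<in> ball z\<^sub>0 r - {z\<^sub>0} \<Longrightarrow> resolvent T z + (resolvent T z o\<^sub>L c) = g z"
    using op_removable_singularity[OF assms(1) an2 C] by blast
  show ?thesis
    by (rule has_finite_residue_cong[OF has_finite_residue_of_analytic[OF g(1)]]) (simp add: g(2))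
qed

text \<open>Split the resolvent as \<open>R = (R + R c) - R c\<close>. The first part is analytic;
  the second lives on the finite-dimensional range of \<open>c\<close>, where inverting an affine
  family produces at most a pole.\<close>

lemma resolvent_has_finite_residue:
  fixes T :: "('a::complex_hilbert, 'a) operator"
  assumes "0 < r" and D: "ball z\<^sub>0 r - {z\<^sub>0} \<subseteq> \<rho> T" and c: "is_residue (resolvent T) z\<^sub>0 c"
    and fin: "cfinite_dim (range (blinfun_apply c))"
  shows "has_finite_residue (resolvent T) z\<^sub>0 r c"
proof -
  let ?R = "resolvent T" and ?D = "ball z\<^sub>0 r - {z\<^sub>0}"
  have an: "op_analytic_on ?R ?D"
    by (rule op_analytic_on_subset[OF op_analytic_on_resolvent D]) auto
  have cB: "c \<in> \<B>" by (rule is_residue_bounded_ops[OF c an assms(1)])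
  then have cF: "c \<in> \<F>" using fin by (simp add: finite_rank_ops_def)
  obtain E where E: "finite E" "orthonormal E" "cspan E = range (blinfun_apply c)"
    using finite_rank_basis[OF cF] by blast
  define P where "P = ortho_projection E"
  have P: "P \<in> \<F>" "P \<in> \<B>" "P o\<^sub>L P = P"
    using ortho_projection_finite_rank E finite_rank_opsD
    by (auto intro!: blinfun_eqI orthogonal_sum_id orthogonal_sum_in_cspan simp: P_def)
  have Pc: "P o\<^sub>L c = c"
    using E by (intro blinfun_eqI) (auto simp: P_def intro!: orthogonal_sum_id)
  have RB: "?R z \<in> \<B>" if "z \<in> ?D" for z using D that resolventD(1) by blast
  \<comment> \<open>The range of \<open>c\<close> is invariant, because the resolvent commutes with
    \<open>c\<close>.\<close>
  have PRP: "P o\<^sub>L (?R z o\<^sub>L P) = ?R z o\<^sub>L P" if z: "z \<in> ?D" for z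
  proof (rule blinfun_eqI)
    fix x
    have "orthogonal_sum E x \<in> range (blinfun_apply c)" using orthogonal_sum_in_cspan E(3) by blast
    then obtain y where y: "orthogonal_sum E x = blinfun_apply c y" by blast
    have "?R z o\<^sub>L c = c o\<^sub>L ?R z" by (rule resolvent_regular_part_bounded(2)[OF assms(1-3) z])
    then have "blinfun_apply (?R z) (blinfun_apply c y) = blinfun_apply c (blinfun_apply (?R z) y)"
      by (metis blinfun_apply_blinfun_compose)
    then have "blinfun_apply (?R z) (orthogonal_sum E x) \<in> cspan E" using y E(3) by simp
    then show "blinfun_apply (P o\<^sub>L (?R z o\<^sub>L P)) x = blinfun_apply (?R z o\<^sub>L P) x"
      by (simp add: P_def orthogonal_sum_id[OF E(1,2)])
  qed
  define w where "w = z\<^sub>0 + of_real (r / 2)"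
  have wD: "w \<in> ?D" using assms(1) by (auto simp: w_def dist_norm)
  then have w: "w \<in> \<rho> T" using D by blast
  \<comment> \<open>On the range of \<open>c\<close>, the two factors of the multiplicative
    resolvent equation become mutually inverse; \<open>s\<close> is affine in \<open>z\<close>, so
    the growth of \<open>m\<close> is under control.\<close>
  define s where "s z = (id_blinfun - (z - w) *\<^sub>C ?R w) o\<^sub>L P" for z
  define m where "m z = (id_blinfun + (z - w) *\<^sub>C ?R z) o\<^sub>L P" for z
  have inv: "is_inverse (id_blinfun - (z - w) *\<^sub>C ?R w) (id_blinfun + (z - w) *\<^sub>C ?R z)" if "z \<in> ?D" for z
    using D that w by (intro resolvent_is_inverse) auto
  have s_an: "op_analytic_on s (ball z\<^sub>0 r)"
    unfolding s_def
    by (intro op_analytic_on_compose op_analytic_on_diff op_analytic_on_const op_analytic_on_scaleC P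
        RB[OF wD] holomorphic_intros) auto
  have m_an: "op_analytic_on m ?D"
    unfolding m_def
    by (intro op_analytic_on_compose op_analytic_on_add op_analytic_on_const op_analytic_on_scaleC P
        an holomorphic_intros) auto
  have Ps: "P o\<^sub>L s z = s z" for z
    by (simp add: s_def blinfun_compose_distrib P PRP[OF wD])
  have Pm: "P o\<^sub>L m z = m z" if "z \<in> ?D" for z
    by (simp add: m_def blinfun_compose_distrib P PRP[OF that])
  have ms: "m z o\<^sub>L s z = P" "s z o\<^sub>L m z = P" if z: "z \<in> ?D" for z
  proof -
    have "m z o\<^sub>L s z = (id_blinfun + (z - w) *\<^sub>C ?R z) o\<^sub>L (P o\<^sub>L s z)"
      by (simp only: m_def blinfun_compose_assoc)
    also have "\<dots> = P" unfolding Ps by (simp only: s_def is_inverseD(8)[OF inv[OF z]])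
    finally show "m z o\<^sub>L s z = P" .
    have "s z o\<^sub>L m z = (id_blinfun - (z - w) *\<^sub>C ?R w) o\<^sub>L (P o\<^sub>L m z)"
      by (simp only: s_def blinfun_compose_assoc)
    also have "\<dots> = P" unfolding Pm[OF z] by (simp only: m_def is_inverseD(7)[OF inv[OF z]])
    finally show "s z o\<^sub>L m z = P" .
  qed
  have mP: "m z o\<^sub>L P = m z" for z by (simp add: m_def blinfun_compose_assoc P)
  have "\<exists>N C. \<forall>\<^sub>F z in at z\<^sub>0. norm ((z - z\<^sub>0) ^ Suc N *\<^sub>C m z) \<le> C"
    by (rule finite_dim_inverse_growth[OF assms(1) E(1,2) E(1,2) has_finite_residue_of_analytic[OF s_an]])
      (auto simp: P_def[symmetric] ms Ps Pm mP intro: op_analytic_onD(2)[OF m_an])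
  then obtain N C where growth: "\<forall>\<^sub>F z in at z\<^sub>0. norm ((z - z\<^sub>0) ^ Suc N *\<^sub>C m z) \<le> C" by blast
  obtain Rm where "has_finite_residue m z\<^sub>0 r Rm"
    using has_finite_residueI_growth[OF assms(1) m_an growth P(1) mP] by blast
  then have "has_finite_residue (\<lambda>z. ?R w o\<^sub>L (m z o\<^sub>L c)) z\<^sub>0 r (?R w o\<^sub>L (Rm o\<^sub>L c))"
    by (intro has_finite_residue_compose_left has_finite_residue_compose_right cB RB wD)
  moreover have "?R w o\<^sub>L (m z o\<^sub>L c) = ?R z o\<^sub>L c" if z: "z \<in> ?D" for z
  proof -
    have "z \<in> \<rho> T" using z D by blast
    then have "?R z = ?R w o\<^sub>L (id_blinfun + (z - w) *\<^sub>C ?R z)"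
      using resolvent_identity[OF _ w] resolvent_commute[OF _ w] RB[OF wD]
      by (simp add: blinfun_compose_distrib algebra_simps)
    moreover have "?R w o\<^sub>L (m z o\<^sub>L c) = (?R w o\<^sub>L (id_blinfun + (z - w) *\<^sub>C ?R z)) o\<^sub>L (P o\<^sub>L c)"
      by (simp only: m_def blinfun_compose_assoc)
    ultimately show ?thesis by (simp add: Pc)
  qed
  ultimately have Rc: "has_finite_residue (\<lambda>z. ?R z o\<^sub>L c) z\<^sub>0 r (?R w o\<^sub>L (Rm o\<^sub>L c))"
    by (rule has_finite_residue_cong)
  have R: "has_finite_residue ?R z\<^sub>0 r (0 - (?R w o\<^sub>L (Rm o\<^sub>L c)))"
    by (rule has_finite_residue_cong[OF has_finite_residue_diff[OF
          resolvent_regular_part[OF assms(1-3)] Rc]]) simp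
  with is_residue_unique[OF c has_finite_residue_is_residue[OF R assms(1)]] show ?thesis by simp
qed

text \<open>The circle integral has the same value for every radius below \<open>r\<close>, so the
  eventual value in the definition exists and is unique.\<close>

lemma riesz_projection_eq:
  fixes T :: "('a::complex_hilbert, 'a) operator"
  assumes "0 < r" and D: "ball z\<^sub>0 r - {z\<^sub>0} \<subseteq> \<rho> T" and c: "is_residue (resolvent T) z\<^sub>0 c"
  shows "riesz_projection T z\<^sub>0 = - c"
proof -
  have an: "op_analytic_on (resolvent T) (ball z\<^sub>0 r - {z\<^sub>0})"
    by (rule op_analytic_on_subset[OF op_analytic_on_resolvent D]) auto
  have "(- 1 / (2 * of_real pi * \<i>)) *\<^sub>C path_integral (circlepath z\<^sub>0 \<epsilon>) (resolvent T) = - c"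
    if "0 < \<epsilon>" "\<epsilon> < r" for \<epsilon>
  proof -
    have "c = (1 / (2 * of_real pi * \<i>)) *\<^sub>C path_integral (circlepath z\<^sub>0 \<epsilon>) (resolvent T)"
      by (rule is_residue_unique[OF c path_integral_is_residue[OF an that]])
    then show ?thesis by (simp add: complex_vector.scale_minus_left)
  qed
  then have ev: "\<forall>\<^sub>F \<epsilon> in at_right 0.
      (- 1 / (2 * of_real pi * \<i>)) *\<^sub>C path_integral (circlepath z\<^sub>0 \<epsilon>) (resolvent T) = - c"
    unfolding eventually_at_right_field using assms(1) by blast
  show ?thesis
    unfolding riesz_projection_def
  proof (rule the_equality)
    show "\<forall>\<^sub>F \<epsilon> in at_right 0.
      (- 1 / (2 * of_real pi * \<i>)) *\<^sub>C path_integral (circlepath z\<^sub>0 \<epsilon>) (resolvent T) = - c" by (rule ev)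
    fix P assume "\<forall>\<^sub>F \<epsilon> in at_right 0.
      (- 1 / (2 * of_real pi * \<i>)) *\<^sub>C path_integral (circlepath z\<^sub>0 \<epsilon>) (resolvent T) = P"
    with ev have "\<forall>\<^sub>F \<epsilon> in at_right (0::real). P = - c" by eventually_elim simp
    then show "P = - c" by simp
  qed
qed

text \<open>Two evaluations of the residue of \<open>R + R c\<close> are compared: additivity gives
  \<open>c + (c o\<^sub>L c)\<close>, analyticity gives 0. Hence \<open>- c\<close> is idempotent,
  and its trace is the dimension of its range.\<close>

lemma alg_mult_eq_trace:
  fixes T :: "('a::complex_hilbert, 'a) operator"
  assumes "0 < r" and D: "ball z\<^sub>0 r - {z\<^sub>0} \<subseteq> \<rho> T" and c: "has_finite_residue (resolvent T) z\<^sub>0 r c"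
  shows "cfinite_dim (range (blinfun_apply (riesz_projection T z\<^sub>0)))"
    "of_nat (m\<^sub>a z\<^sub>0 T) = - op_trace c"
proof -
  have isr: "is_residue (resolvent T) z\<^sub>0 c" by (rule has_finite_residue_is_residue[OF c assms(1)])
  have cF: "c \<in> \<F>" by (rule has_finite_residue_finite_rank[OF c])
  have eq: "riesz_projection T z\<^sub>0 = - c" by (rule riesz_projection_eq[OF assms(1,2) isr])
  show "cfinite_dim (range (blinfun_apply (riesz_projection T z\<^sub>0)))"
    unfolding eq using finite_rank_opsD(2) cF by blast
  have "has_finite_residue (\<lambda>z. resolvent T z + (resolvent T z o\<^sub>L c)) z\<^sub>0 r (c + (c o\<^sub>L c))"
    using cF finite_rank_opsD by (intro has_finite_residue_add has_finite_residue_compose_right c) auto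
  then have "c + (c o\<^sub>L c) = 0"
    using resolvent_regular_part[OF assms(1,2) isr] assms(1) by (rule has_finite_residue_unique)
  then have "(- c) o\<^sub>L (- c) = - c" by (simp add: blinfun_compose_distrib add_eq_0_iff)
  then have "op_trace (- c) = of_nat (cdim (range (blinfun_apply (- c))))"
    using cF by (intro op_trace_projection) auto
  then show "of_nat (m\<^sub>a z\<^sub>0 T) = - op_trace c"
    unfolding alg_mult_def eq by (simp add: op_trace_uminus[OF cF])
qed

text \<open>The leading Laurent coefficient of the resolvent maps into the eigenspace. The relation
  \<open>(T - z) R(z) = 1\<close> is used in a form containing only the bounded operator
  \<open>?R w\<close>, so that limits may be taken.\<close>

lemma resolvent_has_finite_residue_eigenvalue:
  fixes T :: "('a::complex_hilbert, 'a) operator"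
  assumes "0 < r" and D: "ball z\<^sub>0 r - {z\<^sub>0} \<subseteq> \<rho> T" and res: "has_finite_residue (resolvent T) z\<^sub>0 r R"
    and z0: "z\<^sub>0 \<in> \<sigma> T"
  shows "is_eigenvalue T z\<^sub>0"
proof -
  let ?R = "resolvent T" and ?D = "ball z\<^sub>0 r - {z\<^sub>0}"
  from res obtain N c g where c: "\<And>k. c k \<in> \<F>" and g: "op_analytic_on g (ball z\<^sub>0 r)"
    and eq: "\<And>z. z \<in> ?D \<Longrightarrow> ?R z = principal_part N c z\<^sub>0 z + g z"
    by (rule has_finite_residueE) blast
  have evD: "\<forall>\<^sub>F z in at z\<^sub>0. z \<in> ?D" using assms(1) by (auto simp: eventually_at dist_commute)
  define w where "w = z\<^sub>0 + of_real (r / 2)"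
  have "w \<in> ?D" using assms(1) by (auto simp: w_def dist_norm)
  then have w: "w \<in> \<rho> T" using D by blast
  note Rw = resolventD(1)[OF w]
  have gz0: "g z\<^sub>0 \<in> \<B>" using op_analytic_onD(2)[OF g] assms(1) by simp
  have glim: "(g \<longlongrightarrow> g z\<^sub>0) (at z\<^sub>0)" using op_analytic_on_isCont[OF g] assms(1) by (simp add: isCont_def)
  have L: "((\<lambda>z. id_blinfun - (z - w) *\<^sub>C ?R w) \<longlongrightarrow> id_blinfun - (z\<^sub>0 - w) *\<^sub>C ?R w) (at z\<^sub>0)"
    by (intro tendsto_intros)
  note oL = bounded_bilinear.tendsto[OF bounded_bilinear_blinfun_compose]
  have id1: "(id_blinfun - (z - w) *\<^sub>C ?R w) o\<^sub>L ?R z = ?R w" "?R z o\<^sub>L (id_blinfun - (z - w) *\<^sub>C ?R w) = ?R w"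
    if "z \<in> ?D" for z
  proof -
    have z: "z \<in> \<rho> T" using that D by blast
    have 1: "(z - w) *\<^sub>C (?R z o\<^sub>L ?R w) = ?R z - ?R w" using resolvent_identity[OF z w] by simp
    then have 2: "(z - w) *\<^sub>C (?R w o\<^sub>L ?R z) = ?R z - ?R w" using resolvent_commute[OF z w] by simp
    show "(id_blinfun - (z - w) *\<^sub>C ?R w) o\<^sub>L ?R z = ?R w" "?R z o\<^sub>L (id_blinfun - (z - w) *\<^sub>C ?R w) = ?R w"
      using resolventD(1)[OF z] by (simp_all add: blinfun_compose_distrib 1 2)
  qed
  \<comment> \<open>Without a polar part, \<open>g z\<^sub>0\<close> would satisfy the resolvent
    equation with \<open>?R w\<close>, and \<open>z\<^sub>0\<close> would lie in the resolvent
    set.\<close>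
  have "\<exists>k\<le>N. c k \<noteq> 0"
  proof (rule ccontr)
    assume "\<not> ?thesis"
    then have "principal_part N c z\<^sub>0 z = 0" for z by (simp add: principal_part_def)
    then have Rg: "?R z = g z" if "z \<in> ?D" for z using eq[OF that] by simp
    have e1: "(id_blinfun - (z\<^sub>0 - w) *\<^sub>C ?R w) o\<^sub>L g z\<^sub>0 = ?R w"
    proof (rule tendsto_unique[OF at_neq_bot])
      show "((\<lambda>z. (id_blinfun - (z - w) *\<^sub>C ?R w) o\<^sub>L g z) \<longlongrightarrow> (id_blinfun - (z\<^sub>0 - w) *\<^sub>C ?R w) o\<^sub>L g z\<^sub>0) (at z\<^sub>0)"
        by (intro oL L glim)
      show "((\<lambda>z. (id_blinfun - (z - w) *\<^sub>C ?R w) o\<^sub>L g z) \<longlongrightarrow> ?R w) (at z\<^sub>0)"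
        by (rule tendsto_eventually) (use evD in eventually_elim, use id1 Rg in simp)
    qed
    have e2: "g z\<^sub>0 o\<^sub>L (id_blinfun - (z\<^sub>0 - w) *\<^sub>C ?R w) = ?R w"
    proof (rule tendsto_unique[OF at_neq_bot])
      show "((\<lambda>z. g z o\<^sub>L (id_blinfun - (z - w) *\<^sub>C ?R w)) \<longlongrightarrow> g z\<^sub>0 o\<^sub>L (id_blinfun - (z\<^sub>0 - w) *\<^sub>C ?R w)) (at z\<^sub>0)"
        by (intro oL L glim)
      show "((\<lambda>z. g z o\<^sub>L (id_blinfun - (z - w) *\<^sub>C ?R w)) \<longlongrightarrow> ?R w) (at z\<^sub>0)"
        by (rule tendsto_eventually) (use evD in eventually_elim, use id1 Rg in simp)
    qed
    have 1: "(z\<^sub>0 - w) *\<^sub>C (?R w o\<^sub>L g z\<^sub>0) = g z\<^sub>0 - ?R w"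
      using e1 by (simp add: blinfun_compose_distrib algebra_simps)
    have 2: "(z\<^sub>0 - w) *\<^sub>C (g z\<^sub>0 o\<^sub>L ?R w) = g z\<^sub>0 - ?R w"
      using e2 gz0 by (simp add: blinfun_compose_distrib algebra_simps)
    have "is_inverse (id_blinfun - (z\<^sub>0 - w) *\<^sub>C ?R w) (id_blinfun + (z\<^sub>0 - w) *\<^sub>C g z\<^sub>0)"
      unfolding is_inverse_def using Rw gz0
      by (auto simp: blinfun_compose_distrib 1 2 complex_vector.scale_right_diff_distrib)
    then have "z\<^sub>0 \<in> \<rho> T" by (rule resolvent_setI[OF w])
    then show False using z0 by (simp add: op_spectrum_def)
  qed
  \<comment> \<open>\<open>k\<close> is the index of the leading coefficient: the pole has order
    \<open>Suc k\<close>.\<close>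
  then obtain k where k: "k \<le> N" "c k \<noteq> 0" and max: "\<And>j. k < j \<Longrightarrow> j \<le> N \<Longrightarrow> c j = 0"
  proof -
    let ?S = "{k. k \<le> N \<and> c k \<noteq> 0}"
    have S: "finite ?S" "?S \<noteq> {}" using \<open>\<exists>k\<le>N. c k \<noteq> 0\<close> by auto
    have "Max ?S \<in> ?S" by (rule Max_in[OF S])
    moreover have "c j = 0" if "Max ?S < j" "j \<le> N" for j
    proof (rule ccontr)
      assume "c j \<noteq> 0"
      then have "j \<in> ?S" using that by simp
      then show False using Max_ge[OF S(1)] that(1) by fastforce
    qed
    ultimately show thesis using that by blast
  qed
  have lim: "((\<lambda>z. (z - z\<^sub>0) ^ Suc k *\<^sub>C ?R z) \<longlongrightarrow> c k) (at z\<^sub>0)"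
  proof (rule Lim_transform_eventually)
    let ?f = "\<lambda>z. (\<Sum>j\<le>k. (z - z\<^sub>0) ^ (k - j) *\<^sub>C c j) + (z - z\<^sub>0) ^ Suc k *\<^sub>C g z"
    have "(?f \<longlongrightarrow> (\<Sum>j\<le>k. (z\<^sub>0 - z\<^sub>0) ^ (k - j) *\<^sub>C c j) + (z\<^sub>0 - z\<^sub>0) ^ Suc k *\<^sub>C g z\<^sub>0) (at z\<^sub>0)"
      by (intro tendsto_intros glim)
    moreover have "(\<Sum>j\<le>k. (z\<^sub>0 - z\<^sub>0) ^ (k - j) *\<^sub>C c j) = (\<Sum>j\<le>k. if j = k then c k else 0)"
      by (intro sum.cong) (auto simp: power_0_left)
    ultimately show "(?f \<longlongrightarrow> c k) (at z\<^sub>0)" by simp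
    show "\<forall>\<^sub>F z in at z\<^sub>0. ?f z = (z - z\<^sub>0) ^ Suc k *\<^sub>C ?R z"
      using evD
    proof eventually_elim
      case (elim z)
      then have nz: "z - z\<^sub>0 \<noteq> 0" by simp
      have "principal_part N c z\<^sub>0 z = (\<Sum>j\<le>k. inverse ((z - z\<^sub>0) ^ Suc j) *\<^sub>C c j)"
        unfolding principal_part_def using k max by (intro sum.mono_neutral_right) auto
      moreover have "(z - z\<^sub>0) ^ Suc k * inverse ((z - z\<^sub>0) ^ Suc j) = (z - z\<^sub>0) ^ (k - j)" if "j \<le> k" for j
        using nz that by (simp add: power_diff field_simps)
      ultimately show ?case
        unfolding eq[OF elim] by (simp add: scaleC_add_right complex_vector.scale_sum_right scaleC_scaleC
            del: power_Suc)
    qed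
  qed
  \<comment> \<open>After multiplication by \<open>(z - z\<^sub>0) ^ Suc k\<close> the right side of
    \<open>id1\<close> tends to 0. Thus \<open>(z\<^sub>0 - w) *\<^sub>C ?R w\<close> fixes the
    range of \<open>c k\<close>, whose nonzero vectors are eigenvectors.\<close>
  have "(id_blinfun - (z\<^sub>0 - w) *\<^sub>C ?R w) o\<^sub>L c k = 0"
  proof (rule tendsto_unique[OF at_neq_bot])
    show "((\<lambda>z. (id_blinfun - (z - w) *\<^sub>C ?R w) o\<^sub>L ((z - z\<^sub>0) ^ Suc k *\<^sub>C ?R z)) \<longlongrightarrow>
        (id_blinfun - (z\<^sub>0 - w) *\<^sub>C ?R w) o\<^sub>L c k) (at z\<^sub>0)"
      by (intro oL L lim)
    show "((\<lambda>z. (id_blinfun - (z - w) *\<^sub>C ?R w) o\<^sub>L ((z - z\<^sub>0) ^ Suc k *\<^sub>C ?R z)) \<longlongrightarrow> 0) (at z\<^sub>0)"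
    proof (rule Lim_transform_eventually)
      have "((\<lambda>z. (z - z\<^sub>0) ^ Suc k *\<^sub>C ?R w) \<longlongrightarrow> (z\<^sub>0 - z\<^sub>0) ^ Suc k *\<^sub>C ?R w) (at z\<^sub>0)"
        by (intro tendsto_intros)
      then show "((\<lambda>z. (z - z\<^sub>0) ^ Suc k *\<^sub>C ?R w) \<longlongrightarrow> 0) (at z\<^sub>0)" by simp
      show "\<forall>\<^sub>F z in at z\<^sub>0. (z - z\<^sub>0) ^ Suc k *\<^sub>C ?R w =
          (id_blinfun - (z - w) *\<^sub>C ?R w) o\<^sub>L ((z - z\<^sub>0) ^ Suc k *\<^sub>C ?R z)"
        using evD
      proof eventually_elim
        case (elim z)
        have "id_blinfun - (z - w) *\<^sub>C ?R w \<in> \<B>" using Rw by auto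
        then show ?case by (simp only: blinfun_compose_scaleC_right id1(1)[OF elim])
      qed
    qed
  qed
  moreover obtain y where y: "blinfun_apply (c k) y \<noteq> 0"
    using k(2) by (metis blinfun_eqI blinfun.zero_left)
  define x where "x = blinfun_apply (c k) y"
  ultimately have "x - (z\<^sub>0 - w) *\<^sub>C blinfun_apply (?R w) x = 0"
    unfolding x_def by (metis (no_types) blinfun.diff_left blinfun.zero_left blinfun_apply_blinfun_compose
        blinfun_apply_id_blinfun id_apply scaleC_blinfun.rep_eq)
  then have "x = blinfun_apply (?R w) ((z\<^sub>0 - w) *\<^sub>C x)" by (simp add: bounded_opsD[OF Rw])
  then have "(x, (z\<^sub>0 - w) *\<^sub>C x + w *\<^sub>C x) \<in> T" by (subst resolventD(3)[OF w])
  then have "(x, z\<^sub>0 *\<^sub>C x) \<in> T" by (simp add: complex_vector.scale_left_diff_distrib)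
  then show ?thesis unfolding is_eigenvalue_def using y x_def by blast
qed

section \<open>The perturbation setting\<close>

text \<open>The composite is everywhere defined, and its graph is the preimage of the closed
  \<open>V\<close> under a continuous map, so the closed graph theorem applies.\<close>

lemma closed_operator_compose_bounded:
  fixes V :: "('b::complex_hilbert, 'c::complex_hilbert) operator" and R :: "'a::complex_hilbert \<Rightarrow>\<^sub>L 'b"
  assumes V: "linear_operator V" "closed V" and R: "R \<in> \<B>" "range (blinfun_apply R) \<subseteq> Domain V"
  shows "everywhere_bounded (V \<odot> graph_of R)"
proof (rule everywhere_boundedI)
  have eq: "V \<odot> graph_of R = (\<lambda>p. (blinfun_apply R (fst p), snd p)) -` V"
    by (auto simp: graph_of_def relcomp.simps)
  show "csubspace (V \<odot> graph_of R)"
    unfolding eq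
    using linear_operatorD(2-4)[OF V(1)]
    by (intro complex_vector.subspaceI) (auto simp: scaleC_prod_def blinfun.add_right bounded_opsD[OF R(1)])
  show "closed (V \<odot> graph_of R)"
    unfolding eq by (intro closed_vimage V continuous_intros)
  show "single_valued (V \<odot> graph_of R)"
    using linear_operatorD(1)[OF V(1)] unfolding eq by (intro single_valuedI) (auto dest: single_valuedD)
  show "Domain (V \<odot> graph_of R) = UNIV"
    using R(2) unfolding eq by (force simp: Domain_iff)
qed

lemma closure_dense_restriction:
  assumes "T \<subseteq> graph_of B" "closure (Domain T) = UNIV"
  shows "closure T = graph_of B"
proof
  have "closed (graph_of B)"
  proof -
    have "graph_of B = {p. snd p = blinfun_apply B (fst p)}" by (auto simp: graph_of_def)
    then show ?thesis by (simp add: closed_Collect_eq continuous_intros)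
  qed
  then show "closure T \<subseteq> graph_of B" using assms(1) by (rule closure_minimal[rotated])
  show "graph_of B \<subseteq> closure T"
  proof
    fix p assume "p \<in> graph_of B"
    then obtain x where p: "p = (x, blinfun_apply B x)" unfolding graph_of_def by blast
    have "x \<in> closure (Domain T)" using assms(2) by simp
    then obtain f where f: "\<forall>n. f n \<in> Domain T" "f \<longlonglongrightarrow> x" unfolding closure_sequential by blast
    have "(f n, blinfun_apply B (f n)) \<in> T" for n
    proof -
      obtain y where "(f n, y) \<in> T" using f(1) by blast
      moreover from this have "y = blinfun_apply B (f n)" using assms(1) by auto
      ultimately show ?thesis by simp
    qed
    moreover have "(\<lambda>n. (f n, blinfun_apply B (f n))) \<longlonglongrightarrow> p"
      unfolding p by (intro tendsto_Pair f(2) blinfun.tendsto[OF tendsto_const f(2)])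
    ultimately show "p \<in> closure T"
      unfolding closure_sequential by (intro exI[of _ "\<lambda>n. (f n, blinfun_apply B (f n))"]) simp
  qed
qed

lemma blinfun_eq_on_dense:
  assumes "closure S = UNIV" "\<And>x. x \<in> S \<Longrightarrow> blinfun_apply F x = blinfun_apply G x"
  shows "F = G"
proof (rule blinfun_eqI)
  fix x
  have "closure S \<subseteq> {x. blinfun_apply F x = blinfun_apply G x}"
    using assms(2) by (intro closure_minimal closed_Collect_eq continuous_intros) auto
  then show "blinfun_apply F x = blinfun_apply G x" using assms(1) by blast
qed

lemma one_in_resolvent_set_iff:
  assumes "K \<in> \<B>"
  shows "1 \<in> \<rho> (graph_of K) \<longleftrightarrow> (\<exists>G. is_inverse (id_blinfun - K) G)"
proof -
  have "op_shift (graph_of K) 1 = graph_of (K - id_blinfun)"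
    by (auto simp: op_shift_def graph_of_def blinfun.diff_left)
  then have "1 \<in> \<rho> (graph_of K) \<longleftrightarrow> boundedly_invertible (K - id_blinfun)"
    by (simp add: resolvent_set_def boundedly_invertible_def)
  also have "\<dots> \<longleftrightarrow> (\<exists>G. is_inverse (K - id_blinfun) G)"
    using assms by (intro boundedly_invertible_iff) auto
  also have "\<dots> \<longleftrightarrow> (\<exists>G. is_inverse (id_blinfun - K) G)"
  proof -
    have "is_inverse F G \<Longrightarrow> is_inverse (- F) (- G)" for F G :: "'a \<Rightarrow>\<^sub>L 'a"
      unfolding is_inverse_def by (auto simp: blinfun_compose_distrib)
    from this[of "K - id_blinfun"] this[of "id_blinfun - K"] show ?thesis by auto
  qed
  finally show ?thesis .
qed

lemma has_finite_residue_subset: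
  assumes "has_finite_residue f z\<^sub>0 r R" "\<delta> \<le> r"
  shows "has_finite_residue f z\<^sub>0 \<delta> R"
proof -
  from assms(1) obtain N c g where "\<And>k. c k \<in> \<F>" "c 0 = R" and g: "op_analytic_on g (ball z\<^sub>0 r)"
    and "\<And>z. z \<in> ball z\<^sub>0 r - {z\<^sub>0} \<Longrightarrow> f z = principal_part N c z\<^sub>0 z + g z"
    by (rule has_finite_residueE) blast
  moreover have "op_analytic_on g (ball z\<^sub>0 \<delta>)"
    by (rule op_analytic_on_subset[OF g]) (use assms(2) in auto)
  ultimately show ?thesis using assms(2) by (intro has_finite_residueI[of c R g z\<^sub>0 \<delta> f N]) auto
qed

text \<open>The Woodbury formula usually derives the inverse of \<open>X + C E1 A\<close> from that
  of \<open>E + A G0 C\<close>; here it is run in the opposite direction. The auxiliary equations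
  are the two forms \<open>G0 - G = G0 C E1 A G = G C E1 A G0\<close>.\<close>

lemma is_inverse_Woodbury:
  assumes X: "is_inverse X G0" and Y: "is_inverse (X + (C o\<^sub>L (E1 o\<^sub>L A))) G" and E: "is_inverse E E1"
    and B: "A \<in> \<B>" "C \<in> \<B>"
  shows "is_inverse (E + (A o\<^sub>L (G0 o\<^sub>L C))) (E1 - (E1 o\<^sub>L (A o\<^sub>L (G o\<^sub>L (C o\<^sub>L E1)))))"
proof -
  note X = is_inverseD[OF X] and Y = is_inverseD[OF Y] and E = is_inverseD[OF E]
  have "G0 o\<^sub>L ((X + (C o\<^sub>L (E1 o\<^sub>L A))) o\<^sub>L G) = G0" using Y(3) by simp
  then have 1: "G0 o\<^sub>L (C o\<^sub>L (E1 o\<^sub>L (A o\<^sub>L G))) = G0 - G"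
    by (simp add: X blinfun_compose_distrib eq_diff_eq add.commute)
  have "(G o\<^sub>L (X + (C o\<^sub>L (E1 o\<^sub>L A)))) o\<^sub>L G0 = G0" using Y(4) by simp
  then have 2: "G o\<^sub>L (C o\<^sub>L (E1 o\<^sub>L (A o\<^sub>L G0))) = G0 - G"
    by (simp add: X blinfun_compose_distrib eq_diff_eq add.commute)
  have G0_eq: "G0 o\<^sub>L (C o\<^sub>L (E1 o\<^sub>L (A o\<^sub>L (G o\<^sub>L Z)))) = (G0 o\<^sub>L Z) - (G o\<^sub>L Z)" for Z
    using arg_cong[OF 1, of "\<lambda>U. U o\<^sub>L Z"] by (simp add: blinfun_compose_distrib)
  have G_eq: "G o\<^sub>L (C o\<^sub>L (E1 o\<^sub>L (A o\<^sub>L (G0 o\<^sub>L Z)))) = (G0 o\<^sub>L Z) - (G o\<^sub>L Z)" for Z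
    using arg_cong[OF 2, of "\<lambda>U. U o\<^sub>L Z"] by (simp add: blinfun_compose_distrib)
  show ?thesis
    unfolding is_inverse_def
  proof (intro conjI)
    show "(E + (A o\<^sub>L (G0 o\<^sub>L C))) o\<^sub>L (E1 - (E1 o\<^sub>L (A o\<^sub>L (G o\<^sub>L (C o\<^sub>L E1))))) = id_blinfun"
      by (simp add: X Y E B blinfun_compose_distrib G0_eq)
    show "(E1 - (E1 o\<^sub>L (A o\<^sub>L (G o\<^sub>L (C o\<^sub>L E1))))) o\<^sub>L (E + (A o\<^sub>L (G0 o\<^sub>L C))) = id_blinfun"
      by (simp add: X Y E B blinfun_compose_distrib G_eq)
  qed (use X Y E B in auto)
qed

section \<open>The bounded factors of the perturbation and their resolvent equations\<close>

locale factored_perturbation =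
  fixes H\<^sub>0 :: "('h::complex_hilbert, 'h) operator"
    and V\<^sub>1 V\<^sub>2 :: "('h, 'k::complex_hilbert) operator"
  assumes V1: "dd_closed_operator V\<^sub>1" and V2: "dd_closed_operator V\<^sub>2"
    and dom1: "Domain H\<^sub>0 \<subseteq> Domain V\<^sub>1" and dom2: "Domain (adjoint_op H\<^sub>0) \<subseteq> Domain V\<^sub>2"
    and ext: "\<exists>z\<in>\<rho> H\<^sub>0. has_bounded_extension (op_uminus (V\<^sub>1 \<odot> R0_graph H\<^sub>0 z \<odot> adjoint_op V\<^sub>2))"
begin

abbreviation "R \<equiv> resolvent H\<^sub>0"
abbreviation "A \<equiv> V1R0 H\<^sub>0 V\<^sub>1"
abbreviation "B \<equiv> R0V2adj H\<^sub>0 V\<^sub>2"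
abbreviation "K \<equiv> K_op H\<^sub>0 V\<^sub>1 V\<^sub>2"

lemma V1R0:
  assumes z: "z \<in> \<rho> H\<^sub>0"
  shows "A z \<in> \<B>" "(blinfun_apply (R z) x, blinfun_apply (A z) x) \<in> V\<^sub>1"
proof -
  have "range (blinfun_apply (R z)) \<subseteq> Domain V\<^sub>1"
    using dom1 resolventD(3)[OF z] by blast
  then have "everywhere_bounded (V\<^sub>1 \<odot> graph_of (R z))"
    using V1 resolventD(1)[OF z] by (intro closed_operator_compose_bounded) (auto simp: dd_closed_operator_def)
  from as_boundedD[OF this] have *: "A z \<in> \<B>" "graph_of (A z) = V\<^sub>1 \<odot> graph_of (R z)"
    by (simp_all add: V1R0_def resolventD(2)[OF z])
  then show "A z \<in> \<B>" by blast
  have "(x, blinfun_apply (A z) x) \<in> V\<^sub>1 \<odot> graph_of (R z)" unfolding *(2)[symmetric] by simp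
  then show "(blinfun_apply (R z) x, blinfun_apply (A z) x) \<in> V\<^sub>1" by auto
qed

lemma V1_eq: "(x, y) \<in> V\<^sub>1 \<Longrightarrow> (x, y') \<in> V\<^sub>1 \<Longrightarrow> y = y'"
  using V1 by (auto simp: dd_closed_operator_def linear_operator_def dest: single_valuedD)

lemma dense: "closure (Domain (adjoint_op V\<^sub>2)) = UNIV"
  by (rule dense_Domain_adjoint[OF V2])

text \<open>The composite \<open>R(z)\<close> after the adjoint of \<open>V\<^sub>2\<close> is a
  restriction of the adjoint of \<open>V\<^sub>2 R(z)'\<close>, where \<open>R(z)'\<close> is the
  adjoint of \<open>R(z)\<close>. The latter product is everywhere defined, hence bounded; density
  of the domain then identifies the closure.\<close>

lemma R0V2adj:
  assumes z: "z \<in> \<rho> H\<^sub>0"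
  shows "B z \<in> \<B>" "(k, g) \<in> adjoint_op V\<^sub>2 \<Longrightarrow> blinfun_apply (B z) k = blinfun_apply (R z) g"
proof -
  obtain Ra where Ra: "Ra \<in> \<B>" "\<And>k x. cinner (blinfun_apply Ra k) x = cinner k (blinfun_apply (R z) x)"
    using adjoint_exists[OF resolventD(1)[OF z]] by blast
  \<comment> \<open>\<open>Ra\<close> acts as the resolvent of the adjoint of
    \<open>H\<^sub>0\<close> at \<open>cnj z\<close>, so it maps into the domain of that adjoint and
    hence into \<open>Domain V\<^sub>2\<close>.\<close>
  have "(blinfun_apply Ra h, h + cnj z *\<^sub>C blinfun_apply Ra h) \<in> adjoint_op H\<^sub>0" for h
    unfolding adjoint_op_iff
  proof (intro allI impI)
    fix x y assume "(x, y) \<in> H\<^sub>0"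
    then have "(x, (y - z *\<^sub>C x) + z *\<^sub>C x) \<in> H\<^sub>0" by simp
    then have x: "x = blinfun_apply (R z) (y - z *\<^sub>C x)" using resolventD(3)[OF z] by blast
    have "cinner (blinfun_apply Ra h) (y - z *\<^sub>C x) = cinner h x" using Ra(2) x by simp
    then show "cinner (blinfun_apply Ra h) y = cinner (h + cnj z *\<^sub>C blinfun_apply Ra h) x"
      by (simp add: cinner_simps algebra_simps)
  qed
  then have "range (blinfun_apply Ra) \<subseteq> Domain V\<^sub>2" using dom2 by blast
  then have "everywhere_bounded (V\<^sub>2 \<odot> graph_of Ra)"
    using V2 Ra(1) by (intro closed_operator_compose_bounded) (auto simp: dd_closed_operator_def)
  from as_boundedD[OF this] obtain C where C: "C \<in> \<B>" "graph_of C = V\<^sub>2 \<odot> graph_of Ra" by blast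
  have CV: "(blinfun_apply Ra h, blinfun_apply C h) \<in> V\<^sub>2" for h
  proof -
    have "(h, blinfun_apply C h) \<in> V\<^sub>2 \<odot> graph_of Ra" unfolding C(2)[symmetric] by simp
    then show ?thesis by auto
  qed
  obtain Ca where Ca: "Ca \<in> \<B>" "\<And>k x. cinner (blinfun_apply Ca k) x = cinner k (blinfun_apply C x)"
    using adjoint_exists[OF C(1)] by blast
  have Ca_eq: "blinfun_apply Ca k = blinfun_apply (R z) g" if "(k, g) \<in> adjoint_op V\<^sub>2" for k g
  proof (rule cinner_ext)
    fix h
    have "cinner (blinfun_apply Ca k) h = cinner g (blinfun_apply Ra h)"
      using that CV[of h] Ca(2) unfolding adjoint_op_iff by metis
    then have "cinner h (blinfun_apply Ca k) = cinner (blinfun_apply Ra h) g"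
      by (metis cinner_commute)
    then show "cinner h (blinfun_apply Ca k) = cinner h (blinfun_apply (R z) g)" by (simp add: Ra(2))
  qed
  have "closure (graph_of (R z) \<odot> adjoint_op V\<^sub>2) = graph_of Ca"
  proof (rule closure_dense_restriction)
    have "(k, blinfun_apply (R z) g) \<in> graph_of (R z) \<odot> adjoint_op V\<^sub>2" if "(k, g) \<in> adjoint_op V\<^sub>2" for k g
      by (rule relcompI[OF that]) simp
    then have "Domain (graph_of (R z) \<odot> adjoint_op V\<^sub>2) = Domain (adjoint_op V\<^sub>2)" by blast
    then show "closure (Domain (graph_of (R z) \<odot> adjoint_op V\<^sub>2)) = UNIV" using dense by simp
  qed (auto simp: Ca_eq)
  then have "B z = Ca"
    by (simp add: R0V2adj_def as_bounded_graph_of[OF Ca(1)] flip: resolventD(2)[OF z])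
  then show "B z \<in> \<B>" "(k, g) \<in> adjoint_op V\<^sub>2 \<Longrightarrow> blinfun_apply (B z) k = blinfun_apply (R z) g"
    using Ca(1) Ca_eq by simp_all
qed

lemma V1R0_shift:
  assumes z: "z \<in> \<rho> H\<^sub>0" and w: "w \<in> \<rho> H\<^sub>0"
  shows "A z = A w o\<^sub>L (id_blinfun + (z - w) *\<^sub>C R z)"
proof (rule blinfun_eqI)
  fix x
  have "R z = R w o\<^sub>L (id_blinfun + (z - w) *\<^sub>C R z)"
    using resolvent_identity[OF z w] resolvent_commute[OF z w] resolventD(1)[OF w]
    by (simp add: blinfun_compose_distrib algebra_simps)
  then have "blinfun_apply (R z) x = blinfun_apply (R w) (blinfun_apply (id_blinfun + (z - w) *\<^sub>C R z) x)"
    by (metis blinfun_apply_blinfun_compose)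
  then show "blinfun_apply (A z) x = blinfun_apply (A w o\<^sub>L (id_blinfun + (z - w) *\<^sub>C R z)) x"
    using V1R0(2)[OF z, of x] V1R0(2)[OF w, of "blinfun_apply (id_blinfun + (z - w) *\<^sub>C R z) x"]
    by (auto intro: V1_eq)
qed

lemma R0V2adj_shift:
  assumes z: "z \<in> \<rho> H\<^sub>0" and w: "w \<in> \<rho> H\<^sub>0"
  shows "B z = (id_blinfun + (z - w) *\<^sub>C R z) o\<^sub>L B w"
proof (rule blinfun_eq_on_dense[OF dense])
  fix k assume "k \<in> Domain (adjoint_op V\<^sub>2)"
  then obtain g where g: "(k, g) \<in> adjoint_op V\<^sub>2" by blast
  have "R z = (id_blinfun + (z - w) *\<^sub>C R z) o\<^sub>L R w"
    using resolvent_identity[OF z w] by (simp add: blinfun_compose_distrib algebra_simps)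
  then have "blinfun_apply (R z) g = blinfun_apply ((id_blinfun + (z - w) *\<^sub>C R z) o\<^sub>L R w) g" by simp
  then show "blinfun_apply (B z) k = blinfun_apply ((id_blinfun + (z - w) *\<^sub>C R z) o\<^sub>L B w) k"
    by (simp add: R0V2adj(2)[OF z g] R0V2adj(2)[OF w g])
qed

text \<open>\<open>V1R0_shift\<close> produces the pair \<open>A w\<close>, \<open>R z\<close>. The
  pair \<open>A z\<close>, \<open>R w\<close> is wanted, because \<open>R w\<close> after the
  adjoint of \<open>V\<^sub>2\<close> becomes \<open>B w\<close>.\<close>

lemma V1_resolvent_diff:
  assumes z: "z \<in> \<rho> H\<^sub>0" and w: "w \<in> \<rho> H\<^sub>0"
  shows "A z - A w = (z - w) *\<^sub>C (A z o\<^sub>L R w)"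
proof -
  have "(id_blinfun + (z - w) *\<^sub>C R z) o\<^sub>L R w = R w + (R z - R w)"
    unfolding resolvent_identity[OF z w] by (simp add: blinfun_compose_distrib)
  then have "A z o\<^sub>L R w = A w o\<^sub>L R z"
    by (simp add: V1R0_shift[OF z w] blinfun_compose_assoc)
  moreover have "A z - A w = (z - w) *\<^sub>C (A w o\<^sub>L R z)"
    using V1R0_shift[OF z w] V1R0(1)[OF w] by (simp add: blinfun_compose_distrib)
  ultimately show ?thesis by simp
qed

text \<open>A bounded extension is given at one point \<open>w\<close> only. Passing from
  \<open>w\<close> to \<open>z\<close> changes the composite by
  \<open>(z - w) *\<^sub>C (A z o\<^sub>L B w)\<close>, which is bounded, so \<open>C\<close> is an
  extension at \<open>z\<close>.\<close>

lemma K_op: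
  assumes z: "z \<in> \<rho> H\<^sub>0"
  shows "K z \<in> \<B>" "(k, g) \<in> adjoint_op V\<^sub>2 \<Longrightarrow> blinfun_apply (K z) k = - blinfun_apply (A z) g"
proof -
  have graph: "V\<^sub>1 \<odot> graph_of (R z) \<odot> adjoint_op V\<^sub>2 \<subseteq> graph_of C"
    if "\<And>k g. (k, g) \<in> adjoint_op V\<^sub>2 \<Longrightarrow> blinfun_apply C k = blinfun_apply (A z) g" for C
  proof (rule subrelI)
    fix k v assume "(k, v) \<in> V\<^sub>1 \<odot> graph_of (R z) \<odot> adjoint_op V\<^sub>2"
    then obtain g where g: "(k, g) \<in> adjoint_op V\<^sub>2" "(blinfun_apply (R z) g, v) \<in> V\<^sub>1" by auto
    then have "v = blinfun_apply (A z) g" using V1R0(2)[OF z] V1_eq by blast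
    then show "(k, v) \<in> graph_of C" using that[OF g(1)] by simp
  qed
  obtain w Cw where w: "w \<in> \<rho> H\<^sub>0" "Cw \<in> \<B>"
    and sub: "op_uminus (V\<^sub>1 \<odot> R0_graph H\<^sub>0 w \<odot> adjoint_op V\<^sub>2) \<subseteq> graph_of Cw"
    using ext unfolding has_bounded_extension_def by blast
  have Cw: "blinfun_apply Cw k = - blinfun_apply (A w) g" if "(k, g) \<in> adjoint_op V\<^sub>2" for k g
  proof -
    have "(k, blinfun_apply (A w) g) \<in> V\<^sub>1 \<odot> R0_graph H\<^sub>0 w \<odot> adjoint_op V\<^sub>2"
      unfolding resolventD(2)[OF w(1), symmetric]
      by (rule relcompI[OF that], rule relcompI[OF _ V1R0(2)[OF w(1)]]) simp
    then have "(k, - blinfun_apply (A w) g) \<in> graph_of Cw" using sub unfolding op_uminus_def by blast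
    then show ?thesis by simp
  qed
  define C where "C = (z - w) *\<^sub>C (A z o\<^sub>L B w) - Cw"
  have CB: "C \<in> \<B>" unfolding C_def using V1R0(1)[OF z] R0V2adj(1)[OF w(1)] w(2) by auto
  have C: "blinfun_apply C k = blinfun_apply (A z) g" if "(k, g) \<in> adjoint_op V\<^sub>2" for k g
  proof -
    have "(z - w) *\<^sub>C blinfun_apply (A z) (blinfun_apply (R w) g) = blinfun_apply (A z) g - blinfun_apply (A w) g"
      using arg_cong[OF V1_resolvent_diff[OF z w(1)], of "\<lambda>X. blinfun_apply X g"]
      by (simp add: blinfun.diff_left)
    then show ?thesis
      using Cw[OF that] R0V2adj(2)[OF w(1) that] by (simp add: C_def blinfun.diff_left)
  qed
  have "(k, blinfun_apply (A z) g) \<in> V\<^sub>1 \<odot> graph_of (R z) \<odot> adjoint_op V\<^sub>2" if "(k, g) \<in> adjoint_op V\<^sub>2" for k g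
    by (rule relcompI[OF that], rule relcompI[OF _ V1R0(2)[OF z]]) simp
  then have "Domain (V\<^sub>1 \<odot> graph_of (R z) \<odot> adjoint_op V\<^sub>2) = Domain (adjoint_op V\<^sub>2)"
    by blast
  then have "closure (V\<^sub>1 \<odot> graph_of (R z) \<odot> adjoint_op V\<^sub>2) = graph_of C"
    using dense by (intro closure_dense_restriction graph C) simp_all
  then have "K z = - C"
    by (simp add: K_op_def as_bounded_graph_of[OF CB] flip: resolventD(2)[OF z])
  then show "K z \<in> \<B>" "(k, g) \<in> adjoint_op V\<^sub>2 \<Longrightarrow> blinfun_apply (K z) k = - blinfun_apply (A z) g"
    using CB C by (simp_all add: blinfun.minus_left)
qed

lemma K_op_diff:
  assumes z: "z \<in> \<rho> H\<^sub>0" and w: "w \<in> \<rho> H\<^sub>0"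
  shows "K z - K w = - ((z - w) *\<^sub>C (A z o\<^sub>L B w))"
proof (rule blinfun_eq_on_dense[OF dense])
  fix k assume "k \<in> Domain (adjoint_op V\<^sub>2)"
  then obtain g where g: "(k, g) \<in> adjoint_op V\<^sub>2" by blast
  have "blinfun_apply (A z - A w) g = blinfun_apply ((z - w) *\<^sub>C (A z o\<^sub>L R w)) g"
    by (simp only: V1_resolvent_diff[OF z w])
  then show "blinfun_apply (K z - K w) k = blinfun_apply (- ((z - w) *\<^sub>C (A z o\<^sub>L B w))) k"
    using K_op(2)[OF z g] K_op(2)[OF w g] R0V2adj(2)[OF w g]
    by (simp add: blinfun.diff_left blinfun.minus_left algebra_simps)
qed

lemma op_analytic_on_V1R0: "op_analytic_on A (\<rho> H\<^sub>0)"
proof -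
  obtain w where w: "w \<in> \<rho> H\<^sub>0" using ext by blast
  have "op_analytic_on (\<lambda>z. A w o\<^sub>L (id_blinfun + (z - w) *\<^sub>C R z)) (\<rho> H\<^sub>0)"
    by (intro op_analytic_on_compose op_analytic_on_add op_analytic_on_const op_analytic_on_scaleC
        open_resolvent_set V1R0(1)[OF w] op_analytic_on_resolvent holomorphic_intros) auto
  then show ?thesis by (rule op_analytic_on_cong) (rule V1R0_shift[OF _ w, symmetric])
qed

text \<open>The difference quotient at \<open>z\<close> equals \<open>- (A w o\<^sub>L B z)\<close>
  exactly, so continuity of \<open>A\<close> alone gives the limit.\<close>

lemma K_op_has_deriv:
  assumes z: "z \<in> \<rho> H\<^sub>0"
  shows "op_has_deriv K (- (A z o\<^sub>L B z)) z"
  unfolding op_has_deriv_def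
proof (rule Lim_transform_eventually)
  have "(A \<longlongrightarrow> A z) (at z)" using op_analytic_on_isCont[OF op_analytic_on_V1R0 z] by (simp add: isCont_def)
  then show "((\<lambda>w. - (A w o\<^sub>L B z)) \<longlongrightarrow> - (A z o\<^sub>L B z)) (at z)"
    by (intro tendsto_minus bounded_bilinear.tendsto[OF bounded_bilinear_blinfun_compose] tendsto_const)
  have "\<forall>\<^sub>F w in at z. w \<in> \<rho> H\<^sub>0 \<and> w \<noteq> z"
    using z open_resolvent_set by (auto simp: eventually_at_topological)
  then show "\<forall>\<^sub>F w in at z. - (A w o\<^sub>L B z) = inverse (w - z) *\<^sub>C (K w - K z)"
    by eventually_elim (simp add: K_op_diff[OF _ z] scaleC_scaleC)
qed

lemma op_analytic_on_K_op: "op_analytic_on K (\<rho> H\<^sub>0)"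
  unfolding op_analytic_on_iff using open_resolvent_set K_op(1) K_op_has_deriv by blast

lemma id_minus_K_op_has_deriv:
  assumes z: "z \<in> \<rho> H\<^sub>0"
  shows "op_has_deriv (\<lambda>z. id_blinfun - K z) (A z o\<^sub>L B z) z"
  using tendsto_minus[OF K_op_has_deriv[OF z, unfolded op_has_deriv_def]]
  unfolding op_has_deriv_def by (simp flip: complex_vector.scale_minus_right)

text \<open>Woodbury with \<open>X = 1 - s R(b)\<close>, \<open>C = s B(b)\<close> and
  \<open>E = 1 - K(b)\<close>. The perturbed operator is then \<open>1 - s\<close> times the
  resolvent of \<open>H\<close> at \<open>b\<close>, invertible because \<open>z\<close> lies in
  \<open>\<rho> H\<close>, while \<open>E + A G0 C\<close> becomes \<open>1 - K(z)\<close>.\<close>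

lemma id_minus_K_op_invertible:
  assumes b: "b \<in> \<rho> H\<^sub>0" "is_inverse (id_blinfun - K b) G1"
    and H: "b \<in> \<rho> H" "resolvent H b = R b - (B b o\<^sub>L G1 o\<^sub>L A b)"
    and z: "z \<in> \<rho> H\<^sub>0" "z \<in> \<rho> H"
  shows "\<exists>G. is_inverse (id_blinfun - K z) G"
proof -
  define s where "s = z - b"
  have BB: "A b \<in> \<B>" "B b \<in> \<B>" by (rule V1R0(1)[OF b(1)], rule R0V2adj(1)[OF b(1)])
  have X: "is_inverse (id_blinfun - s *\<^sub>C R b) (id_blinfun + s *\<^sub>C R z)"
    unfolding s_def by (rule resolvent_is_inverse[OF z(1) b(1)])
  have "is_inverse (id_blinfun - s *\<^sub>C resolvent H b) (id_blinfun + s *\<^sub>C resolvent H z)"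
    unfolding s_def by (rule resolvent_is_inverse[OF z(2) H(1)])
  moreover have "id_blinfun - s *\<^sub>C resolvent H b = (id_blinfun - s *\<^sub>C R b) + ((s *\<^sub>C B b) o\<^sub>L (G1 o\<^sub>L A b))"
    by (simp add: H(2) blinfun_compose_distrib complex_vector.scale_right_diff_distrib)
  ultimately have Y: "is_inverse ((id_blinfun - s *\<^sub>C R b) + ((s *\<^sub>C B b) o\<^sub>L (G1 o\<^sub>L A b))) (id_blinfun +
      s *\<^sub>C resolvent H z)"
    by simp
  have "A z = A b o\<^sub>L (id_blinfun + s *\<^sub>C R z)" unfolding s_def by (rule V1R0_shift[OF z(1) b(1)])
  then have "A b o\<^sub>L ((id_blinfun + s *\<^sub>C R z) o\<^sub>L (s *\<^sub>C B b)) = A z o\<^sub>L (s *\<^sub>C B b)"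
    by (simp only: blinfun_compose_assoc)
  also have "\<dots> = s *\<^sub>C (A z o\<^sub>L B b)" by (rule blinfun_compose_scaleC_right[OF V1R0(1)[OF z(1)]])
  also have "\<dots> = - (K z - K b)" unfolding K_op_diff[OF z(1) b(1)] s_def by simp
  finally have "(id_blinfun - K b) + (A b o\<^sub>L ((id_blinfun + s *\<^sub>C R z) o\<^sub>L (s *\<^sub>C B b))) = id_blinfun - K z"
    by simp
  with is_inverse_Woodbury[OF X Y b(2) BB(1)] BB(2) show ?thesis by auto
qed

text \<open>The shift formulas build \<open>A\<close>, \<open>B\<close> and \<open>K\<close> from
  the resolvent, scalars and bounded operators at a fixed point \<open>b\<close>, so that poles come
  from the resolvent only.\<close>

lemma has_finite_residue_free:
  assumes r: "0 < r" and D: "ball z\<^sub>0 r - {z\<^sub>0} \<subseteq> \<rho> H\<^sub>0" and R: "has_finite_residue R z\<^sub>0 r c"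
  obtains RA RB RK where "has_finite_residue A z\<^sub>0 r RA" "has_finite_residue B z\<^sub>0 r RB"
    "has_finite_residue K z\<^sub>0 r RK"
proof -
  obtain b where b: "b \<in> \<rho> H\<^sub>0" using ext by blast
  \<comment> \<open>The scalar \<open>z - b\<close> is written as an operator function, so that
    multiplication by it is covered by composition.\<close>
  let ?s = "\<lambda>z. (z - b) *\<^sub>C (id_blinfun :: 'h \<Rightarrow>\<^sub>L 'h)" and ?sk = "\<lambda>z. (z - b) *\<^sub>C (id_blinfun :: 'k \<Rightarrow>\<^sub>L 'k)"
  have const: "has_finite_residue (\<lambda>_. X) z\<^sub>0 r 0" if "X \<in> \<B>" for X :: "'x::complex_hilbert \<Rightarrow>\<^sub>L 'y::complex_hilbert"
    using that by (intro has_finite_residue_of_analytic op_analytic_on_const) auto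
  have s: "has_finite_residue ?s z\<^sub>0 r 0" "has_finite_residue ?sk z\<^sub>0 r 0"
    by (intro has_finite_residue_of_analytic op_analytic_on_scaleC op_analytic_on_const holomorphic_intros; simp)+
  obtain R1 where R1: "has_finite_residue (\<lambda>z. ?s z o\<^sub>L R z) z\<^sub>0 r R1"
    using has_finite_residue_compose[OF r s(1) R] by blast
  have id: "has_finite_residue (\<lambda>_. id_blinfun :: 'h \<Rightarrow>\<^sub>L 'h) z\<^sub>0 r 0"
    by (intro has_finite_residue_of_analytic op_analytic_on_const) auto
  from has_finite_residue_add[OF id R1]
  have G: "has_finite_residue (\<lambda>z. id_blinfun + (z - b) *\<^sub>C R z) z\<^sub>0 r R1"
    by (simp add: blinfun_compose_scaleC_left)
  have A: "has_finite_residue A z\<^sub>0 r (A b o\<^sub>L R1)"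
    using has_finite_residue_compose_left[OF G V1R0(1)[OF b]]
    by (rule has_finite_residue_cong) (use D V1R0_shift[OF _ b] in auto)
  have B: "has_finite_residue B z\<^sub>0 r (R1 o\<^sub>L B b)"
    using has_finite_residue_compose_right[OF G R0V2adj(1)[OF b]]
    by (rule has_finite_residue_cong) (use D R0V2adj_shift[OF _ b] in auto)
  obtain R2 where R2: "has_finite_residue (\<lambda>z. ?sk z o\<^sub>L (A z o\<^sub>L B b)) z\<^sub>0 r R2"
    using has_finite_residue_compose[OF r s(2) has_finite_residue_compose_right[OF A R0V2adj(1)[OF b]]] by blast
  have Kb: "has_finite_residue (\<lambda>_. K b) z\<^sub>0 r 0"
    using K_op(1)[OF b] by (intro has_finite_residue_of_analytic op_analytic_on_const) auto
  have "has_finite_residue K z\<^sub>0 r (0 - R2)"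
  proof (rule has_finite_residue_cong[OF has_finite_residue_diff[OF Kb R2]])
    fix z assume "z \<in> ball z\<^sub>0 r - {z\<^sub>0}"
    then have "K z - K b = - ((z - b) *\<^sub>C (A z o\<^sub>L B b))" using D b by (intro K_op_diff) auto
    then show "K b - (?sk z o\<^sub>L (A z o\<^sub>L B b)) = K z"
      by (simp add: blinfun_compose_scaleC_left diff_eq_eq)
  qed
  with A B show thesis by (rule that)
qed

end

section \<open>The index formula for algebraic multiplicities\<close>

theorem theorem5p5:
  fixes H\<^sub>0 H :: "('h::complex_hilbert, 'h) operator"
    and V\<^sub>1 V\<^sub>2 :: "('h, 'k::complex_hilbert) operator"
    and K :: "complex \<Rightarrow> ('k \<Rightarrow>\<^sub>L 'k)"
    and z\<^sub>0 :: complex and \<epsilon>\<^sub>0 :: real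
  assumes separable: "separable_space (euclidean :: 'h topology)"
      "separable_space (euclidean :: 'k topology)"
    and H0: "dd_closed_operator H\<^sub>0" "\<rho> H\<^sub>0 \<noteq> {}"
    and V: "dd_closed_operator V\<^sub>1" "dd_closed_operator V\<^sub>2"
      "Domain H\<^sub>0 \<subseteq> Domain V\<^sub>1" "Domain (adjoint_op H\<^sub>0) \<subseteq> Domain V\<^sub>2"
    and ext: "\<exists>z\<in>\<rho> H\<^sub>0. has_bounded_extension (op_uminus (V\<^sub>1 \<odot> R0_graph H\<^sub>0 z \<odot> adjoint_op V\<^sub>2))"
    and K_def: "K = K_op H\<^sub>0 V\<^sub>1 V\<^sub>2"
    and inv: "\<exists>z\<^sub>1\<in>\<rho> H\<^sub>0. 1 \<in> \<rho> (graph_of (K z\<^sub>1))"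
    and Fredholm: "\<forall>z\<in>\<rho> H\<^sub>0. id_blinfun - K z \<in> \<Phi>"
    and H: "dd_closed_operator H"
      "\<forall>z\<in>{\<zeta>\<in>\<rho> H\<^sub>0. 1 \<in> \<rho> (graph_of (K \<zeta>))}. z \<in> \<rho> H \<and>
         resolvent H z = resolvent H\<^sub>0 z -
           (R0V2adj H\<^sub>0 V\<^sub>2 z o\<^sub>L bounded_inverse (id_blinfun - K z) o\<^sub>L V1R0 H\<^sub>0 V\<^sub>1 z)"
    and z0: "z\<^sub>0 \<in> \<sigma>\<^sub>d H\<^sub>0 \<inter> \<sigma> H"
    and eps0: "0 < \<epsilon>\<^sub>0" "ball z\<^sub>0 \<epsilon>\<^sub>0 \<inter> \<sigma> H = {z\<^sub>0}" "ball z\<^sub>0 \<epsilon>\<^sub>0 - {z\<^sub>0} \<subseteq> \<rho> H\<^sub>0"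
  shows "op_analytic_on K (\<rho> H\<^sub>0) \<and>
    finitely_meromorphic_on K (ball z\<^sub>0 \<epsilon>\<^sub>0) \<and>
    (\<exists>N\<^sub>0>0. op_laurent_expansion K z\<^sub>0 \<epsilon>\<^sub>0 N\<^sub>0 (laurent_coeff K z\<^sub>0) \<and>
       (\<forall>k. 1 \<le> k \<and> k \<le> int N\<^sub>0 \<longrightarrow> laurent_coeff K z\<^sub>0 (- k) \<in> \<F>) \<and>
       (\<forall>k\<ge>0. laurent_coeff K z\<^sub>0 k \<in> \<B>)) \<and>
    (id_blinfun - laurent_coeff K z\<^sub>0 0 \<in> \<Phi> \<longrightarrow>
       z\<^sub>0 \<in> \<sigma>\<^sub>d H \<and>
       (\<forall>\<epsilon>\<^sub>1. 0 < \<epsilon>\<^sub>1 \<and> \<epsilon>\<^sub>1 < \<epsilon>\<^sub>0 \<longrightarrow>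
          (let \<Omega> = ball z\<^sub>0 \<epsilon>\<^sub>1; M = (\<lambda>z. id_blinfun - K z) in
             op_analytic_on M (\<Omega> - {z\<^sub>0}) \<and>
             finitely_meromorphic_on M \<Omega> \<and>
             (\<forall>z\<in>\<Omega> - {z\<^sub>0}. M z \<in> \<Phi>) \<and>
             laurent_coeff M z\<^sub>0 0 \<in> \<Phi> \<and>
             (\<exists>\<delta>>0. \<forall>z\<in>ball z\<^sub>0 \<delta> - {z\<^sub>0}. boundedly_invertible (M z)) \<and>
             (\<forall>\<epsilon>. 0 < \<epsilon> \<and> \<epsilon> < \<epsilon>\<^sub>1 \<longrightarrow>
                complex_of_real (real (m\<^sub>a z\<^sub>0 H)) =
                  complex_of_real (real (m\<^sub>a z\<^sub>0 H\<^sub>0)) + op_index M z\<^sub>0 \<epsilon>))))"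
proof -
  interpret factored_perturbation H\<^sub>0 V\<^sub>1 V\<^sub>2
    using V ext by unfold_locales
  let ?K = "K_op H\<^sub>0 V\<^sub>1 V\<^sub>2"
  define M where "M z = id_blinfun - K z" for z
  let ?D = "ball z\<^sub>0 \<epsilon>\<^sub>0 - {z\<^sub>0}"
  have r: "0 < \<epsilon>\<^sub>0" and D: "?D \<subseteq> \<rho> H\<^sub>0" by (rule eps0)+
  have DH: "?D \<subseteq> \<rho> H" using eps0(2) by (auto simp: op_spectrum_def)
  have resolvent_an: "op_analytic_on (resolvent H\<^sub>0) ?D"
    by (rule op_analytic_on_subset[OF op_analytic_on_resolvent D]) auto
  obtain c\<^sub>0 where c0: "is_residue (resolvent H\<^sub>0) z\<^sub>0 c\<^sub>0"
    using path_integral_is_residue[OF resolvent_an, of "\<epsilon>\<^sub>0 / 2"] r by auto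
  \<comment> \<open>Membership in \<open>\<sigma>\<^sub>d H\<^sub>0\<close> enters through the
    finite rank of the Riesz projection, which is \<open>- c\<^sub>0\<close>.\<close>
  have "cfinite_dim (range (blinfun_apply (- c\<^sub>0)))"
    using z0 riesz_projection_eq[OF r D c0] by (simp add: discrete_spectrum_def)
  moreover have "range (blinfun_apply (- c\<^sub>0)) = range (blinfun_apply c\<^sub>0)"
  proof -
    have "blinfun_apply (- c\<^sub>0) x = blinfun_apply c\<^sub>0 (- x)" for x
      by (simp add: blinfun.minus_left blinfun.minus_right)
    then show ?thesis by (metis (no_types, lifting) minus_minus rangeE rangeI subsetI subset_antisym)
  qed
  ultimately have res0: "has_finite_residue (resolvent H\<^sub>0) z\<^sub>0 \<epsilon>\<^sub>0 c\<^sub>0"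
    by (intro resolvent_has_finite_residue[OF r D c0]) simp
  obtain RA RB RK where resA: "has_finite_residue (V1R0 H\<^sub>0 V\<^sub>1) z\<^sub>0 \<epsilon>\<^sub>0 RA"
    and resB: "has_finite_residue (R0V2adj H\<^sub>0 V\<^sub>2) z\<^sub>0 \<epsilon>\<^sub>0 RB" and resK: "has_finite_residue ?K z\<^sub>0 \<epsilon>\<^sub>0 RK"
    by (rule has_finite_residue_free[OF r D res0])
  obtain N c g where c: "\<And>k. c k \<in> \<F>" and g: "op_analytic_on g (ball z\<^sub>0 \<epsilon>\<^sub>0)"
    and Keq: "\<And>z. z \<in> ?D \<Longrightarrow> K z = principal_part N c z\<^sub>0 z + g z"
    using resK unfolding K_def[symmetric] by (rule has_finite_residueE) blast
  have KB: "K z \<in> \<B>" if "z \<in> \<rho> H\<^sub>0" for z using K_op(1)[OF that] by (simp add: K_def)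
  obtain L where L: "op_laurent_expansion K z\<^sub>0 \<epsilon>\<^sub>0 (Suc N) L" "L 0 = g z\<^sub>0" "\<And>k. L k \<in> \<B>"
    "\<And>k. 1 \<le> k \<Longrightarrow> L (- k) \<in> \<F>"
    using op_laurent_expansion_exists[OF r c g Keq] by metis
  have LK: "laurent_coeff K z\<^sub>0 = L" by (rule laurent_coeff_eq[OF L(1) r])
  have part1: "op_analytic_on K (\<rho> H\<^sub>0)" using op_analytic_on_K_op by (simp add: K_def)
  have part2: "finitely_meromorphic_on K (ball z\<^sub>0 \<epsilon>\<^sub>0)"
    using has_finite_residue_meromorphic_on[OF r resK] by (simp add: K_def)
  have part3: "\<exists>N\<^sub>0>0. op_laurent_expansion K z\<^sub>0 \<epsilon>\<^sub>0 N\<^sub>0 (laurent_coeff K z\<^sub>0) \<and>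
       (\<forall>k. 1 \<le> k \<and> k \<le> int N\<^sub>0 \<longrightarrow> laurent_coeff K z\<^sub>0 (- k) \<in> \<F>) \<and>
       (\<forall>k\<ge>0. laurent_coeff K z\<^sub>0 k \<in> \<B>)"
    unfolding LK using L by (intro exI[of _ "Suc N"]) auto
  have inv_M: "\<exists>G. is_inverse (M z) G" if z: "z \<in> ?D" for z
  proof -
    obtain b where b: "b \<in> \<rho> H\<^sub>0" "1 \<in> \<rho> (graph_of (K b))" using inv by blast
    then obtain G where G: "is_inverse (id_blinfun - K b) G"
      using one_in_resolvent_set_iff[OF KB[OF b(1)]] by blast
    have Hb: "b \<in> \<rho> H" "resolvent H b = resolvent H\<^sub>0 b - (R0V2adj H\<^sub>0 V\<^sub>2 b o\<^sub>L G o\<^sub>L V1R0 H\<^sub>0 V\<^sub>1 b)"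
      using H(2) b bounded_inverse_eq[OF G] by auto
    show ?thesis
      unfolding M_def K_def
      by (rule id_minus_K_op_invertible[OF b(1) G[unfolded K_def] Hb]) (use z D DH in blast)+
  qed
  define Mi where "Mi z = bounded_inverse (M z)" for z
  have Mi: "is_inverse (M z) (Mi z)" if z: "z \<in> ?D" for z
    using inv_M[OF z] bounded_inverse_eq unfolding Mi_def by metis
  have resM: "has_finite_residue M z\<^sub>0 \<epsilon>\<^sub>0 (0 - RK)"
    unfolding M_def K_def
    by (intro has_finite_residue_diff resK has_finite_residue_of_analytic op_analytic_on_const) auto
  \<comment> \<open>In this decomposition the regular part takes the value
    \<open>id_blinfun - g z\<^sub>0\<close> at \<open>z\<^sub>0\<close>, the zeroth Laurent
    coefficient; it is there that the inversion lemma requires a Fredholm operator.\<close>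
  have Meq: "M z = principal_part N (\<lambda>k. - c k) z\<^sub>0 z + (id_blinfun - g z)" if "z \<in> ?D" for z
    unfolding M_def Keq[OF that] by (simp add: principal_part_def sum_negf)
  have gM: "op_analytic_on (\<lambda>z. id_blinfun - g z) (ball z\<^sub>0 \<epsilon>\<^sub>0)"
    by (intro op_analytic_on_diff op_analytic_on_const g) auto
  obtain L' where L': "op_laurent_expansion M z\<^sub>0 \<epsilon>\<^sub>0 (Suc N) L'" "L' 0 = id_blinfun - g z\<^sub>0"
    using op_laurent_expansion_exists[OF r _ gM Meq] c by (metis finite_rank_uminus)
  have LM: "laurent_coeff M z\<^sub>0 = L'" by (rule laurent_coeff_eq[OF L'(1) r])
  have part4: "z\<^sub>0 \<in> \<sigma>\<^sub>d H" "0 < \<epsilon> \<Longrightarrow> \<epsilon> < \<epsilon>\<^sub>0 \<Longrightarrow>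
      complex_of_real (real (m\<^sub>a z\<^sub>0 H)) = complex_of_real (real (m\<^sub>a z\<^sub>0 H\<^sub>0)) + op_index M z\<^sub>0 \<epsilon>"
    if Phi: "id_blinfun - laurent_coeff K z\<^sub>0 0 \<in> \<Phi>" for \<epsilon>
  proof -
    have "id_blinfun - g z\<^sub>0 \<in> \<Phi>" using Phi by (simp add: LK L)
    then have "\<exists>R. has_finite_residue Mi z\<^sub>0 \<epsilon>\<^sub>0 R"
      using c by (intro Fredholm_inverse_meromorphic[OF r _ gM Meq _ Mi]) auto
    then obtain RMi where resMi: "has_finite_residue Mi z\<^sub>0 \<epsilon>\<^sub>0 RMi" ..
    obtain RF where resF: "has_finite_residue (\<lambda>z. R0V2adj H\<^sub>0 V\<^sub>2 z o\<^sub>L Mi z) z\<^sub>0 \<epsilon>\<^sub>0 RF"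
      using has_finite_residue_compose[OF r resB resMi] by blast
    obtain P S where P: "has_finite_residue (\<lambda>z. (R0V2adj H\<^sub>0 V\<^sub>2 z o\<^sub>L Mi z) o\<^sub>L V1R0 H\<^sub>0 V\<^sub>1 z) z\<^sub>0 \<epsilon>\<^sub>0 P"
      and S: "has_finite_residue (\<lambda>z. V1R0 H\<^sub>0 V\<^sub>1 z o\<^sub>L (R0V2adj H\<^sub>0 V\<^sub>2 z o\<^sub>L Mi z)) z\<^sub>0 \<epsilon>\<^sub>0 S"
      and tr: "op_trace P = op_trace S"
      using has_finite_residue_commuting[OF r resF resA] unfolding commuting_residues_def by blast
    have resH: "has_finite_residue (resolvent H) z\<^sub>0 \<epsilon>\<^sub>0 (c\<^sub>0 - P)"
    proof (rule has_finite_residue_cong[OF has_finite_residue_diff[OF res0 P]])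
      fix z assume z: "z \<in> ?D"
      then have "z \<in> \<rho> H\<^sub>0" using D by blast
      moreover have "1 \<in> \<rho> (graph_of (K z))"
        using inv_M[OF z] one_in_resolvent_set_iff[OF KB[OF \<open>z \<in> \<rho> H\<^sub>0\<close>]] by (simp add: M_def)
      ultimately show "resolvent H\<^sub>0 z - ((R0V2adj H\<^sub>0 V\<^sub>2 z o\<^sub>L Mi z) o\<^sub>L V1R0 H\<^sub>0 V\<^sub>1 z) = resolvent H z"
        using H(2) by (simp add: Mi_def M_def)
    qed
    note mult0 = alg_mult_eq_trace[OF r D res0] and multH = alg_mult_eq_trace[OF r DH resH]
    have "z\<^sub>0 isolated_in \<sigma> H"
      unfolding isolated_in_def using z0 eps0 by (intro conjI exI[of _ "ball z\<^sub>0 \<epsilon>\<^sub>0"]) auto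
    then show "z\<^sub>0 \<in> \<sigma>\<^sub>d H"
      unfolding discrete_spectrum_def
      using multH(1) resolvent_has_finite_residue_eigenvalue[OF r DH resH] z0 by simp
    assume \<epsilon>: "0 < \<epsilon>" "\<epsilon> < \<epsilon>\<^sub>0"
    have "has_finite_residue (\<lambda>z. op_deriv M z o\<^sub>L bounded_inverse (M z)) z\<^sub>0 \<epsilon>\<^sub>0 S"
    proof (rule has_finite_residue_cong[OF S])
      fix z assume "z \<in> ?D"
      then have "op_deriv M z = V1R0 H\<^sub>0 V\<^sub>1 z o\<^sub>L R0V2adj H\<^sub>0 V\<^sub>2 z"
        unfolding M_def K_def using D by (intro op_deriv_eq id_minus_K_op_has_deriv) auto
      then show "V1R0 H\<^sub>0 V\<^sub>1 z o\<^sub>L (R0V2adj H\<^sub>0 V\<^sub>2 z o\<^sub>L Mi z) = op_deriv M z o\<^sub>L bounded_inverse (M z)"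
        by (simp add: Mi_def blinfun_compose_assoc)
    qed
    from has_finite_residue_path_integral[OF this \<epsilon>] have "op_index M z\<^sub>0 \<epsilon> = op_trace P"
      by (simp add: op_index_def tr)
    moreover have "op_trace (c\<^sub>0 - P) = op_trace c\<^sub>0 - op_trace P"
      using op_trace_add[of c\<^sub>0 "- P"] op_trace_uminus[of P] has_finite_residue_finite_rank[OF res0]
        has_finite_residue_finite_rank[OF P] by auto
    ultimately show "complex_of_real (real (m\<^sub>a z\<^sub>0 H)) =
        complex_of_real (real (m\<^sub>a z\<^sub>0 H\<^sub>0)) + op_index M z\<^sub>0 \<epsilon>"
      using mult0(2) multH(2) by simp
  qed
  have part5: "op_analytic_on M (ball z\<^sub>0 \<epsilon>\<^sub>1 - {z\<^sub>0})" "finitely_meromorphic_on M (ball z\<^sub>0 \<epsilon>\<^sub>1)"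
    "\<forall>z\<in>ball z\<^sub>0 \<epsilon>\<^sub>1 - {z\<^sub>0}. M z \<in> \<Phi>" if "0 < \<epsilon>\<^sub>1" "\<epsilon>\<^sub>1 < \<epsilon>\<^sub>0" for \<epsilon>\<^sub>1
  proof -
    have "has_finite_residue M z\<^sub>0 \<epsilon>\<^sub>1 (0 - RK)"
      using that by (intro has_finite_residue_subset[OF resM]) simp
    then show "op_analytic_on M (ball z\<^sub>0 \<epsilon>\<^sub>1 - {z\<^sub>0})" "finitely_meromorphic_on M (ball z\<^sub>0 \<epsilon>\<^sub>1)"
      using has_finite_residue_analytic has_finite_residue_meromorphic_on that by blast+
    have "ball z\<^sub>0 \<epsilon>\<^sub>1 \<subseteq> ball z\<^sub>0 \<epsilon>\<^sub>0" using that by auto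
    then have "ball z\<^sub>0 \<epsilon>\<^sub>1 - {z\<^sub>0} \<subseteq> \<rho> H\<^sub>0" using D by blast
    then show "\<forall>z\<in>ball z\<^sub>0 \<epsilon>\<^sub>1 - {z\<^sub>0}. M z \<in> \<Phi>" using Fredholm unfolding M_def by blast
  qed
  \<comment> \<open>The inverse exists on the whole punctured disk, so
    \<open>\<epsilon>\<^sub>0\<close> serves as \<open>\<delta>\<close>.\<close>
  have part6: "\<exists>\<delta>>0. \<forall>z\<in>ball z\<^sub>0 \<delta> - {z\<^sub>0}. boundedly_invertible (M z)"
    using r inv_M boundedly_invertible_iff is_inverseD(1) by (intro exI[of _ \<epsilon>\<^sub>0]) blast
  have Mfun: "(\<lambda>z. id_blinfun - K z) = M" by (simp add: M_def fun_eq_iff)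
  show ?thesis
    unfolding Let_def Mfun
  proof (intro conjI impI allI)
    fix \<epsilon>\<^sub>1 \<epsilon>
    assume Phi: "id_blinfun - laurent_coeff K z\<^sub>0 0 \<in> \<Phi>" and \<epsilon>1: "0 < \<epsilon>\<^sub>1 \<and> \<epsilon>\<^sub>1 < \<epsilon>\<^sub>0"
    then show "laurent_coeff M z\<^sub>0 0 \<in> \<Phi>" by (simp add: LM L' LK L)
    assume "0 < \<epsilon> \<and> \<epsilon> < \<epsilon>\<^sub>1"
    then show "complex_of_real (real (m\<^sub>a z\<^sub>0 H)) = complex_of_real (real (m\<^sub>a z\<^sub>0 H\<^sub>0)) + op_index M z\<^sub>0 \<epsilon>"
      using part4(2)[OF Phi] \<epsilon>1 by auto
  qed (use part1 part2 part3 part4(1) part5 part6 in blast)+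
qed

end
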